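(* Let $n\ge 2$. 1. Let $I=I_\lambda$ be an ideal of the Lie algebra $\mathfrak{u}_n$, where $\lambda\in[1,\omega^{n-1}+\cdots+\omega+1]\cup\{0\}$. Then the Lie algebras $\mathfrak{u}_n$ and $\mathfrak{u}_n/I_\lambda$ are isomorphic if and only if $\lambda=i\omega^{n-2}$ for some $i\in\mathbb{N}$. 2. Let $I=I_\lambda$ and $J=I_\mu$ be ideals of $\mathfrak{u}_n$, where $\lambda,\mu\in[1,\omega^{n-1}+\cdots+\omega+1]\cup\{0\}$. Then the Lie algebras $\mathfrak{u}_n/I_\lambda$ and $\mathfrak{u}_n/I_\mu$ are isomorphic if and only if one of the following holds: (a) $\lambda=i\omega^{n-2}+\nu$ and $\mu=j\omega^{n-2}+\nu$ for some $i,j\in\mathbb{N}$ and $\nu\in[1,\omega^{n-2})\cup\{0\}$; or (b) $\lambda=\omega^{n-1}+\omega^{n-2}+\cdots+\omega^s+i\omega^{s-2}+\nu$ and $\mu=\omega^{n-1}+\omega^{n-2}+\cdots+\omega^s+j\omega^{s-2}+\nu$ for some $2\le s\le n-1$, $i,j\in\mathbb{N}$ and $\nu\in[1,\omega^{s-2})\cup\{0\}$; or (c) $\lambda=\mu=\omega^{n-1}+\omega^{n-2}+\cdots+\omega+\varepsilon$ where $\varepsilon\in\{0,1\}$.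
   Context: $K$ is a field of characteristic zero, $\mathbb{N}=\{0,1,\ldots\}$, $P_0=K$, $P_i=K[x_1,\ldots,x_i]$, $\partial_i=\partial/\partial x_i$. For $n\ge 2$, $\mathfrak{u}_n=K\partial_1+P_1\partial_2+\cdots+P_{n-1}\partial_n$, a Lie subalgebra of $\mathrm{Der}_K(P_n)$. $\mathfrak{u}_n$ has the $K$-basis $\mathcal{B}_n=\{X_{\alpha,i}=x^\alpha\partial_i \mid 1\le i\le n,\ \alpha\in\mathbb{N}^{i-1}\}$, where $x^\alpha=x_1^{\alpha_1}\cdots x_{i-1}^{\alpha_{i-1}}$. It is well ordered by: $X_{\alpha,i}>X_{\beta,j}$ iff $i<j$, or $i=j$ and for some $m$ one has $\alpha_m>\beta_m$ and $\alpha_k=\beta_k$ for all $m<k\le i-1$. Its order type is $\omega^{n-1}+\omega^{n-2}+\cdots+\omega+1$, where $\omega$ is the first infinite ordinal and $\omega^0=1$. For $X\in\mathcal{B}_n$ let $\mathrm{ord}(X)$ be the order type of $\{Y\in\mathcal{B}_n\mid Y\le X\}$. For an ordinal $\lambda$ with $1\le\lambda\le\omega^{n-1}+\cdots+\omega+1$ put $I_\lambda=\bigoplus\{KX\mid X\in\mathcal{B}_n,\ \mathrm{ord}(X)\le\lambda\}$, and $I_0=0$. Every ideal of $\mathfrak{u}_n$ equals $I_\lambda$ for a unique such $\lambda$. Intervals are intervals of ordinals; in particular $[1,\omega^0)=\emptyset$. For $i\in\mathbb{N}$, $i\omega^k$ denotes the $i$-fold sum $\omega^k+\cdots+\omega^k$.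 *)

theory Defs
  imports "HOL-Library.Poly_Mapping" "HOL-Library.FuncSet" "HOL-Library.Countable_Set"
begin

unbundle cardinal_syntax

section \<open>Countable ordinals\<close>

text \<open>
  An ordinal is an isomorphism class of well-orders on sets of natural numbers.  These are the
  countable ordinals, which include every ordinal up to \<open>\<omega>\<^sup>\<omega>\<close>.  Well-orders are the
  reflexive relations of the library predicate \<^const>\<open>Well_order\<close>; the underlying set of \<open>r\<close>
  is \<open>Field r\<close>.
\<close>

quotient_type ordinal = "nat rel" / partial: "\<lambda>r s. r =o s"
proof (rule part_equivpI)
  have "Well_order ({} :: nat rel)" by simp
  then show "\<exists>r::nat rel. r =o r" using ordIso_reflexive by blast
  show "symp (\<lambda>r s::nat rel. r =o s)" by (rule sympI) (rule ordIso_symmetric)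
  show "transp (\<lambda>r s::nat rel. r =o s)" by (rule transpI) (rule ordIso_transitive)
qed

text \<open>
  The order type of a well-order on a countable subset of an arbitrary type (unspecified on other
  relations).
\<close>

definition order_type :: "'a rel \<Rightarrow> ordinal" where
  "order_type r = abs_ordinal (SOME s. s =o r)"

lemma rep_ordinal_self: "rep_ordinal a =o rep_ordinal a"
  using Quotient_rep_reflp[OF Quotient_ordinal] by blast

lemma Well_order_rep_ordinal: "Well_order (rep_ordinal a)"
  using rep_ordinal_self[of a] unfolding ordIso_def by blast

lemma ordinal_eq_iff: "a = b \<longleftrightarrow> rep_ordinal a =o rep_ordinal b"
  using Quotient_rel_rep[OF Quotient_ordinal] by blast

lemma rep_abs_ordinal: "Well_order r \<Longrightarrow> rep_ordinal (abs_ordinal r) =o r"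
  using Quotient_rep_abs[OF Quotient_ordinal] ordIso_reflexive by blast

lemma rep_order_type:
  fixes r :: "'a rel"
  assumes "Well_order r" "countable (Field r)"
  shows "rep_ordinal (order_type r) =o r"
proof -
  from assms(2) obtain f :: "'a \<Rightarrow> nat" where f: "inj_on f (Field r)"
    by (auto simp: countable_def)
  have "dir_image r f =o r"
    using dir_image_ordIso[OF assms(1) f] ordIso_symmetric by blast
  then have *: "(SOME s::nat rel. s =o r) =o r" by (rule someI)
  then have "Well_order (SOME s::nat rel. s =o r)" unfolding ordIso_def by blast
  from ordIso_transitive[OF rep_abs_ordinal[OF this] *] show ?thesis
    unfolding order_type_def .
qed

instantiation ordinal :: linorder
begin

definition less_eq_ordinal :: "ordinal \<Rightarrow> ordinal \<Rightarrow> bool" where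
  "a \<le> b \<longleftrightarrow> rep_ordinal a \<le>o rep_ordinal b"

definition less_ordinal :: "ordinal \<Rightarrow> ordinal \<Rightarrow> bool" where
  "a < b \<longleftrightarrow> rep_ordinal a <o rep_ordinal b"

instance
proof
  fix a b c :: ordinal
  show "a < b \<longleftrightarrow> a \<le> b \<and> \<not> b \<le> a"
    unfolding less_eq_ordinal_def less_ordinal_def
    using not_ordLeq_iff_ordLess[OF Well_order_rep_ordinal Well_order_rep_ordinal]
      ordLess_imp_ordLeq by blast
  show "a \<le> a"
    unfolding less_eq_ordinal_def using Well_order_rep_ordinal ordLeq_reflexive by blast
  show "a \<le> b \<Longrightarrow> b \<le> c \<Longrightarrow> a \<le> c"
    unfolding less_eq_ordinal_def by (rule ordLeq_transitive)
  show "a \<le> b \<Longrightarrow> b \<le> a \<Longrightarrow> a = b"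
    unfolding less_eq_ordinal_def ordinal_eq_iff using ordIso_iff_ordLeq by blast
  show "a \<le> b \<or> b \<le> a"
    unfolding less_eq_ordinal_def using ordLeq_total Well_order_rep_ordinal by blast
qed

end

text \<open>The ordered sum: all of \<open>r\<close> precedes all of \<open>s\<close>.\<close>

definition order_sum :: "'a rel \<Rightarrow> 'b rel \<Rightarrow> ('a + 'b) rel" where
  "order_sum r s = {(Inl x, Inl y) | x y. (x, y) \<in> r} \<union> {(Inr x, Inr y) | x y. (x, y) \<in> s}
     \<union> {(Inl x, Inr y) | x y. x \<in> Field r \<and> y \<in> Field s}"

text \<open>The ordered product: \<open>s\<close> many copies of \<open>r\<close>, the second component being the significant one.\<close>

definition order_prod :: "'a rel \<Rightarrow> 'b rel \<Rightarrow> ('a \<times> 'b) rel" where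
  "order_prod r s = {((x, y), (x', y')) | x y x' y'.
     x \<in> Field r \<and> x' \<in> Field r \<and> y \<in> Field s \<and> y' \<in> Field s \<and>
     ((y \<noteq> y' \<and> (y, y') \<in> s) \<or> (y = y' \<and> (x, x') \<in> r))}"

instantiation ordinal :: "{zero, one, plus, times}"
begin

definition zero_ordinal :: ordinal where
  "0 = order_type ({} :: nat rel)"

definition one_ordinal :: ordinal where
  "1 = order_type {((), ())}"

definition plus_ordinal :: "ordinal \<Rightarrow> ordinal \<Rightarrow> ordinal" where
  "a + b = order_type (order_sum (rep_ordinal a) (rep_ordinal b))"

definition times_ordinal :: "ordinal \<Rightarrow> ordinal \<Rightarrow> ordinal" where
  "a * b = order_type (order_prod (rep_ordinal a) (rep_ordinal b))"

instance ..

end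

lemma in_order_sum [simp]:
  "(Inl x, Inl x') \<in> order_sum r s \<longleftrightarrow> (x, x') \<in> r"
  "(Inr y, Inr y') \<in> order_sum r s \<longleftrightarrow> (y, y') \<in> s"
  "(Inl x, Inr y) \<in> order_sum r s \<longleftrightarrow> x \<in> Field r \<and> y \<in> Field s"
  "(Inr y, Inl x) \<in> order_sum r s \<longleftrightarrow> False"
  by (auto simp: order_sum_def)

lemma Inl_in_Field_order_sum [simp]: "Inl x \<in> Field (order_sum r s) \<longleftrightarrow> x \<in> Field r"
proof
  show "Inl x \<in> Field (order_sum r s) \<Longrightarrow> x \<in> Field r"
    by (auto simp: Field_def order_sum_def)
  assume "x \<in> Field r"
  then obtain y where "(x, y) \<in> r \<or> (y, x) \<in> r" by (auto simp: Field_def)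
  then have "(Inl x, Inl y) \<in> order_sum r s \<or> (Inl y, Inl x) \<in> order_sum r s" by simp
  then show "Inl x \<in> Field (order_sum r s)" by (metis FieldI1 FieldI2)
qed

lemma Inr_in_Field_order_sum [simp]: "Inr y \<in> Field (order_sum r s) \<longleftrightarrow> y \<in> Field s"
proof
  show "Inr y \<in> Field (order_sum r s) \<Longrightarrow> y \<in> Field s"
    by (auto simp: Field_def order_sum_def)
  assume "y \<in> Field s"
  then obtain z where "(y, z) \<in> s \<or> (z, y) \<in> s" by (auto simp: Field_def)
  then have "(Inr y, Inr z) \<in> order_sum r s \<or> (Inr z, Inr y) \<in> order_sum r s" by simp
  then show "Inr y \<in> Field (order_sum r s)" by (metis FieldI1 FieldI2)
qed

lemma Field_order_sum: "Field (order_sum r s) = Inl ` Field r \<union> Inr ` Field s"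
proof (rule set_eqI)
  fix z show "z \<in> Field (order_sum r s) \<longleftrightarrow> z \<in> Inl ` Field r \<union> Inr ` Field s"
    by (cases z) auto
qed

lemma Well_order_order_sum:
  assumes "Well_order r" "Well_order s"
  shows "Well_order (order_sum r s)"
proof -
  let ?t = "order_sum r s"
  from assms have r: "Refl r" "trans r" "antisym r" "Total r" "wf (r - Id)"
    and s: "Refl s" "trans s" "antisym s" "Total s" "wf (s - Id)"
    by (simp_all add: order_on_defs)
  have "Refl ?t"
    using r(1) s(1) unfolding refl_on_def Field_order_sum by auto
  moreover have "trans ?t"
  proof (rule transI)
    fix x y z assume xy: "(x, y) \<in> ?t" and yz: "(y, z) \<in> ?t"
    show "(x, z) \<in> ?t"
    proof (cases x)
      case x: (Inl a)
      show ?thesis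
      proof (cases z)
        case z: (Inl c)
        with yz obtain b where "y = Inl b" by (cases y) auto
        with xy yz x z show ?thesis using transD[OF r(2), of a b c] by simp
      next
        case z: (Inr c)
        with xy yz x show ?thesis by (cases y) (auto intro: FieldI1 FieldI2)
      qed
    next
      case x: (Inr a)
      with xy obtain b where y: "y = Inr b" by (cases y) auto
      with yz obtain c where "z = Inr c" by (cases z) auto
      with xy yz x y show ?thesis using transD[OF s(2), of a b c] by simp
    qed
  qed
  moreover have "antisym ?t"
  proof (rule antisymI)
    fix x y assume "(x, y) \<in> ?t" "(y, x) \<in> ?t"
    then show "x = y"
      using r(3) s(3) by (cases x; cases y) (auto simp: antisym_def)
  qed
  moreover have "Total ?t"
    using r(4) s(4) unfolding total_on_def Field_order_sum by (auto; blast)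
  moreover have "wf (?t - Id)"
  proof (rule wfUNIVI)
    fix P z assume "\<forall>x. (\<forall>y. (y, x) \<in> ?t - Id \<longrightarrow> P y) \<longrightarrow> P x"
    then have step: "P x" if "\<And>y. (y, x) \<in> ?t - Id \<Longrightarrow> P y" for x using that by blast
    have l: "P (Inl x)" for x
      using r(5)
    proof (induction x rule: wf_induct_rule)
      case (less x)
      show ?case
      proof (rule step)
        fix y assume "(y, Inl x) \<in> ?t - Id"
        then show "P y" using less by (cases y) auto
      qed
    qed
    have "P (Inr x)" for x
      using s(5)
    proof (induction x rule: wf_induct_rule)
      case (less x)
      show ?case
      proof (rule step)
        fix y assume "(y, Inr x) \<in> ?t - Id"
        then show "P y" using less l by (cases y) auto
      qed
    qed
    with l show "P z" by (cases z) auto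
  qed
  moreover have "?t \<subseteq> Field ?t \<times> Field ?t" by (auto intro: FieldI1 FieldI2)
  ultimately show ?thesis by (simp add: order_on_defs)
qed

lemma ordIsoI:
  assumes "Well_order r" "Well_order s" "bij_betw f (Field r) (Field s)"
    and "\<And>x y. x \<in> Field r \<Longrightarrow> y \<in> Field r \<Longrightarrow> (x, y) \<in> r \<longleftrightarrow> (f x, f y) \<in> s"
  shows "r =o s"
proof -
  have "iso r s f" unfolding iso_iff2 using assms(3,4) by blast
  with assms(1,2) show ?thesis unfolding ordIso_def by blast
qed

lemma order_sum_cong:
  assumes "r =o r'" "s =o s'"
  shows "order_sum r s =o order_sum r' s'"
proof -
  from assms obtain f g where f: "iso r r' f" and g: "iso s s' g"
    and w: "Well_order r" "Well_order r'" "Well_order s" "Well_order s'"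
    unfolding ordIso_def by blast
  have bf: "bij_betw f (Field r) (Field r')" and bg: "bij_betw g (Field s) (Field s')"
    using f g unfolding iso_iff2 by auto
  have img: "map_sum f g ` Field (order_sum r s) = Field (order_sum r' s')"
    unfolding Field_order_sum image_Un image_image
    by (simp flip: bij_betw_imp_surj_on[OF bf] bij_betw_imp_surj_on[OF bg] add: image_image)
  have inj: "inj_on (map_sum f g) (Field (order_sum r s))"
  proof (rule inj_onI)
    fix x y assume "x \<in> Field (order_sum r s)" "y \<in> Field (order_sum r s)"
      "map_sum f g x = map_sum f g y"
    then show "x = y"
      using inj_onD[OF bij_betw_imp_inj_on[OF bf]] inj_onD[OF bij_betw_imp_inj_on[OF bg]]
      by (cases x; cases y) auto
  qed
  have f_mem: "f x \<in> Field r'" if "x \<in> Field r" for x using bf that by (rule bij_betwE[rule_format])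
  have g_mem: "g x \<in> Field s'" if "x \<in> Field s" for x using bg that by (rule bij_betwE[rule_format])
  have f_iff: "(f x, f y) \<in> r' \<longleftrightarrow> (x, y) \<in> r" if "x \<in> Field r" "y \<in> Field r" for x y
    using f that unfolding iso_iff2 by blast
  have g_iff: "(g x, g y) \<in> s' \<longleftrightarrow> (x, y) \<in> s" if "x \<in> Field s" "y \<in> Field s" for x y
    using g that unfolding iso_iff2 by blast
  show ?thesis
  proof (rule ordIsoI[OF Well_order_order_sum[OF w(1,3)] Well_order_order_sum[OF w(2,4)]])
    show "bij_betw (map_sum f g) (Field (order_sum r s)) (Field (order_sum r' s'))"
      using inj img by (simp add: bij_betw_def)
    fix x y assume "x \<in> Field (order_sum r s)" "y \<in> Field (order_sum r s)"
    then show "(x, y) \<in> order_sum r s \<longleftrightarrow> (map_sum f g x, map_sum f g y) \<in> order_sum r' s'"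
      by (cases x; cases y) (simp_all add: f_mem g_mem f_iff g_iff)
  qed
qed

lemma rep_plus_ordinal: "rep_ordinal (a + b) =o order_sum (rep_ordinal a) (rep_ordinal b)"
  unfolding plus_ordinal_def
  by (rule rep_order_type) (auto intro: Well_order_order_sum Well_order_rep_ordinal)

lemma rep_zero_ordinal: "rep_ordinal 0 =o ({} :: nat rel)"
  unfolding zero_ordinal_def by (rule rep_order_type) auto

instance ordinal :: monoid_add
proof
  fix a b c :: ordinal
  let ?a = "rep_ordinal a" and ?b = "rep_ordinal b" and ?c = "rep_ordinal c"
  note w = Well_order_rep_ordinal
  let ?f = "case_sum (case_sum Inl (Inr \<circ> Inl)) (Inr \<circ> Inr) ::
    (nat + nat) + nat \<Rightarrow> nat + (nat + nat)"
  have "order_sum (order_sum ?a ?b) ?c =o order_sum ?a (order_sum ?b ?c)"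
  proof (rule ordIsoI[where f = ?f])
    show "bij_betw ?f (Field (order_sum (order_sum ?a ?b) ?c)) (Field (order_sum ?a (order_sum ?b ?c)))"
      unfolding bij_betw_def Field_order_sum
      by (auto simp: inj_on_def image_Un image_image)
    fix x y
    show "(x, y) \<in> order_sum (order_sum ?a ?b) ?c \<longleftrightarrow>
      (?f x, ?f y) \<in> order_sum ?a (order_sum ?b ?c)"
      by (auto split: sum.splits)
  qed (intro Well_order_order_sum w)+
  then have "rep_ordinal (a + b + c) =o rep_ordinal (a + (b + c))"
    by (meson order_sum_cong rep_plus_ordinal rep_ordinal_self ordIso_transitive ordIso_symmetric)
  then show "a + b + c = a + (b + c)" by (simp add: ordinal_eq_iff)
  have "order_sum ({} :: nat rel) ?a =o ?a"
  proof (rule ordIsoI[where f = "case_sum id id"])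
    show "bij_betw (case_sum id id) (Field (order_sum ({} :: nat rel) ?a)) (Field ?a)"
      unfolding bij_betw_def Field_order_sum by (auto simp: inj_on_def image_image)
    fix x y assume "x \<in> Field (order_sum ({} :: nat rel) ?a)"
      "y \<in> Field (order_sum ({} :: nat rel) ?a)"
    then show "(x, y) \<in> order_sum {} ?a \<longleftrightarrow> (case_sum id id x, case_sum id id y) \<in> ?a"
      by (cases x; cases y) auto
  qed (auto intro: Well_order_order_sum w)
  then have "rep_ordinal (0 + a) =o ?a"
    by (meson order_sum_cong rep_plus_ordinal rep_zero_ordinal rep_ordinal_self ordIso_transitive)
  then show "0 + a = a" by (simp add: ordinal_eq_iff)
  have "order_sum ?a ({} :: nat rel) =o ?a"
  proof (rule ordIsoI[where f = "case_sum id id"])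
    show "bij_betw (case_sum id id) (Field (order_sum ?a ({} :: nat rel))) (Field ?a)"
      unfolding bij_betw_def Field_order_sum by (auto simp: inj_on_def image_image)
    fix x y assume "x \<in> Field (order_sum ?a ({} :: nat rel))"
      "y \<in> Field (order_sum ?a ({} :: nat rel))"
    then show "(x, y) \<in> order_sum ?a {} \<longleftrightarrow> (case_sum id id x, case_sum id id y) \<in> ?a"
      by (cases x; cases y) auto
  qed (auto intro: Well_order_order_sum w)
  then have "rep_ordinal (a + 0) =o ?a"
    by (meson order_sum_cong rep_plus_ordinal rep_zero_ordinal rep_ordinal_self ordIso_transitive)
  then show "a + 0 = a" by (simp add: ordinal_eq_iff)
qed

instance ordinal :: power ..

definition omega :: ordinal  (\<open>\<omega>\<close>) where
  "\<omega> = order_type {(i :: nat, j). i \<le> j}"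

text \<open>The \<open>i\<close>-fold sum \<open>a + \<dots> + a\<close>, that is, \<open>a\<close> times \<open>i\<close> with the factor \<open>i\<close> on the right.\<close>

definition nfold :: "nat \<Rightarrow> ordinal \<Rightarrow> ordinal"  (infixr \<open>\<cdot>\<close> 75) where
  "i \<cdot> a = sum_list (replicate i a)"

text \<open>\<open>omega_sum n s\<close> is \<open>\<omega>\<^bsup>n-1\<^esup> + \<omega>\<^bsup>n-2\<^esup> + \<dots> + \<omega>\<^bsup>s\<^esup>\<close>.\<close>

definition omega_sum :: "nat \<Rightarrow> nat \<Rightarrow> ordinal" where
  "omega_sum n s = (\<Sum>k\<leftarrow>rev [s..<n]. \<omega> ^ k)"


section \<open>Lie algebras\<close>

text \<open>
  The operations of a Lie algebra over the field \<^typ>\<open>'k\<close> whose underlying set is a subset of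
  \<^typ>\<open>'a\<close>; they are meaningful on the carrier only.
\<close>

record ('k, 'a) lie_algebra =
  carrier :: "'a set"
  add :: "'a \<Rightarrow> 'a \<Rightarrow> 'a"
  scale :: "'k \<Rightarrow> 'a \<Rightarrow> 'a"
  bracket :: "'a \<Rightarrow> 'a \<Rightarrow> 'a"

definition lie_isomorphic ::
    "('k, 'a) lie_algebra \<Rightarrow> ('k, 'b) lie_algebra \<Rightarrow> bool"  (infix \<open>\<cong>\<close> 50) where
  "L \<cong> M \<longleftrightarrow> (\<exists>f. bij_betw f (carrier L) (carrier M) \<and>
     (\<forall>x\<in>carrier L. \<forall>y\<in>carrier L. f (add L x y) = add M (f x) (f y)) \<and>
     (\<forall>c. \<forall>x\<in>carrier L. f (scale L c x) = scale M c (f x)) \<and>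
     (\<forall>x\<in>carrier L. \<forall>y\<in>carrier L. f (bracket L x y) = bracket M (f x) (f y)))"

definition lie_coset :: "('k, 'a) lie_algebra \<Rightarrow> 'a set \<Rightarrow> 'a \<Rightarrow> 'a set" where
  "lie_coset L I x = {add L x y | y. y \<in> I}"

text \<open>
  The quotient of a Lie algebra by an ideal.  Its operations are written as unions over all
  representatives; when \<open>I\<close> is an ideal all the cosets in each union coincide.
\<close>

definition lie_quotient :: "('k, 'a) lie_algebra \<Rightarrow> 'a set \<Rightarrow> ('k, 'a set) lie_algebra"
    (infixl \<open>'/'/\<^sub>L\<close> 65) where
  "L //\<^sub>L I =
     \<lparr> carrier = lie_coset L I ` carrier L,
       add = (\<lambda>A B. \<Union>x\<in>A. \<Union>y\<in>B. lie_coset L I (add L x y)),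
       scale = (\<lambda>c A. \<Union>x\<in>A. lie_coset L I (scale L c x)),
       bracket = (\<lambda>A B. \<Union>x\<in>A. \<Union>y\<in>B. lie_coset L I (bracket L x y)) \<rparr>"


section \<open>Polynomials and derivations\<close>

text \<open>
  Polynomials in the variables \<open>x\<^sub>0, x\<^sub>1, x\<^sub>2, \<dots>\<close>; an exponent vector is a finitely supported function
  and the product is the convolution product of \<^theory>\<open>HOL-Library.Poly_Mapping\<close>.  The variable
  \<open>x\<^sub>0\<close> is not used.
\<close>

type_synonym 'k mpoly = "(nat \<Rightarrow>\<^sub>0 nat) \<Rightarrow>\<^sub>0 'k"

type_synonym 'k operator = "'k mpoly \<Rightarrow> 'k mpoly"

definition Const :: "'k::zero \<Rightarrow> 'k mpoly" where
  "Const c = Poly_Mapping.single 0 c"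

definition monomial :: "(nat \<Rightarrow>\<^sub>0 nat) \<Rightarrow> 'k::zero_neq_one mpoly" where
  "monomial \<alpha> = Poly_Mapping.single \<alpha> 1"

text \<open>\<open>Polys n = K[x\<^sub>1, \<dots>, x\<^sub>n]\<close>\<close>

definition Polys :: "nat \<Rightarrow> 'k::zero mpoly set" where
  "Polys n = {p. \<forall>\<alpha>\<in>Poly_Mapping.keys p. Poly_Mapping.keys \<alpha> \<subseteq> {1..n}}"

text \<open>
  The partial derivative \<open>\<partial>/\<partial>x\<^sub>i\<close>.  The subtraction of exponents is truncated, but the coefficient
  vanishes wherever truncation takes effect.
\<close>

definition pderivative :: "nat \<Rightarrow> 'k::comm_semiring_1 operator"  (\<open>\<partial>\<close>) where
  "\<partial> i p = (\<Sum>\<alpha>\<in>Poly_Mapping.keys p.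
     Poly_Mapping.single (\<alpha> - Poly_Mapping.single i 1) (of_nat (Poly_Mapping.lookup \<alpha> i) * Poly_Mapping.lookup p \<alpha>))"

text \<open>
  The Lie algebra of \<open>K\<close>-derivations of \<open>Polys n\<close>.  Maps on \<open>Polys n\<close> are represented by functions that are
  \<^const>\<open>undefined\<close> outside \<open>Polys n\<close>.
\<close>

definition Der :: "nat \<Rightarrow> ('k::comm_ring_1, 'k operator) lie_algebra" where
  "Der n =
     \<lparr> carrier = {D \<in> Polys n \<rightarrow>\<^sub>E Polys n.
         (\<forall>p\<in>Polys n. \<forall>q\<in>Polys n. D (p + q) = D p + D q) \<and>
         (\<forall>c. \<forall>p\<in>Polys n. D (Const c * p) = Const c * D p) \<and>
         (\<forall>p\<in>Polys n. \<forall>q\<in>Polys n. D (p * q) = D p * q + p * D q)},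
       add = (\<lambda>D E. \<lambda>p\<in>Polys n. D p + E p),
       scale = (\<lambda>c D. \<lambda>p\<in>Polys n. Const c * D p),
       bracket = (\<lambda>D E. \<lambda>p\<in>Polys n. D (E p) - E (D p)) \<rparr>"

text \<open>
  \<open>\<uu> n = K \<partial>\<^sub>1 + P\<^sub>1 \<partial>\<^sub>2 + \<dots> + P\<^bsub>n-1\<^esub> \<partial>\<^sub>n\<close>, a subalgebra of \<open>Der n\<close>.
\<close>

definition triangular_derivations ::
    "nat \<Rightarrow> ('k::comm_ring_1, 'k operator) lie_algebra"  (\<open>\<uu>\<close>) where
  "\<uu> n = (Der n) \<lparr> carrier :=
     {(\<lambda>p\<in>Polys n. \<Sum>i=1..n. f i * \<partial> i p) | f. \<forall>i\<in>{1..n}. f i \<in> Polys (i - 1)} \<rparr>"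

section \<open>The ideals \<open>I\<^sub>\<lambda>\<close>\<close>

text \<open>The index set of the basis: pairs \<open>(\<alpha>, i)\<close> with \<open>1 \<le> i \<le> n\<close> and \<open>\<alpha> \<in> \<nat>\<^bsup>i-1\<^esup>\<close>.\<close>

definition basis_index :: "nat \<Rightarrow> ((nat \<Rightarrow>\<^sub>0 nat) \<times> nat) set" where
  "basis_index n = {(\<alpha>, i). 1 \<le> i \<and> i \<le> n \<and> Poly_Mapping.keys \<alpha> \<subseteq> {1..i - 1}}"

text \<open>\<open>basis_elem n (\<alpha>, i)\<close> is \<open>x\<^sup>\<alpha> \<partial>\<^sub>i\<close> as a derivation of \<open>Polys n\<close>.\<close>

definition basis_elem :: "nat \<Rightarrow> (nat \<Rightarrow>\<^sub>0 nat) \<times> nat \<Rightarrow> 'k::comm_semiring_1 operator" where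
  "basis_elem n = (\<lambda>(\<alpha>, i). \<lambda>p\<in>Polys n. monomial \<alpha> * \<partial> i p)"

definition basis :: "nat \<Rightarrow> 'k::comm_semiring_1 operator set" where
  "basis n = basis_elem n ` basis_index n"

text \<open>\<open>index_greater (\<alpha>, i) (\<beta>, j)\<close> is the condition for \<open>X\<^bsub>\<alpha>,i\<^esub> > X\<^bsub>\<beta>,j\<^esub>\<close>.\<close>

definition index_greater :: "(nat \<Rightarrow>\<^sub>0 nat) \<times> nat \<Rightarrow> (nat \<Rightarrow>\<^sub>0 nat) \<times> nat \<Rightarrow> bool" where
  "index_greater = (\<lambda>(\<alpha>, i) (\<beta>, j). i < j \<or>
     (i = j \<and> (\<exists>m\<in>{1..i - 1}. Poly_Mapping.lookup \<alpha> m > Poly_Mapping.lookup \<beta> m \<and>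
        (\<forall>k\<in>{m<..i - 1}. Poly_Mapping.lookup \<alpha> k = Poly_Mapping.lookup \<beta> k))))"

text \<open>The reflexive order on the basis; \<open>(Y, Z)\<close> belongs to it when \<open>Y \<le> Z\<close>.\<close>

definition basis_order :: "nat \<Rightarrow> 'k::comm_semiring_1 operator rel" where
  "basis_order n = {(basis_elem n b, basis_elem n a) | a b.
     a \<in> basis_index n \<and> b \<in> basis_index n \<and> (b = a \<or> index_greater a b)}"

text \<open>The order type of \<open>{Y \<in> basis n. Y \<le> Z}\<close>.\<close>

definition basis_ord :: "nat \<Rightarrow> 'k::comm_semiring_1 operator \<Rightarrow> ordinal" where
  "basis_ord n Z = order_type (Restr (basis_order n) {Y. (Y, Z) \<in> basis_order n})"

text \<open>
  The span of the basis elements of order at most \<open>a\<close>.  Every basis element has order at least \<open>1\<close>,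
  so this is the zero subspace for \<open>a = 0\<close>.
\<close>

definition ideal_upto :: "nat \<Rightarrow> ordinal \<Rightarrow> 'k::comm_semiring_1 operator set" where
  "ideal_upto n a = {(\<lambda>p\<in>Polys n. \<Sum>Z\<in>S. Const (c Z) * Z p) | c S.
     finite S \<and> S \<subseteq> {Z \<in> basis n. basis_ord n Z \<le> a}}"

end

theory Submission
  imports Defs "HOL-Library.Function_Algebras"
begin

text \<open>
  Everything is decided by the lattice of ideals together with the brackets of ideals.

  The ideals of \<open>\<uu> n\<close> are the spans of the initial segments of the basis
  (\<open>ideal_classification\<close>): bracketing an element with suitable basis elements yields elements whose
  leading terms descend as slowly as desired, so an ideal that contains an element with leading
  term \<open>X\<close> contains everything below \<open>X\<close>.  A proper initial segment is the set of all basis elements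
  below some \<open>x\<^sup>\<alpha> \<partial>\<^sub>s\<close>.  For \<open>s \<ge> 2\<close> its order type is
  \<open>\<omega>\<^bsup>n-1\<^esup> + \<dots> + \<omega>\<^sup>s + \<alpha>\<^bsub>s-1\<^esub> \<omega>\<^bsup>s-2\<^esup> + \<nu>\<close>, where \<open>\<nu> < \<omega>\<^bsup>s-2\<^esup>\<close> is the order type of the exponents below \<open>(\<alpha>\<^sub>1, \<dots>, \<alpha>\<^bsub>s-2\<^esub>)\<close> (\<open>ord_below\<close>).  In these terms the
  criterion says that the quotients by the ideals below \<open>x\<^sup>\<alpha> \<partial>\<^sub>s\<close> and below \<open>x\<^sup>\<beta> \<partial>\<^sub>t\<close> are isomorphic
  if and only if \<open>s = t\<close> and \<open>\<alpha>\<close>, \<open>\<beta>\<close> differ at most in the exponent of the last variable \<open>x\<^bsub>s-1\<^esub>\<close>.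

  Such exponents give isomorphic quotients because of the endomorphism that differentiates the
  coefficient of \<open>\<partial>\<^sub>s\<close> by \<open>x\<^bsub>s-1\<^esub>\<close>, keeps the coefficients before it and forgets those after it.  It is
  surjective up to the forgotten part, and the preimage of the ideal below \<open>x\<^sup>\<alpha> \<partial>\<^sub>s\<close> is the ideal below
  \<open>x\<^sup>\<alpha> x\<^bsub>s-1\<^esub> \<partial>\<^sub>s\<close> (\<open>isomorphic_step\<close>).

  Conversely, an isomorphism of quotients preserves every ideal that can be described by inclusions
  and brackets.  The derived series gives back \<open>s\<close>.  The centralizer \<open>C\<^sub>2\<close> of one of its terms and the
  centralizer \<open>C\<^sub>1\<close> of the least ideal properly above the following term enclose an interval of ideals
  whose order type is that of the exponents up to \<open>(\<alpha>\<^sub>1, \<dots>, \<alpha>\<^bsub>s-2\<^esub>)\<close>.  Order types determine initial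
  segments of a well-order, so the interval gives back these exponents (\<open>correspondence_not_less\<close>).

  Isomorphisms of quotients are handled as relations between representatives
  (\<open>correspondence\<close>), so that no lifts have to be chosen.
\<close>

section \<open>Polynomials and partial derivatives\<close>

abbreviation lookup :: "('a \<Rightarrow>\<^sub>0 'b::zero) \<Rightarrow> 'a \<Rightarrow> 'b" where
  "lookup \<equiv> Poly_Mapping.lookup"

abbreviation keys :: "('a \<Rightarrow>\<^sub>0 'b::zero) \<Rightarrow> 'a set" where
  "keys \<equiv> Poly_Mapping.keys"

abbreviation single :: "'a \<Rightarrow> 'b \<Rightarrow> 'a \<Rightarrow>\<^sub>0 'b::zero" where
  "single \<equiv> Poly_Mapping.single"

abbreviation unit_exp :: "nat \<Rightarrow> nat \<Rightarrow>\<^sub>0 nat"  (\<open>\<epsilon>\<close>) where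
  "\<epsilon> i \<equiv> single i 1"

lemma minus_unit_exp_add: "lookup \<alpha> i \<noteq> 0 \<Longrightarrow> \<alpha> - \<epsilon> i + \<epsilon> i = \<alpha>"
  by (rule poly_mapping_eqI) (auto simp: lookup_add lookup_minus lookup_single when_def)

text \<open>
  On coefficients \<open>\<partial> i\<close> is a weighted shift.  Most facts about it follow by comparing coefficients.
\<close>

lemma lookup_pderivative:
  "lookup (\<partial> i p) \<alpha> = of_nat (Suc (lookup \<alpha> i)) * lookup p (\<alpha> + \<epsilon> i)"
proof -
  have "lookup (\<partial> i p) \<alpha> = (\<Sum>\<beta>\<in>keys p.
      if \<beta> = \<alpha> + \<epsilon> i then of_nat (lookup \<beta> i) * lookup p \<beta> else 0)"
    unfolding pderivative_def lookup_sum
  proof (rule sum.cong[OF refl])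
    fix \<beta>
    show "lookup (single (\<beta> - \<epsilon> i) (of_nat (lookup \<beta> i) * lookup p \<beta>)) \<alpha> =
      (if \<beta> = \<alpha> + \<epsilon> i then of_nat (lookup \<beta> i) * lookup p \<beta> else 0)"
      using minus_unit_exp_add[of \<beta> i]
      by (cases "lookup \<beta> i = 0") (auto simp: lookup_single when_def lookup_add)
  qed
  also have "\<dots> = of_nat (Suc (lookup \<alpha> i)) * lookup p (\<alpha> + \<epsilon> i)"
    by (subst sum.delta) (auto simp: lookup_add in_keys_iff)
  finally show ?thesis .
qed

lemma keys_pderivative: "\<alpha> \<in> keys (\<partial> i p) \<Longrightarrow> \<alpha> + \<epsilon> i \<in> keys p"
  by (auto simp: in_keys_iff lookup_pderivative)

lemma pderivative_zero [simp]: "\<partial> i 0 = 0"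
  by (rule poly_mapping_eqI) (simp add: lookup_pderivative)

lemma pderivative_add: "\<partial> i (p + q) = \<partial> i p + \<partial> i q"
  by (rule poly_mapping_eqI) (simp add: lookup_pderivative lookup_add algebra_simps)

lemma pderivative_diff: "\<partial> i (p - q) = \<partial> i p - \<partial> i (q :: 'k::comm_ring_1 mpoly)"
  by (rule poly_mapping_eqI) (simp add: lookup_pderivative lookup_minus algebra_simps)

lemma pderivative_sum: "\<partial> i (\<Sum>x\<in>A. f x) = (\<Sum>x\<in>A. \<partial> i (f x))"
  by (induction A rule: infinite_finite_induct) (simp_all add: pderivative_add)

lemma pderivative_single:
  "\<partial> i (single \<alpha> c) = single (\<alpha> - \<epsilon> i) (of_nat (lookup \<alpha> i) * c)"
  by (cases "c = 0") (simp_all add: pderivative_def)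

lemma pderivative_commute: "\<partial> i (\<partial> j p) = \<partial> j (\<partial> i p)"
  by (rule poly_mapping_eqI)
    (auto simp: lookup_pderivative lookup_add lookup_single when_def ac_simps)

lemma mpoly_induct [case_names zero add]:
  fixes p :: "'k::comm_monoid_add mpoly"
  assumes "P 0" "\<And>\<alpha> c q. P q \<Longrightarrow> P (single \<alpha> c + q)"
  shows "P p"
proof -
  have "P (\<Sum>\<alpha>\<in>A. single \<alpha> (lookup p \<alpha>))" if "finite A" for A
    using that by (induction A rule: finite_induct) (simp_all add: assms)
  moreover have "p = (\<Sum>\<alpha>\<in>keys p. single \<alpha> (lookup p \<alpha>))"
    by (rule poly_mapping_eqI) (simp add: lookup_sum lookup_single when_def sum.delta' in_keys_iff)
  ultimately show ?thesis by (metis finite_keys)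
qed

text \<open>
  Both sides are bilinear, so monomials suffice.  There the truncated subtraction of exponents does no
  harm, since the coefficient vanishes whenever an exponent is truncated.
\<close>

lemma pderivative_mult: "\<partial> i (p * q) = \<partial> i p * q + p * \<partial> i q"
proof (induction p rule: mpoly_induct)
  case (add \<alpha> a p)
  have "\<partial> i (single \<alpha> a * q) =
    \<partial> i (single \<alpha> a) * q + single \<alpha> a * \<partial> i q"
  proof (induction q rule: mpoly_induct)
    case (add \<beta> b q)
    have 1: "single (\<alpha> + \<beta> - \<epsilon> i) (of_nat (lookup \<alpha> i) * (a * b)) =
      single (\<alpha> - \<epsilon> i + \<beta>) (of_nat (lookup \<alpha> i) * a * b)" for \<alpha> \<beta> :: "nat \<Rightarrow>\<^sub>0 nat" and a b :: 'a
    proof (cases "lookup \<alpha> i = 0")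
      case False
      then have "\<alpha> + \<beta> - \<epsilon> i = \<alpha> - \<epsilon> i + \<beta>"
        by (intro poly_mapping_eqI) (auto simp: lookup_add lookup_minus lookup_single when_def)
      then show ?thesis by (simp add: mult.assoc)
    qed simp
    have "\<partial> i (single \<alpha> a * single \<beta> b) =
      single (\<alpha> + \<beta> - \<epsilon> i) (of_nat (lookup \<alpha> i) * (a * b)) +
      single (\<beta> + \<alpha> - \<epsilon> i) (of_nat (lookup \<beta> i) * (b * a))"
      by (simp add: mult_single pderivative_single lookup_add distrib_right single_add
          mult.commute[of b a] add.commute[of \<beta> \<alpha>])
    also have "\<dots> = \<partial> i (single \<alpha> a) * single \<beta> b +
      single \<alpha> a * \<partial> i (single \<beta> b)"
      unfolding 1 pderivative_single mult_single by (simp add: ac_simps)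
    finally have "\<partial> i (single \<alpha> a * single \<beta> b) =
      \<partial> i (single \<alpha> a) * single \<beta> b +
      single \<alpha> a * \<partial> i (single \<beta> b)" .
    then show ?case by (simp only: add.IH distrib_left pderivative_add add.assoc add.commute add.left_commute)
  qed simp
  then show ?case by (simp only: add.IH distrib_right distrib_left pderivative_add add.assoc add.commute add.left_commute)
qed simp

lemma lookup_single_times_add:
  "lookup (single \<alpha> a * p) (\<alpha> + \<beta>) = a * lookup (p :: 'k::comm_semiring_1 mpoly) \<beta>"
proof (induction p rule: mpoly_induct)
  case (add \<gamma> c p)
  then show ?case
    by (simp add: distrib_left lookup_add mult_single lookup_single when_def)
qed simp

lemma Polys_0: "0 \<in> Polys n"
  by (simp add: Polys_def)

lemma Polys_add: "p \<in> Polys n \<Longrightarrow> q \<in> Polys n \<Longrightarrow> p + q \<in> Polys n"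
  using keys_add[of p q] unfolding Polys_def by blast

lemma Polys_diff: "p \<in> Polys n \<Longrightarrow> q \<in> Polys n \<Longrightarrow> p - q \<in> Polys n"
  for p q :: "'k::comm_ring_1 mpoly"
  using Polys_add[of p n "- q"] by (simp add: Polys_def in_keys_iff)

lemma keys_plus_exp: "keys (\<alpha> + \<beta>) = keys \<alpha> \<union> keys (\<beta> :: nat \<Rightarrow>\<^sub>0 nat)"
  by (auto simp: in_keys_iff lookup_add)

lemma Polys_mult: "p \<in> Polys n \<Longrightarrow> q \<in> Polys n \<Longrightarrow> p * q \<in> Polys n"
  using keys_mult[of p q] unfolding Polys_def by (fastforce simp: keys_plus_exp)

lemma Polys_sum: "(\<And>x. x \<in> A \<Longrightarrow> f x \<in> Polys n) \<Longrightarrow> (\<Sum>x\<in>A. f x) \<in> Polys n"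
  by (induction A rule: infinite_finite_induct) (auto simp: Polys_0 Polys_add)

lemma Polys_mono: "p \<in> Polys m \<Longrightarrow> m \<le> n \<Longrightarrow> p \<in> Polys n"
  unfolding Polys_def by fastforce

lemma Polys_pderivative: "p \<in> Polys n \<Longrightarrow> \<partial> i p \<in> Polys n"
  using keys_pderivative[of _ i p] unfolding Polys_def by (fastforce simp: keys_plus_exp)

lemma pderivative_eq_0: "p \<in> Polys m \<Longrightarrow> m < i \<Longrightarrow> \<partial> i p = 0"
proof (rule ccontr)
  assume p: "p \<in> Polys m" "m < i" and "\<partial> i p \<noteq> 0"
  then obtain \<alpha> where "\<alpha> \<in> keys (\<partial> i p)"
    by (metis lookup_zero not_in_keys_iff_lookup_eq_zero poly_mapping_eqI)
  then have "\<alpha> + \<epsilon> i \<in> keys p" by (rule keys_pderivative)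
  then have "i \<in> {1..m}" using p(1) unfolding Polys_def by (auto simp: keys_plus_exp)
  with p(2) show False by simp
qed

lemma pderivative_Const_mult: "\<partial> i (Const c * p) = Const c * \<partial> i p"
proof -
  have "\<partial> i (Const c) = 0" by (simp add: Const_def pderivative_single)
  then show ?thesis by (simp add: pderivative_mult)
qed

lemma lookup_Const_mult: "lookup (Const c * p) \<alpha> = c * lookup p \<alpha>" for p :: "'k::comm_semiring_1 mpoly"
  using lookup_single_times_add[of 0 c p \<alpha>] by (simp add: Const_def)

section \<open>Coordinates on the triangular derivations\<close>

type_synonym 'k tuple = "nat \<Rightarrow> 'k mpoly"

type_synonym index = "(nat \<Rightarrow>\<^sub>0 nat) \<times> nat"

definition support :: "'k::zero tuple \<Rightarrow> index set" where
  "support f = {(\<alpha>, i). \<alpha> \<in> keys (f i)}"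

text \<open>
  This is the span of the basis elements with index in \<open>S\<close> when \<open>S \<subseteq> basis_index n\<close>: membership then
  forces all but \<open>n\<close> components to vanish, so supports are finite.
\<close>

definition span_on :: "index set \<Rightarrow> 'k::zero tuple set" where
  "span_on S = {f. support f \<subseteq> S}"

text \<open>
  A tuple \<open>f\<close> stands for the derivation \<open>\<Sum> f\<^sub>j \<partial>\<^sub>j\<close>, and this is the commutator.  The sum stops
  before \<open>i\<close> because the \<open>i\<close>-th coefficients involve only the variables before \<open>x\<^sub>i\<close>.
\<close>

definition tuple_bracket :: "'k::comm_ring_1 tuple \<Rightarrow> 'k tuple \<Rightarrow> 'k tuple" where
  "tuple_bracket f g i = (\<Sum>j\<in>{1..<i}. f j * \<partial> j (g i) - g j * \<partial> j (f i))"

definition tuple_scale :: "'k::comm_ring_1 \<Rightarrow> 'k tuple \<Rightarrow> 'k tuple" where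
  "tuple_scale c f i = Const c * f i"

text \<open>
  Tuples are added pointwise on their whole type, without the restriction to \<open>Polys n\<close> that operators
  need, so the group laws of the type class apply to them.
\<close>

definition tuples :: "nat \<Rightarrow> ('k::comm_ring_1, 'k tuple) lie_algebra" where
  "tuples n = \<lparr> carrier = span_on (basis_index n), add = (+), scale = tuple_scale,
     bracket = tuple_bracket \<rparr>"

lemma tuples_simps [simp]:
  "carrier (tuples n) = span_on (basis_index n)"
  "add (tuples n) = (+)" "scale (tuples n) = tuple_scale" "bracket (tuples n) = tuple_bracket"
  by (simp_all add: tuples_def)

lemma in_support: "(\<alpha>, i) \<in> support f \<longleftrightarrow> lookup (f i) \<alpha> \<noteq> 0"
  by (simp add: support_def in_keys_iff)

lemma span_onD: "f \<in> span_on S \<Longrightarrow> lookup (f i) \<alpha> \<noteq> 0 \<Longrightarrow> (\<alpha>, i) \<in> S"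
  unfolding span_on_def using in_support[of \<alpha> i f] by auto

lemma span_onI: "(\<And>\<alpha> i. lookup (f i) \<alpha> \<noteq> 0 \<Longrightarrow> (\<alpha>, i) \<in> S) \<Longrightarrow> f \<in> span_on S"
  unfolding span_on_def using in_support[of _ _ f] by auto

lemma span_on_basis_index:
  "f \<in> span_on (basis_index n) \<longleftrightarrow>
    (\<forall>i. if i \<in> {1..n} then f i \<in> Polys (i - 1) else f i = 0)"
proof -
  have "f \<in> span_on (basis_index n) \<longleftrightarrow>
      (\<forall>i. \<forall>\<alpha>\<in>keys (f i). i \<in> {1..n} \<and> keys \<alpha> \<subseteq> {1..i - 1})"
    unfolding span_on_def support_def basis_index_def by auto
  moreover have "(\<forall>\<alpha>\<in>keys (f i). i \<in> {1..n} \<and> keys \<alpha> \<subseteq> {1..i - 1}) \<longleftrightarrow>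
      (if i \<in> {1..n} then f i \<in> Polys (i - 1) else f i = 0)" for i
    by (cases "i \<in> {1..n}") (auto simp: Polys_def in_keys_iff intro: poly_mapping_eqI)
  ultimately show ?thesis by simp
qed

lemma span_on_component:
  assumes "f \<in> span_on (basis_index n)"
  shows "f i \<in> Polys (i - 1)" "i \<notin> {1..n} \<Longrightarrow> f i = 0"
  using assms unfolding span_on_basis_index by (auto simp: Polys_0 split: if_splits)

lemma span_on_mono: "S \<subseteq> T \<Longrightarrow> span_on S \<subseteq> span_on T"
  by (auto simp: span_on_def)

lemma lookup_tuple_scale: "lookup (tuple_scale c f i) \<alpha> = c * lookup (f i) \<alpha>"
  by (simp add: tuple_scale_def lookup_Const_mult)

lemma span_on_0: "0 \<in> span_on S"
  by (rule span_onI) simp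

lemma span_on_add: "f \<in> span_on S \<Longrightarrow> g \<in> span_on S \<Longrightarrow> f + g \<in> span_on S"
  by (rule span_onI) (metis add_0 lookup_add plus_fun_apply span_onD)

lemma span_on_scale: "f \<in> span_on S \<Longrightarrow> tuple_scale c f \<in> span_on S"
  by (rule span_onI) (metis lookup_tuple_scale mult_zero_right span_onD)

lemma tuple_bracket_add:
  "tuple_bracket (f + g) h = tuple_bracket f h + tuple_bracket g h"
  "tuple_bracket h (f + g) = tuple_bracket h f + tuple_bracket h g"
  by (simp_all add: fun_eq_iff tuple_bracket_def pderivative_add algebra_simps
      sum.distrib sum_subtractf)

lemma tuple_bracket_commute: "tuple_bracket f g = - tuple_bracket g f"
  by (simp add: fun_eq_iff tuple_bracket_def flip: sum_negf)

lemma tuple_bracket_closed: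
  assumes "f \<in> span_on (basis_index n)" "g \<in> span_on (basis_index n)"
  shows "tuple_bracket f g \<in> span_on (basis_index n)"
proof -
  have f: "f j \<in> Polys (i - 1)" and g: "g j \<in> Polys (i - 1)" if "j \<le> i" for i j
    using span_on_component(1)[OF assms(1), of j] span_on_component(1)[OF assms(2), of j] that
    by (auto elim: Polys_mono)
  have "tuple_bracket f g i \<in> Polys (i - 1)" for i
    unfolding tuple_bracket_def
    by (intro Polys_sum Polys_diff Polys_mult Polys_pderivative f g) auto
  moreover have "tuple_bracket f g i = 0" if "i \<notin> {1..n}" for i
    using span_on_component(2)[OF assms(1) that] span_on_component(2)[OF assms(2) that]
    by (simp add: tuple_bracket_def)
  ultimately show ?thesis unfolding span_on_basis_index by simp
qed

definition derivation :: "nat \<Rightarrow> 'k::comm_ring_1 tuple \<Rightarrow> 'k operator" where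
  "derivation n f = (\<lambda>p\<in>Polys n. \<Sum>i=1..n. f i * \<partial> i p)"

lemma triangular_derivations_simps [simp]:
  "add (\<uu> n) = (\<lambda>D E. \<lambda>p\<in>Polys n. D p + E p)"
  "scale (\<uu> n) = (\<lambda>c D. \<lambda>p\<in>Polys n. Const c * D p)"
  "bracket (\<uu> n) = (\<lambda>D E. \<lambda>p\<in>Polys n. D (E p) - E (D p))"
  by (simp_all add: triangular_derivations_def Der_def)

lemma carrier_triangular_derivations:
  "carrier (\<uu> n) = derivation n ` span_on (basis_index n)"
proof -
  have "(\<lambda>p\<in>Polys n. \<Sum>i=1..n. f i * \<partial> i p) \<in> derivation n ` span_on (basis_index n)"
    if "\<forall>i\<in>{1..n}. f i \<in> Polys (i - 1)" for f :: "'a tuple"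
  proof
    show "(\<lambda>i. if i \<in> {1..n} then f i else 0) \<in> span_on (basis_index n)"
      using that by (simp add: span_on_basis_index)
    show "(\<lambda>p\<in>Polys n. \<Sum>i=1..n. f i * \<partial> i p) =
      derivation n (\<lambda>i. if i \<in> {1..n} then f i else 0)"
      unfolding derivation_def by (intro restrict_ext sum.cong) auto
  qed
  moreover have "derivation n f \<in> carrier (\<uu> n)" if "f \<in> span_on (basis_index n)" for f :: "'a tuple"
    unfolding triangular_derivations_def derivation_def
    using span_on_component(1)[OF that] by auto
  ultimately show ?thesis
    by (auto simp: triangular_derivations_def)
qed

lemma pderivative_variable: "\<partial> i (monomial (\<epsilon> j)) = (if i = j then 1 else 0)"
  by (simp add: monomial_def pderivative_single lookup_single flip: single_one)

lemma variable_in_Polys: "i \<in> {1..n} \<Longrightarrow> monomial (\<epsilon> i) \<in> Polys n"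
  by (simp add: Polys_def monomial_def)

text \<open>
  The coefficients can be read off from the operator, so no two tuples give the same derivation.
\<close>

lemma derivation_variable:
  "i \<in> {1..n} \<Longrightarrow> derivation n f (monomial (\<epsilon> i)) = f i"
  by (simp add: derivation_def variable_in_Polys pderivative_variable if_distrib[of "\<lambda>x. _ * x"]
      sum.delta del: One_nat_def cong: if_cong)

lemma inj_on_derivation: "inj_on (derivation n) (span_on (basis_index n))"
proof (rule inj_onI, rule ext)
  fix f g :: "'a tuple" and i
  assume "f \<in> span_on (basis_index n)" "g \<in> span_on (basis_index n)"
    "derivation n f = derivation n g"
  then show "f i = g i"
    using derivation_variable[of i n f] derivation_variable[of i n g]
      span_on_component(2)[of f n i] span_on_component(2)[of g n i] by metis
qed

lemma bij_betw_derivation: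
  "bij_betw (derivation n) (carrier (tuples n)) (carrier (\<uu> n))"
  by (simp add: bij_betw_def inj_on_derivation carrier_triangular_derivations)

lemma derivation_add: "add (\<uu> n) (derivation n f) (derivation n g) = derivation n (f + g)"
  by (auto simp: derivation_def restrict_def fun_eq_iff distrib_right sum.distrib)

lemma derivation_scale: "scale (\<uu> n) c (derivation n f) = derivation n (tuple_scale c f)"
  by (auto simp: derivation_def restrict_def fun_eq_iff tuple_scale_def sum_distrib_left mult.assoc)

text \<open>
  In the commutator of \<open>\<Sum> f\<^sub>j \<partial>\<^sub>j\<close> and \<open>\<Sum> g\<^sub>i \<partial>\<^sub>i\<close> the second order terms cancel because partial
  derivatives commute; triangularity cuts the remaining sums down to \<open>j < i\<close>.
\<close>

lemma derivation_bracket: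
  assumes f: "f \<in> span_on (basis_index n)" and g: "g \<in> span_on (basis_index n)"
  shows "bracket (\<uu> n) (derivation n f) (derivation n g) = derivation n (tuple_bracket f g)"
proof -
  have P: "derivation n h p \<in> Polys n" if "h \<in> span_on (basis_index n)" "p \<in> Polys n"
    for h p
    using that(2) Polys_mono[OF span_on_component(1)[OF that(1)], of _ n] unfolding derivation_def
    by (auto intro!: Polys_sum Polys_mult Polys_pderivative)
  have comp: "derivation n f (derivation n g p) =
      (\<Sum>i=1..n. \<Sum>j=1..n. f j * \<partial> j (g i) * \<partial> i p) + (\<Sum>i=1..n. \<Sum>j=1..n. f i * g j * \<partial> i (\<partial> j p))"
    if "p \<in> Polys n" "g \<in> span_on (basis_index n)" for f g :: "'a tuple" and p
  proof -
    have "derivation n f (derivation n g p) = (\<Sum>j=1..n. f j * \<partial> j (\<Sum>i=1..n. g i * \<partial> i p))"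
      using P[OF that(2,1)] that(1) by (simp add: derivation_def)
    also have "\<dots> = (\<Sum>j=1..n. \<Sum>i=1..n. f j * \<partial> j (g i) * \<partial> i p) +
        (\<Sum>j=1..n. \<Sum>i=1..n. f j * g i * \<partial> j (\<partial> i p))"
      by (simp add: pderivative_sum pderivative_mult sum_distrib_left distrib_left sum.distrib mult.assoc)
    also have "(\<Sum>j=1..n. \<Sum>i=1..n. f j * \<partial> j (g i) * \<partial> i p) =
        (\<Sum>i=1..n. \<Sum>j=1..n. f j * \<partial> j (g i) * \<partial> i p)" by (rule sum.swap)
    finally show ?thesis .
  qed
  have sym: "(\<Sum>i=1..n. \<Sum>j=1..n. f i * g j * \<partial> i (\<partial> j p)) =
      (\<Sum>i=1..n. \<Sum>j=1..n. g i * f j * \<partial> i (\<partial> j p))" for p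
    by (subst sum.swap) (simp add: pderivative_commute mult.commute)
  have br: "tuple_bracket f g i = (\<Sum>j=1..n. f j * \<partial> j (g i) - g j * \<partial> j (f i))" if "i \<le> n" for i
    unfolding tuple_bracket_def
  proof (rule sum.mono_neutral_left)
    show "\<forall>j\<in>{1..n} - {1..<i}. f j * \<partial> j (g i) - g j * \<partial> j (f i) = 0"
    proof
      fix j assume "j \<in> {1..n} - {1..<i}"
      then have "i - 1 < j" by auto
      then show "f j * \<partial> j (g i) - g j * \<partial> j (f i) = 0"
        using span_on_component(1)[OF f, of i] span_on_component(1)[OF g, of i]
        by (simp add: pderivative_eq_0)
    qed
  qed (use that in auto)
  have "derivation n f (derivation n g p) - derivation n g (derivation n f p) =
      derivation n (tuple_bracket f g) p" if "p \<in> Polys n" for p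
  proof -
    have "derivation n f (derivation n g p) - derivation n g (derivation n f p) =
        (\<Sum>i=1..n. (\<Sum>j=1..n. f j * \<partial> j (g i) - g j * \<partial> j (f i)) * \<partial> i p)"
      unfolding comp[OF that g] comp[OF that f] sym
      by (simp add: sum_distrib_right left_diff_distrib sum_subtractf)
    also have "\<dots> = derivation n (tuple_bracket f g) p"
      using that br by (simp add: derivation_def)
    finally show ?thesis .
  qed
  then show ?thesis
    by (auto simp: fun_eq_iff restrict_def) (simp add: derivation_def)
qed

subsection \<open>Spans of basis elements\<close>

definition basis_tuple :: "index \<Rightarrow> 'k::comm_ring_1 tuple" where
  "basis_tuple b = (\<lambda>i. if i = snd b then monomial (fst b) else 0)"

lemma lookup_basis_tuple: "lookup (basis_tuple b i) \<alpha> = (if (\<alpha>, i) = b then 1 else 0)"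
  by (cases b) (auto simp: basis_tuple_def monomial_def lookup_single when_def)

lemma basis_tuple_supported: "basis_tuple b \<in> span_on S \<longleftrightarrow> b \<in> S"
  by (cases b) (auto simp: span_on_def in_support lookup_basis_tuple split: if_splits)

lemma derivation_basis_tuple:
  "b \<in> basis_index n \<Longrightarrow> derivation n (basis_tuple b) = basis_elem n b"
  unfolding derivation_def basis_elem_def basis_index_def
  by (auto simp: basis_tuple_def if_distrib[of "\<lambda>x. x * _"] sum.delta cong: if_cong
      intro!: restrict_ext)

lemma inj_basis_tuple: "inj (basis_tuple :: index \<Rightarrow> 'k::comm_ring_1 tuple)"
  by (rule injI) (metis lookup_basis_tuple prod.collapse zero_neq_one)

lemma inj_on_basis_elem: "inj_on (basis_elem n :: index \<Rightarrow> 'k::comm_ring_1 operator) (basis_index n)"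
proof (rule inj_onI)
  fix b c assume b: "b \<in> basis_index n" and c: "c \<in> basis_index n"
    and eq: "basis_elem n b = (basis_elem n c :: 'k operator)"
  from b c have "(basis_tuple b :: 'k tuple) \<in> span_on (basis_index n)"
    "(basis_tuple c :: 'k tuple) \<in> span_on (basis_index n)"
    by (simp_all add: basis_tuple_supported)
  with eq b c have "(basis_tuple b :: 'k tuple) = basis_tuple c"
    using inj_onD[OF inj_on_derivation] by (metis derivation_basis_tuple)
  then show "b = c" using inj_basis_tuple by (metis injD)
qed

lemma finite_support: "f \<in> span_on (basis_index n) \<Longrightarrow> finite (support f)"
proof -
  assume "f \<in> span_on (basis_index n)"
  then have "support f \<subseteq> (\<lambda>(i, \<alpha>). (\<alpha>, i)) ` (SIGMA i:{1..n}. keys (f i))"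
    unfolding span_on_def support_def basis_index_def by force
  then show "finite (support f)" by (rule finite_subset) auto
qed

lemma sum_fun_apply: "(\<Sum>x\<in>A. f x) i = (\<Sum>x\<in>A. f x i)"
  by (induction A rule: infinite_finite_induct) auto

lemma tuple_as_sum:
  assumes "finite T" "support f \<subseteq> T"
  shows "f = (\<Sum>b\<in>T. tuple_scale (lookup (f (snd b)) (fst b)) (basis_tuple b))"
proof (intro ext poly_mapping_eqI)
  fix i \<alpha>
  have "lookup ((\<Sum>b\<in>T. tuple_scale (lookup (f (snd b)) (fst b)) (basis_tuple b)) i) \<alpha> =
      (\<Sum>b\<in>T. if (\<alpha>, i) = b then lookup (f i) \<alpha> else 0)"
    unfolding sum_fun_apply lookup_sum
    by (intro sum.cong) (auto simp: lookup_tuple_scale lookup_basis_tuple)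
  also have "\<dots> = lookup (f i) \<alpha>"
    using assms by (auto simp: sum.delta' in_support subset_iff)
  finally show "lookup (f i) \<alpha> =
      lookup ((\<Sum>b\<in>T. tuple_scale (lookup (f (snd b)) (fst b)) (basis_tuple b)) i) \<alpha>" ..
qed

lemma span_on_sum: "(\<And>x. x \<in> A \<Longrightarrow> f x \<in> span_on S) \<Longrightarrow> (\<Sum>x\<in>A. f x) \<in> span_on S"
  by (induction A rule: infinite_finite_induct) (auto simp: span_on_0 span_on_add)

lemma derivation_sum:
  "p \<in> Polys n \<Longrightarrow> derivation n (\<Sum>x\<in>A. f x) p = (\<Sum>x\<in>A. derivation n (f x) p)"
  by (simp add: derivation_def sum_fun_apply sum_distrib_right) (rule sum.swap)

text \<open>
  This moves the ideals into coordinates, where membership is a condition on the support.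
\<close>

lemma ideal_upto_eq:
  "(ideal_upto n a :: 'k::comm_ring_1 operator set) = derivation n ` span_on
    {b \<in> basis_index n. basis_ord n (basis_elem n b :: 'k operator) \<le> a}" (is "_ = _ ` span_on ?B")
proof (intro equalityI subsetI)
  fix D :: "'k operator" assume "D \<in> ideal_upto n a"
  then obtain c S where D: "D = (\<lambda>p\<in>Polys n. \<Sum>Z\<in>S. Const (c Z) * Z p)" and "finite S"
    "S \<subseteq> {Z \<in> basis n. basis_ord n Z \<le> a}" unfolding ideal_upto_def by auto
  then have "S \<subseteq> basis_elem n ` ?B" by (auto simp: basis_def)
  with \<open>finite S\<close> obtain T where T: "T \<subseteq> ?B" "finite T" "S = basis_elem n ` T"
    by (meson finite_subset_image)
  then have inj: "inj_on (basis_elem n :: index \<Rightarrow> 'k operator) T"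
    using inj_on_basis_elem inj_on_subset by blast
  let ?f = "\<Sum>b\<in>T. tuple_scale (c (basis_elem n b)) (basis_tuple b)"
  have "D = derivation n ?f"
  proof
    fix p
    show "D p = derivation n ?f p"
    proof (cases "p \<in> Polys n")
      case True
      then have "D p = (\<Sum>b\<in>T. Const (c (basis_elem n b)) * basis_elem n b p)"
        by (simp add: D T(3) sum.reindex[OF inj])
      also have "\<dots> = (\<Sum>b\<in>T. derivation n (tuple_scale (c (basis_elem n b)) (basis_tuple b)) p)"
        using T(1) True
        by (intro sum.cong) (auto simp: derivation_scale[symmetric] derivation_basis_tuple)
      finally show ?thesis using True by (simp add: derivation_sum)
    qed (simp add: D derivation_def)
  qed
  moreover have "?f \<in> span_on ?B"
    using T(1) by (intro span_on_sum span_on_scale) (auto simp: basis_tuple_supported)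
  ultimately show "D \<in> derivation n ` span_on ?B" by blast
next
  fix D :: "'k operator" assume "D \<in> derivation n ` span_on ?B"
  then obtain f where f: "f \<in> span_on ?B" and D: "D = derivation n f" by auto
  define T where "T = support f"
  have T: "T \<subseteq> ?B" using f by (simp add: span_on_def T_def)
  have "f \<in> span_on (basis_index n)" using f span_on_mono[of ?B "basis_index n"] by auto
  then have fin: "finite T" by (simp add: T_def finite_support)
  have inj: "inj_on (basis_elem n :: index \<Rightarrow> 'k operator) T"
    using inj_on_subset[OF inj_on_basis_elem, of T n] T by auto
  define c where "c Z = (let b = inv_into T (basis_elem n) Z in lookup (f (snd b)) (fst b))"
    for Z :: "'k operator"
  have "D p = (\<lambda>p\<in>Polys n. \<Sum>Z\<in>basis_elem n ` T. Const (c Z) * Z p) p" for p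
  proof (cases "p \<in> Polys n")
    case True
    have "D p = (\<Sum>b\<in>T. derivation n (tuple_scale (lookup (f (snd b)) (fst b)) (basis_tuple b)) p)"
      unfolding D by (subst tuple_as_sum[of T f]) (simp_all add: fin T_def[symmetric] derivation_sum True)
    also have "\<dots> = (\<Sum>b\<in>T. Const (c (basis_elem n b)) * basis_elem n b p)"
      using T True
      by (intro sum.cong)
        (auto simp: derivation_scale[symmetric] derivation_basis_tuple c_def inv_into_f_f[OF inj])
    finally show ?thesis using True by (simp add: sum.reindex[OF inj])
  qed (simp add: D derivation_def)
  then have "D = (\<lambda>p\<in>Polys n. \<Sum>Z\<in>basis_elem n ` T. Const (c Z) * Z p)" ..
  moreover have "basis_elem n ` T \<subseteq> {Z \<in> basis n :: 'k operator set. basis_ord n Z \<le> a}"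
    using T by (auto simp: basis_def)
  ultimately show "D \<in> ideal_upto n a"
    unfolding ideal_upto_def using fin by blast
qed

section \<open>The order on the basis\<close>

text \<open>
  Comparison at the last exponent that differs, for vectors of any length.  On the vectors of one
  block it is the order of the basis, and it is invariant under translations.
\<close>

definition colex :: "(nat \<Rightarrow>\<^sub>0 nat) \<Rightarrow> (nat \<Rightarrow>\<^sub>0 nat) \<Rightarrow> bool"  (infix \<open>\<lhd>\<close> 50) where
  "\<alpha> \<lhd> \<beta> \<longleftrightarrow> (\<exists>m. lookup \<alpha> m < lookup \<beta> m \<and> (\<forall>k>m. lookup \<alpha> k = lookup \<beta> k))"

definition index_less :: "index \<Rightarrow> index \<Rightarrow> bool"  (infix \<open>\<prec>\<close> 50) where
  "b \<prec> c \<longleftrightarrow> snd c < snd b \<or> (snd b = snd c \<and> fst b \<lhd> fst c)"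

lemma index_less_Pair: "(\<alpha>, i) \<prec> (\<beta>, j) \<longleftrightarrow> j < i \<or> (i = j \<and> \<alpha> \<lhd> \<beta>)"
  by (simp add: index_less_def)

lemma colex_irrefl [simp]: "\<not> \<alpha> \<lhd> \<alpha>"
  by (simp add: colex_def)

lemma colex_trans: "\<alpha> \<lhd> \<beta> \<Longrightarrow> \<beta> \<lhd> \<gamma> \<Longrightarrow> \<alpha> \<lhd> \<gamma>"
proof -
  assume "\<alpha> \<lhd> \<beta>" "\<beta> \<lhd> \<gamma>"
  then obtain k l where k: "lookup \<alpha> k < lookup \<beta> k" "\<forall>m>k. lookup \<alpha> m = lookup \<beta> m"
    and l: "lookup \<beta> l < lookup \<gamma> l" "\<forall>m>l. lookup \<beta> m = lookup \<gamma> m"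
    unfolding colex_def by blast
  have "lookup \<alpha> (max k l) < lookup \<gamma> (max k l)"
    by (cases k l rule: linorder_cases) (use k l in \<open>auto simp: max_def\<close>)
  moreover have "\<forall>m>max k l. lookup \<alpha> m = lookup \<gamma> m" using k(2) l(2) by simp
  ultimately show ?thesis unfolding colex_def by blast
qed

lemma colex_total: "\<alpha> \<noteq> \<beta> \<Longrightarrow> \<alpha> \<lhd> \<beta> \<or> \<beta> \<lhd> \<alpha>"
proof -
  assume "\<alpha> \<noteq> \<beta>"
  define D where "D = {k. lookup \<alpha> k \<noteq> lookup \<beta> k}"
  have mem: "k \<in> D \<longleftrightarrow> lookup \<alpha> k \<noteq> lookup \<beta> k" for k by (simp add: D_def)
  then have "D \<subseteq> keys \<alpha> \<union> keys \<beta>" by (auto simp: in_keys_iff)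
  then have fin: "finite D" by (rule finite_subset) simp
  have "D \<noteq> {}" using \<open>\<alpha> \<noteq> \<beta>\<close> mem by (auto intro: poly_mapping_eqI)
  with fin have "Max D \<in> D" by (rule Max_in)
  moreover have "k \<notin> D" if "k > Max D" for k
    using that Max_ge[OF fin] leD by blast
  ultimately have "lookup \<alpha> (Max D) \<noteq> lookup \<beta> (Max D)" "\<forall>k>Max D. lookup \<alpha> k = lookup \<beta> k"
    unfolding mem[symmetric] by (blast intro: mem[THEN iffD2])+
  then show ?thesis
    unfolding colex_def by (cases "lookup \<alpha> (Max D) < lookup \<beta> (Max D)") (auto intro!: exI[of _ "Max D"])
qed

lemma colex_add: "\<alpha> + \<gamma> \<lhd> \<beta> + \<gamma> \<longleftrightarrow> \<alpha> \<lhd> \<beta>"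
  by (simp add: colex_def lookup_add)

lemma colex_pointwise: "(\<And>k. lookup \<alpha> k \<le> lookup \<beta> k) \<Longrightarrow> \<alpha> = \<beta> \<or> \<alpha> \<lhd> \<beta>"
  using colex_total[of \<alpha> \<beta>] unfolding colex_def by (metis linorder_not_less)

lemma index_less_irrefl [simp]: "\<not> b \<prec> b"
  by (simp add: index_less_def)

lemma index_less_trans: "b \<prec> c \<Longrightarrow> c \<prec> d \<Longrightarrow> b \<prec> d"
  unfolding index_less_def using colex_trans by auto

lemma index_le_not_less: "c = b \<or> b \<prec> c \<Longrightarrow> \<not> c \<prec> b"
  using index_less_trans[of b c b] by auto

lemma index_less_total: "b \<noteq> c \<Longrightarrow> b \<prec> c \<or> c \<prec> b"
  unfolding index_less_def using colex_total by (metis linorder_neqE_nat prod.collapse)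

text \<open>
  First minimise the exponent of the last variable, then continue with the remaining variables.
\<close>

lemma colex_least:
  assumes "A \<noteq> {}" "\<And>\<alpha>. \<alpha> \<in> A \<Longrightarrow> keys \<alpha> \<subseteq> {..<m}"
  shows "\<exists>\<alpha>\<in>A. \<forall>\<beta>\<in>A. \<beta> = \<alpha> \<or> \<alpha> \<lhd> \<beta>"
  using assms
proof (induction m arbitrary: A)
  case 0
  then have "\<alpha> = 0" if "\<alpha> \<in> A" for \<alpha> using that by force
  with 0 show ?case by auto
next
  case (Suc m)
  let ?P = "\<lambda>c. \<exists>\<alpha>\<in>A. lookup \<alpha> m = c"
  define c where "c = (LEAST c. ?P c)"
  have "\<exists>c. ?P c" using Suc.prems(1) by blast
  then have c: "?P c" unfolding c_def by (rule LeastI_ex)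
  have c_le: "c \<le> lookup \<alpha> m" if "\<alpha> \<in> A" for \<alpha>
    unfolding c_def by (rule Least_le) (use that in blast)
  let ?s = "single m c"
  define A' where "A' = {\<alpha>. \<alpha> + ?s \<in> A \<and> lookup \<alpha> m = 0}"
  have shift: "\<alpha> - ?s \<in> A'" "\<alpha> - ?s + ?s = \<alpha>" if "\<alpha> \<in> A" "lookup \<alpha> m = c" for \<alpha>
  proof -
    show *: "\<alpha> - ?s + ?s = \<alpha>"
      using that(2) by (intro poly_mapping_eqI) (auto simp: lookup_add lookup_minus lookup_single when_def)
    show "\<alpha> - ?s \<in> A'"
      unfolding A'_def using * that by (simp add: lookup_minus)
  qed
  have "A' \<noteq> {}" using c shift by blast
  moreover have "keys \<alpha> \<subseteq> {..<m}" if "\<alpha> \<in> A'" for \<alpha>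
  proof
    fix k assume k: "k \<in> keys \<alpha>"
    have "k \<noteq> m" using k that by (auto simp: A'_def in_keys_iff)
    moreover have "k \<in> keys (\<alpha> + ?s)" using k by (auto simp: keys_plus_exp)
    ultimately show "k \<in> {..<m}" using that Suc.prems(2)[of "\<alpha> + ?s"] by (auto simp: A'_def)
  qed
  ultimately obtain \<alpha> where \<alpha>: "\<alpha> \<in> A'" "\<forall>\<beta>\<in>A'. \<beta> = \<alpha> \<or> \<alpha> \<lhd> \<beta>"
    using Suc.IH by blast
  show ?case
  proof (intro bexI ballI)
    show "\<alpha> + ?s \<in> A" using \<alpha>(1) by (simp add: A'_def)
    fix \<beta> assume \<beta>: "\<beta> \<in> A"
    show "\<beta> = \<alpha> + ?s \<or> \<alpha> + ?s \<lhd> \<beta>"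
    proof (cases "lookup \<beta> m = c")
      case True
      with \<alpha>(2) shift[OF \<beta>] have "\<beta> - ?s = \<alpha> \<or> \<alpha> \<lhd> \<beta> - ?s" by blast
      then show ?thesis using shift(2)[OF \<beta> True] colex_add by metis
    next
      case False
      with c_le[OF \<beta>] have "lookup (\<alpha> + ?s) m < lookup \<beta> m"
        using \<alpha>(1) by (simp add: lookup_add A'_def)
      moreover have "lookup (\<alpha> + ?s) k = lookup \<beta> k" if "k > m" for k
      proof -
        have "k \<notin> keys \<beta>" "k \<notin> keys (\<alpha> + ?s)"
          using that Suc.prems(2)[OF \<beta>] Suc.prems(2)[of "\<alpha> + ?s"] \<alpha>(1) by (auto simp: A'_def)
        then show ?thesis by (simp only: in_keys_iff not_not)
      qed
      ultimately show ?thesis unfolding colex_def by blast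
    qed
  qed
qed

lemma basis_index_least:
  assumes "B \<subseteq> basis_index n" "B \<noteq> {}"
  shows "\<exists>b\<in>B. \<forall>c\<in>B. c = b \<or> b \<prec> c"
proof -
  let ?J = "snd ` B"
  have fin: "finite ?J"
    by (rule finite_subset[of _ "{1..n}"]) (use assms(1) in \<open>auto simp: basis_index_def\<close>)
  define i where "i = Max ?J"
  have i: "i \<in> ?J" and max: "\<And>j. j \<in> ?J \<Longrightarrow> j \<le> i"
    using assms(2) fin by (auto simp: i_def intro!: Max_in)
  let ?A = "{\<alpha>. (\<alpha>, i) \<in> B}"
  have "?A \<noteq> {}" using i by auto
  moreover have "keys \<alpha> \<subseteq> {..<i}" if "\<alpha> \<in> ?A" for \<alpha>
    using that assms(1) by (force simp: basis_index_def)
  ultimately obtain \<alpha> where \<alpha>: "(\<alpha>, i) \<in> B" "\<forall>\<beta>\<in>?A. \<beta> = \<alpha> \<or> \<alpha> \<lhd> \<beta>"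
    using colex_least[of ?A i] by blast
  have "c = (\<alpha>, i) \<or> (\<alpha>, i) \<prec> c" if "c \<in> B" for c
  proof -
    obtain \<beta> j where c: "c = (\<beta>, j)" by (cases c)
    then have "j \<le> i" using max[of j] that by force
    with that \<alpha>(2) show ?thesis by (cases "j = i") (auto simp: c index_less_Pair)
  qed
  with \<alpha>(1) show ?thesis by blast
qed

lemma wf_index_less: "wf {(b, c). b \<in> basis_index n \<and> c \<in> basis_index n \<and> b \<prec> c}" (is "wf ?r")
proof (rule wfI_min)
  fix x Q assume "x \<in> (Q :: index set)"
  show "\<exists>z\<in>Q. \<forall>y. (y, z) \<in> ?r \<longrightarrow> y \<notin> Q"
  proof (cases "Q \<inter> basis_index n = {}")
    case True
    then show ?thesis using \<open>x \<in> Q\<close> by blast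
  next
    case False
    then obtain b where "b \<in> Q \<inter> basis_index n" "\<forall>c\<in>Q \<inter> basis_index n. c = b \<or> b \<prec> c"
      using basis_index_least[of "Q \<inter> basis_index n" n] by blast
    then show ?thesis
      using index_le_not_less[of _ b] by (intro bexI[of _ b]) blast+
  qed
qed

text \<open>
  Initial segments of the basis, as sets of indices.
\<close>

definition downset :: "nat \<Rightarrow> index set \<Rightarrow> bool" where
  "downset n S \<longleftrightarrow> S \<subseteq> basis_index n \<and> (\<forall>b\<in>S. \<forall>c\<in>basis_index n. c \<prec> b \<longrightarrow> c \<in> S)"

definition below :: "nat \<Rightarrow> index \<Rightarrow> index set" where
  "below n b = {c \<in> basis_index n. c \<prec> b}"

lemma downset_below: "downset n (below n b)"
  unfolding downset_def below_def using index_less_trans by blast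

lemma downset_basis_index: "downset n (basis_index n)"
  by (simp add: downset_def)

text \<open>
  The complement of a proper downset has a least element \<open>b\<close>, and everything below \<open>b\<close> belongs to the
  downset.
\<close>

lemma downset_cases:
  assumes "downset n S"
  obtains "S = basis_index n" | b where "b \<in> basis_index n" "S = below n b"
proof (cases "basis_index n - S = {}")
  case True
  then show ?thesis using that(1) assms by (auto simp: downset_def)
next
  case False
  then obtain b where b: "b \<in> basis_index n - S" "\<forall>c\<in>basis_index n - S. c = b \<or> b \<prec> c"
    using basis_index_least[of "basis_index n - S" n] by blast
  have "S = below n b"
  proof (intro equalityI subsetI)
    fix c assume c: "c \<in> S"
    then have "c \<in> basis_index n" "c \<noteq> b" "\<not> b \<prec> c"
      using assms b(1) unfolding downset_def by blast+
    then show "c \<in> below n b" using index_less_total[of c b] by (auto simp: below_def)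
  next
    fix c assume "c \<in> below n b"
    then show "c \<in> S" using b(2) index_le_not_less[of c b] unfolding below_def by blast
  qed
  with b(1) show ?thesis using that(2) by blast
qed

lemma downset_linear: "downset n S \<Longrightarrow> downset n T \<Longrightarrow> S \<subseteq> T \<or> T \<subseteq> S"
proof -
  assume S: "downset n S" and T: "downset n T"
  {
    fix b c assume "b \<in> S" "b \<notin> T" "c \<in> T"
    then have "c \<prec> b" using S T index_less_total[of b c] unfolding downset_def by blast
    then have "c \<in> S" using S T \<open>b \<in> S\<close> \<open>c \<in> T\<close> unfolding downset_def by blast
  }
  then show ?thesis by blast
qed

lemma below_subset_iff:
  "c \<in> basis_index n \<Longrightarrow> below n b \<subseteq> below n c \<longleftrightarrow> b = c \<or> b \<prec> c"
  unfolding below_def using index_less_total[of b c] index_less_trans[of _ b c] by auto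

lemma below_inj: "b \<in> basis_index n \<Longrightarrow> c \<in> basis_index n \<Longrightarrow> below n b = below n c \<Longrightarrow> b = c"
  using below_subset_iff[of b n c] below_subset_iff[of c n b] index_less_trans[of b c b] by auto

lemma downset_not_mem: "downset n S \<Longrightarrow> b \<in> basis_index n \<Longrightarrow> b \<notin> S \<Longrightarrow> S \<subseteq> below n b"
proof
  fix c assume *: "downset n S" "b \<in> basis_index n" "b \<notin> S" "c \<in> S"
  then have "c \<noteq> b" "\<not> b \<prec> c" "c \<in> basis_index n" unfolding downset_def by blast+
  then show "c \<in> below n b" using index_less_total[of c b] by (simp add: below_def)
qed

section \<open>The ideals\<close>

definition ideal :: "nat \<Rightarrow> 'k::comm_ring_1 tuple set \<Rightarrow> bool" where
  "ideal n A \<longleftrightarrow> A \<subseteq> span_on (basis_index n) \<and> 0 \<in> A \<and>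
     (\<forall>f\<in>A. \<forall>g\<in>A. f + g \<in> A) \<and> (\<forall>c. \<forall>f\<in>A. tuple_scale c f \<in> A) \<and>
     (\<forall>f\<in>span_on (basis_index n). \<forall>g\<in>A. tuple_bracket f g \<in> A)"

lemma lookup_sum_nonzero: "lookup (\<Sum>x\<in>A. f x) \<alpha> \<noteq> 0 \<Longrightarrow> \<exists>x\<in>A. lookup (f x) \<alpha> \<noteq> 0"
  unfolding lookup_sum by (meson sum.neutral)

lemma lookup_mult_nonzero:
  "lookup (p * q) \<alpha> \<noteq> 0 \<Longrightarrow> \<exists>\<beta> \<gamma>. \<alpha> = \<beta> + \<gamma> \<and> lookup p \<beta> \<noteq> 0 \<and> lookup q \<gamma> \<noteq> 0"
  using keys_mult[of p q] unfolding in_keys_iff[symmetric] by blast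

lemma lookup_pderivative_nonzero: "lookup (\<partial> i p) \<alpha> \<noteq> 0 \<Longrightarrow> lookup p (\<alpha> + \<epsilon> i) \<noteq> 0"
  by (auto simp: lookup_pderivative)

text \<open>
  All estimates of brackets rest on this description of the monomials that can occur in them.
\<close>

lemma tuple_bracket_nonzero:
  assumes "lookup (tuple_bracket f g i) \<alpha> \<noteq> 0"
  obtains j \<beta> \<gamma> where "1 \<le> j" "j < i" "\<alpha> = \<beta> + \<gamma>"
    "lookup (f j) \<beta> \<noteq> 0 \<and> lookup (g i) (\<gamma> + \<epsilon> j) \<noteq> 0 \<or>
     lookup (g j) \<beta> \<noteq> 0 \<and> lookup (f i) (\<gamma> + \<epsilon> j) \<noteq> 0"
proof -
  from lookup_sum_nonzero[OF assms[unfolded tuple_bracket_def]]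
  obtain j where j: "j \<in> {1..<i}" "lookup (f j * \<partial> j (g i) - g j * \<partial> j (f i)) \<alpha> \<noteq> 0" by blast
  then have "lookup (f j * \<partial> j (g i)) \<alpha> \<noteq> 0 \<or> lookup (g j * \<partial> j (f i)) \<alpha> \<noteq> 0"
    by (auto simp: lookup_minus)
  then show ?thesis
    using j(1) by (auto dest!: lookup_mult_nonzero lookup_pderivative_nonzero intro: that)
qed

lemma colex_add_small:
  assumes "keys \<beta> \<subseteq> {..<j}"
  shows "\<beta> + \<gamma> \<lhd> \<gamma> + \<epsilon> j"
  unfolding colex_def
proof (intro exI[of _ j] conjI allI impI)
  show "lookup (\<beta> + \<gamma>) j < lookup (\<gamma> + \<epsilon> j) j"
    using assms by (auto simp: lookup_add in_keys_iff subset_iff)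
  fix k assume "j < k"
  then show "lookup (\<beta> + \<gamma>) k = lookup (\<gamma> + \<epsilon> j) k"
    using assms by (auto simp: lookup_add lookup_single in_keys_iff subset_iff)
qed

text \<open>
  Brackets never move upwards.  An element of the ideal may be differentiated by \<open>x\<^sub>j\<close>, which lowers
  its exponent more than the factor in the variables before \<open>x\<^sub>j\<close> can raise it, or it may
  differentiate another coefficient, which leads to a later block.
\<close>

lemma ideal_span_on:
  assumes "downset n S"
  shows "ideal n (span_on S :: 'k::comm_ring_1 tuple set)"
  unfolding ideal_def
proof (intro conjI ballI allI)
  show "span_on S \<subseteq> (span_on (basis_index n) :: 'k tuple set)"
    using assms by (intro span_on_mono) (simp add: downset_def)
  fix f g :: "'k tuple"
  assume f: "f \<in> span_on (basis_index n)" and g: "g \<in> span_on S"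
  then have g': "g \<in> span_on (basis_index n)"
    using assms span_on_mono[of S] by (auto simp: downset_def)
  show "tuple_bracket f g \<in> span_on S"
  proof (rule span_onI)
    fix \<alpha> i assume nz: "lookup (tuple_bracket f g i) \<alpha> \<noteq> 0"
    then have W: "(\<alpha>, i) \<in> basis_index n"
      using span_onD[OF tuple_bracket_closed[OF f g']] by blast
    from nz obtain j \<beta> \<gamma> where j: "1 \<le> j" "j < i" and \<alpha>: "\<alpha> = \<beta> + \<gamma>" and
      alt: "lookup (f j) \<beta> \<noteq> 0 \<and> lookup (g i) (\<gamma> + \<epsilon> j) \<noteq> 0 \<or>
        lookup (g j) \<beta> \<noteq> 0 \<and> lookup (f i) (\<gamma> + \<epsilon> j) \<noteq> 0"
      by (rule tuple_bracket_nonzero)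
    show "(\<alpha>, i) \<in> S"
    proof (cases "lookup (g j) \<beta> = 0")
      case True
      with alt have "(\<beta>, j) \<in> basis_index n" and S: "(\<gamma> + \<epsilon> j, i) \<in> S"
        using span_onD[OF f] span_onD[OF g] by blast+
      then have "\<beta> + \<gamma> \<lhd> \<gamma> + \<epsilon> j"
        by (intro colex_add_small) (force simp: basis_index_def)
      then have "(\<alpha>, i) \<prec> (\<gamma> + \<epsilon> j, i)" by (simp add: \<alpha> index_less_Pair)
      with S W assms show ?thesis unfolding downset_def by blast
    next
      case False
      then have "(\<beta>, j) \<in> S" using span_onD[OF g] by blast
      moreover have "(\<alpha>, i) \<prec> (\<beta>, j)" using j by (simp add: index_less_Pair)
      ultimately show ?thesis using W assms unfolding downset_def by blast
    qed
  qed
qed (auto intro: span_on_0 span_on_add span_on_scale)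

definition leading :: "'k::zero tuple \<Rightarrow> index \<Rightarrow> bool" where
  "leading f b \<longleftrightarrow> b \<in> support f \<and> (\<forall>c\<in>support f. c = b \<or> c \<prec> b)"

lemma leadingD:
  assumes "leading f (\<alpha>, i)"
  shows "lookup (f i) \<alpha> \<noteq> 0" "j < i \<Longrightarrow> f j = 0" "lookup (f i) \<beta> \<noteq> 0 \<Longrightarrow> \<beta> = \<alpha> \<or> \<beta> \<lhd> \<alpha>"
proof -
  show "lookup (f i) \<alpha> \<noteq> 0" using assms by (simp add: leading_def in_support)
  have *: "(\<beta>, k) = (\<alpha>, i) \<or> (\<beta>, k) \<prec> (\<alpha>, i)" if "lookup (f k) \<beta> \<noteq> 0" for \<beta> k
    using assms that unfolding leading_def in_support[symmetric] by blast
  show "lookup (f i) \<beta> \<noteq> 0 \<Longrightarrow> \<beta> = \<alpha> \<or> \<beta> \<lhd> \<alpha>"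
    using *[of i \<beta>] by (auto simp: index_less_Pair)
  show "j < i \<Longrightarrow> f j = 0"
    using *[of j] by (intro poly_mapping_eqI) (force simp: index_less_Pair)
qed

lemma leadingI:
  assumes "lookup (f i) \<alpha> \<noteq> 0" "\<And>j. j < i \<Longrightarrow> f j = 0"
    "\<And>\<beta>. lookup (f i) \<beta> \<noteq> 0 \<Longrightarrow> \<beta> = \<alpha> \<or> \<beta> \<lhd> \<alpha>"
  shows "leading f (\<alpha>, i)"
  unfolding leading_def
proof (intro conjI ballI)
  show "(\<alpha>, i) \<in> support f" using assms(1) by (simp add: in_support)
  fix c assume "c \<in> support f"
  then obtain \<beta> j where c: "c = (\<beta>, j)" "lookup (f j) \<beta> \<noteq> 0" by (cases c) (auto simp: in_support)
  then have "\<not> j < i" using assms(2)[of j] by auto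
  with c assms(3)[of \<beta>] show "c = (\<alpha>, i) \<or> c \<prec> (\<alpha>, i)"
    by (cases "j = i") (auto simp: index_less_Pair)
qed

lemma lookup_monomial_times:
  "lookup (monomial \<delta> * p) (\<delta> + \<gamma>) = lookup p \<gamma>"
  "lookup (monomial \<delta> * p) \<beta> \<noteq> 0 \<Longrightarrow> \<exists>\<gamma>. \<beta> = \<delta> + \<gamma> \<and> lookup p \<gamma> \<noteq> 0"
  for p :: "'k::comm_ring_1 mpoly"
  using lookup_mult_nonzero[of "monomial \<delta>" p \<beta>]
  by (auto simp: monomial_def lookup_single_times_add lookup_single when_def split: if_splits)

lemma bracket_basis_tuple:
  fixes f :: "'k::comm_ring_1 tuple"
  assumes "\<And>l. l < i \<Longrightarrow> f l = 0" "1 \<le> k" "k < i"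
  shows "tuple_bracket (basis_tuple (\<delta>, k)) f i = monomial \<delta> * \<partial> k (f i)"
    "j < i \<Longrightarrow> tuple_bracket (basis_tuple (\<delta>, k)) f j = 0"
proof -
  have "tuple_bracket (basis_tuple (\<delta>, k)) f i =
      (\<Sum>l\<in>{1..<i}. if l = k then monomial \<delta> * \<partial> k (f i) else 0)"
    unfolding tuple_bracket_def using assms by (intro sum.cong) (auto simp: basis_tuple_def)
  also have "\<dots> = monomial \<delta> * \<partial> k (f i)"
    using assms by (subst sum.delta) auto
  finally show "tuple_bracket (basis_tuple (\<delta>, k)) f i = monomial \<delta> * \<partial> k (f i)" .
  show "tuple_bracket (basis_tuple (\<delta>, k)) f j = 0" if "j < i"
    unfolding tuple_bracket_def using assms(1) that by (intro sum.neutral) auto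
qed

text \<open>
  Differentiation by \<open>x\<^sub>k\<close> and multiplication by a monomial preserve the order of exponents, so the
  leading term of the bracket comes from the leading term of \<open>f\<close>.  Characteristic zero keeps its
  coefficient from vanishing.
\<close>

lemma leading_bracket_same_block:
  fixes f :: "'k::field_char_0 tuple"
  assumes f: "leading f (\<alpha>, i)" and k: "1 \<le> k" "k < i" "lookup \<alpha> k \<noteq> 0"
  shows "leading (tuple_bracket (basis_tuple (\<delta>, k)) f) (\<delta> + (\<alpha> - \<epsilon> k), i)"
proof (rule leadingI)
  have br: "tuple_bracket (basis_tuple (\<delta>, k)) f i = monomial \<delta> * \<partial> k (f i)"
    using leadingD(2)[OF f] k by (intro bracket_basis_tuple(1)) auto
  have \<alpha>: "\<alpha> - \<epsilon> k + \<epsilon> k = \<alpha>" using k(3) by (rule minus_unit_exp_add)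
  show "lookup (tuple_bracket (basis_tuple (\<delta>, k)) f i) (\<delta> + (\<alpha> - \<epsilon> k)) \<noteq> 0"
    using leadingD(1)[OF f] \<alpha> by (simp add: br lookup_monomial_times lookup_pderivative del: of_nat_Suc)
  show "tuple_bracket (basis_tuple (\<delta>, k)) f j = 0" if "j < i" for j
    using leadingD(2)[OF f] k that by (intro bracket_basis_tuple(2)) auto
  show "\<beta> = \<delta> + (\<alpha> - \<epsilon> k) \<or> \<beta> \<lhd> \<delta> + (\<alpha> - \<epsilon> k)"
    if nz: "lookup (tuple_bracket (basis_tuple (\<delta>, k)) f i) \<beta> \<noteq> 0" for \<beta>
  proof -
    from nz[unfolded br] obtain \<gamma> where \<beta>: "\<beta> = \<delta> + \<gamma>" and "lookup (f i) (\<gamma> + \<epsilon> k) \<noteq> 0"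
      by (blast dest: lookup_monomial_times(2) lookup_pderivative_nonzero)
    then have "\<gamma> + \<epsilon> k = \<alpha> - \<epsilon> k + \<epsilon> k \<or> \<gamma> + \<epsilon> k \<lhd> \<alpha> - \<epsilon> k + \<epsilon> k"
      unfolding \<alpha> using leadingD(3)[OF f] by blast
    then have "\<gamma> = \<alpha> - \<epsilon> k \<or> \<gamma> \<lhd> \<alpha> - \<epsilon> k" unfolding colex_add by simp
    then show ?thesis unfolding \<beta> by (metis add.commute colex_add)
  qed
qed

text \<open>
  Bracketing with \<open>x\<^sub>i\<^bsup>N+1\<^esup> \<partial>\<^bsub>i+1\<^esub>\<close> moves the coefficient of \<open>\<partial>\<^sub>i\<close> into the next block, with
  an exponent of \<open>x\<^sub>i\<close> as large as desired.
\<close>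

lemma leading_bracket_next_block:
  fixes f :: "'k::field_char_0 tuple"
  assumes f: "leading f (\<alpha>, i)" and i: "1 \<le> i"
  shows "leading (tuple_bracket (basis_tuple (single i (Suc N), Suc i)) f)
    (single i N + \<alpha>, Suc i)" (is "leading ?h _")
proof (rule leadingI)
  let ?x = "single i N" and ?y = "single i (Suc N)"
  note f0 = leadingD(2)[OF f]
  have zero: "?h j = 0" if "j < Suc i" for j
    unfolding tuple_bracket_def using that f0
    by (intro sum.neutral) (auto simp: basis_tuple_def)
  then show "\<And>j. j < Suc i \<Longrightarrow> ?h j = 0" .
  have "?h (Suc i) = (\<Sum>l\<in>{1..<Suc i}. if l = i then - (f i * \<partial> i (monomial ?y)) else 0)"
    unfolding tuple_bracket_def using f0 by (intro sum.cong) (auto simp: basis_tuple_def)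
  also have "\<dots> = - (\<partial> i (monomial ?y) * f i)"
    using i by (subst sum.delta) (auto simp: mult.commute)
  also have "\<partial> i (monomial ?y) = Const (of_nat (Suc N)) * (monomial ?x :: 'k mpoly)"
  proof -
    have "?y - \<epsilon> i = ?x" by (rule poly_mapping_eqI) (auto simp: lookup_minus lookup_single when_def)
    then show ?thesis by (simp add: monomial_def pderivative_single Const_def mult_single)
  qed
  finally have h: "?h (Suc i) = - (Const (of_nat (Suc N)) * (monomial ?x * f i))"
    by (simp add: mult.assoc)
  have lookup_h: "lookup (?h (Suc i)) \<beta> = - (of_nat (Suc N) * lookup (monomial ?x * f i) \<beta>)" for \<beta>
    by (simp only: h lookup_uminus lookup_Const_mult)
  show "lookup (?h (Suc i)) (?x + \<alpha>) \<noteq> 0"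
    unfolding lookup_h lookup_monomial_times using leadingD(1)[OF f] of_nat_neq_0[of N] by simp
  show "\<beta> = ?x + \<alpha> \<or> \<beta> \<lhd> ?x + \<alpha>" if "lookup (?h (Suc i)) \<beta> \<noteq> 0" for \<beta>
  proof -
    from that have "lookup (monomial ?x * f i) \<beta> \<noteq> 0" unfolding lookup_h by auto
    then obtain \<gamma> where "\<beta> = ?x + \<gamma>" "lookup (f i) \<gamma> \<noteq> 0"
      using lookup_monomial_times(2) by blast
    then show ?thesis using leadingD(3)[OF f] by (metis add.commute colex_add)
  qed
qed

text \<open>
  From the leading index \<open>z\<close> one can descend without jumping over a given \<open>y\<close> below it.  Iterating this
  reaches every index below \<open>z\<close>.
\<close>

lemma leading_bracket_step:
  fixes f :: "'k::field_char_0 tuple"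
  assumes f: "leading f z" and z: "z \<in> basis_index n" and y: "y \<in> basis_index n" and less: "y \<prec> z"
  obtains b v where "b \<in> basis_index n" "v \<in> basis_index n"
    "leading (tuple_bracket (basis_tuple b) f) v" "y = v \<or> y \<prec> v" "v \<prec> z"
proof -
  obtain \<alpha> i \<beta> j where z_eq: "z = (\<alpha>, i)" and y_eq: "y = (\<beta>, j)" by (cases z, cases y)
  have i: "1 \<le> i" "i \<le> n" and \<alpha>: "keys \<alpha> \<subseteq> {1..i - 1}"
    and j: "1 \<le> j" "j \<le> n" and \<beta>: "keys \<beta> \<subseteq> {1..j - 1}"
    using z y by (auto simp: z_eq y_eq basis_index_def)
  show ?thesis
  proof (cases "i < j")
    case True
    \<comment> \<open>The exponent of \<open>x\<^sub>i\<close> has to exceed that in \<open>\<beta>\<close> in case \<open>y\<close> lies in the next block.\<close>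
    define N where "N = Suc (lookup \<beta> i)"
    let ?b = "(single i (Suc N), Suc i)" and ?v = "(single i N + \<alpha>, Suc i)"
    show ?thesis
    proof (rule that)
      show "?b \<in> basis_index n" using True i j by (simp add: basis_index_def)
      show "?v \<in> basis_index n" using True i j \<alpha> by (force simp: basis_index_def keys_plus_exp N_def)
      show "leading (tuple_bracket (basis_tuple ?b) f) ?v"
        using f i(1) leading_bracket_next_block unfolding z_eq by blast
      show "?v \<prec> z" by (simp add: z_eq index_less_Pair)
      have "\<beta> \<lhd> single i N + \<alpha>" if "j = Suc i"
        unfolding colex_def
      proof (intro exI[of _ i] conjI allI impI)
        show "lookup \<beta> i < lookup (single i N + \<alpha>) i"
          by (simp add: lookup_add N_def)
        fix k assume "i < k"
        then have "k \<notin> keys \<beta>" "k \<notin> keys \<alpha>" using \<alpha> \<beta> that by auto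
        then have "lookup \<beta> k = 0" "lookup \<alpha> k = 0" by (simp_all only: in_keys_iff not_not)
        then show "lookup \<beta> k = lookup (single i N + \<alpha>) k"
          using \<open>i < k\<close> by (simp add: lookup_add lookup_single when_def)
      qed
      then show "y = ?v \<or> y \<prec> ?v" using True by (auto simp: y_eq index_less_Pair)
    qed
  next
    case False
    with less have ji: "j = i" and "\<beta> \<lhd> \<alpha>" by (auto simp: z_eq y_eq index_less_Pair)
    then obtain k where k: "lookup \<beta> k < lookup \<alpha> k" "\<forall>m>k. lookup \<beta> m = lookup \<alpha> m"
      unfolding colex_def by blast
    have "k \<in> keys \<alpha>" using k(1) by (auto simp: in_keys_iff)
    then have "k \<in> {1..i - 1}" using \<alpha> by blast
    then have k1: "1 \<le> k" "k < i" by auto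
    \<comment> \<open>The new exponent \<open>\<delta> + \<alpha> - \<epsilon> k\<close> is below \<open>\<alpha>\<close> at \<open>k\<close>, the last place where \<open>\<alpha>\<close> and \<open>\<beta>\<close> differ,
      and the exponents of \<open>\<beta>\<close> before \<open>k\<close> make it at least \<open>\<beta>\<close> at every place.\<close>
    define \<delta> where "\<delta> = Abs_poly_mapping (\<lambda>l. if l < k then lookup \<beta> l else 0)"
    have \<delta>: "lookup \<delta> l = (if l < k then lookup \<beta> l else 0)" for l
    proof -
      have "finite {l. (if l < k then lookup \<beta> l else 0) \<noteq> 0}"
        by (rule finite_subset[of _ "keys \<beta>"]) (auto simp: in_keys_iff)
      then show ?thesis unfolding \<delta>_def by (simp add: Abs_poly_mapping_inverse)
    qed
    let ?v = "\<delta> + (\<alpha> - \<epsilon> k)"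
    have "keys \<delta> \<subseteq> keys \<beta> \<inter> {..<k}" by (auto simp: \<delta> in_keys_iff split: if_splits)
    moreover have "keys (\<alpha> - \<epsilon> k) \<subseteq> keys \<alpha>" by (auto simp: in_keys_iff lookup_minus)
    ultimately have keys: "keys \<delta> \<subseteq> {1..k - 1}" "keys ?v \<subseteq> {1..i - 1}"
      using \<alpha> \<beta> k1 unfolding ji keys_plus_exp by force+
    show ?thesis
    proof (rule that)
      show "(\<delta>, k) \<in> basis_index n" using keys k1 i by (simp add: basis_index_def)
      show "(?v, i) \<in> basis_index n" using keys i by (simp add: basis_index_def)
      show "leading (tuple_bracket (basis_tuple (\<delta>, k)) f) (?v, i)"
        using f k1 k(1) unfolding z_eq by (intro leading_bracket_same_block) auto
      have "lookup \<beta> l \<le> lookup ?v l" for l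
        using k by (cases l k rule: linorder_cases) (auto simp: lookup_add lookup_minus \<delta> lookup_single when_def)
      then show "y = (?v, i) \<or> y \<prec> (?v, i)"
        using colex_pointwise by (auto simp: y_eq ji index_less_Pair)
      have "?v \<lhd> \<alpha>"
        unfolding colex_def using k(1)
        by (intro exI[of _ k]) (auto simp: lookup_add lookup_minus \<delta> lookup_single when_def)
      then show "(?v, i) \<prec> z" by (simp add: z_eq index_less_Pair)
    qed
  qed
qed

lemma idealD:
  assumes "ideal n A"
  shows "A \<subseteq> span_on (basis_index n)" "0 \<in> A" "f \<in> A \<Longrightarrow> g \<in> A \<Longrightarrow> f + g \<in> A"
    "f \<in> A \<Longrightarrow> tuple_scale c f \<in> A" "f \<in> span_on (basis_index n) \<Longrightarrow> g \<in> A \<Longrightarrow> tuple_bracket f g \<in> A"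
  using assms unfolding ideal_def by blast+

lemma ideal_sum: "ideal n A \<Longrightarrow> (\<And>x. x \<in> B \<Longrightarrow> f x \<in> A) \<Longrightarrow> (\<Sum>x\<in>B. f x) \<in> A"
  by (induction B rule: infinite_finite_induct) (auto simp: idealD)

lemma ideal_contains_supported:
  assumes A: "ideal n A" and T: "\<And>b. b \<in> T \<Longrightarrow> basis_tuple b \<in> A"
    and f: "f \<in> span_on (basis_index n)" "support f \<subseteq> T"
  shows "f \<in> A"
proof -
  have "(\<Sum>b\<in>support f. tuple_scale (lookup (f (snd b)) (fst b)) (basis_tuple b)) \<in> A"
    using T f(2) by (intro ideal_sum[OF A] idealD(4)[OF A]) auto
  then show ?thesis using tuple_as_sum[OF finite_support[OF f(1)] order_refl] by simp
qed

text \<open>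
  By induction on the leading index the ideal contains all basis elements below \<open>z\<close>, since one step
  down leads to an element of the ideal whose leading index is still not below \<open>y\<close>.  Subtracting them
  from \<open>f\<close> leaves a multiple of the basis element at \<open>z\<close>.
\<close>

lemma ideal_contains_leading:
  fixes A :: "'k::field_char_0 tuple set"
  assumes A: "ideal n A"
  shows "z \<in> basis_index n \<Longrightarrow> f \<in> A \<Longrightarrow> leading f z \<Longrightarrow> y \<in> basis_index n \<Longrightarrow> y = z \<or> y \<prec> z \<Longrightarrow>
    basis_tuple y \<in> A"
  using wf_index_less[of n]
proof (induction z arbitrary: f y rule: wf_induct_rule)
  case (less z)
  have lower: "basis_tuple y \<in> A" if y: "y \<in> basis_index n" "y \<prec> z" for y
  proof -
    obtain b v where b: "b \<in> basis_index n" and v: "v \<in> basis_index n"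
      and lead: "leading (tuple_bracket (basis_tuple b) f) v" and yv: "y = v \<or> y \<prec> v" and vz: "v \<prec> z"
      using leading_bracket_step[OF less.prems(3,1) y] .
    have "tuple_bracket (basis_tuple b) f \<in> A"
      using idealD(5)[OF A _ less.prems(2)] b by (simp add: basis_tuple_supported)
    then show ?thesis using less.IH[OF _ v _ lead y(1) yv] v vz less.prems(1) by blast
  qed
  have "basis_tuple z \<in> A"
  proof -
    let ?c = "lookup (f (snd z)) (fst z)"
    define g where "g = f + tuple_scale (- ?c) (basis_tuple z)"
    have z: "z \<in> support f" using less.prems(3) by (simp add: leading_def)
    then have c: "?c \<noteq> 0" by (cases z) (simp add: in_support)
    have fU: "f \<in> span_on (basis_index n)" using less.prems(2) idealD(1)[OF A] by blast
    have supp: "lookup (g i) \<alpha> = (if (\<alpha>, i) = z then 0 else lookup (f i) \<alpha>)" for \<alpha> i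
      by (cases z) (auto simp: g_def lookup_add lookup_tuple_scale lookup_basis_tuple)
    have "g \<in> span_on (basis_index n)"
      unfolding g_def using fU less.prems(1)
      by (intro span_on_add span_on_scale) (simp_all add: basis_tuple_supported)
    moreover have "support g \<subseteq> {y \<in> basis_index n. y \<prec> z}"
    proof
      fix b assume "b \<in> support g"
      then have "b \<in> support f" "b \<noteq> z" by (cases b; auto simp: in_support supp split: if_splits)+
      then show "b \<in> {y \<in> basis_index n. y \<prec> z}"
        using less.prems(3) fU by (auto simp: leading_def span_on_def)
    qed
    ultimately have "g \<in> A" using ideal_contains_supported[OF A, of "{y \<in> basis_index n. y \<prec> z}"] lower by blast
    then have "tuple_scale (inverse ?c) (f + tuple_scale (- 1) g) \<in> A"
      using less.prems(2) by (intro idealD(3,4)[OF A])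
    also have "tuple_scale (inverse ?c) (f + tuple_scale (- 1) g) = basis_tuple z"
      using c by (intro ext poly_mapping_eqI) (auto simp: lookup_tuple_scale lookup_add supp lookup_basis_tuple)
    finally show ?thesis .
  qed
  with lower less.prems(4,5) show ?case by blast
qed

lemma leading_exists:
  assumes "f \<in> span_on (basis_index n)" "f \<noteq> 0"
  shows "\<exists>z\<in>basis_index n. leading f z"
proof -
  have fin: "finite (support f)" using assms(1) by (rule finite_support)
  have "support f \<noteq> {}"
  proof
    assume "support f = {}"
    then have "lookup (f i) \<alpha> = 0" for i \<alpha> using in_support by blast
    then have "f = 0" by (intro ext poly_mapping_eqI) simp
    with assms(2) show False by simp
  qed
  moreover have "finite T \<Longrightarrow> T \<noteq> {} \<Longrightarrow> \<exists>z\<in>T. \<forall>c\<in>T. c = z \<or> c \<prec> z" for T :: "index set"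
  proof (induction T rule: finite_ne_induct)
    case (insert b T)
    then obtain z where z: "z \<in> T" "\<forall>c\<in>T. c = z \<or> c \<prec> z" by blast
    show ?case
    proof (cases "z \<prec> b")
      case True
      then have "c \<prec> b" if "c \<in> T" for c
        using that z(2) index_less_trans[of c z b] by auto
      then show ?thesis by (intro bexI[of _ b]) blast+
    next
      case False
      then show ?thesis using z index_less_total[of b z] by (intro bexI[of _ z]) blast+
    qed
  qed simp
  ultimately obtain z where "z \<in> support f" "\<forall>c\<in>support f. c = z \<or> c \<prec> z"
    using fin by meson
  then show ?thesis using assms(1) unfolding leading_def span_on_def by auto
qed

theorem ideal_classification:
  fixes A :: "'k::field_char_0 tuple set"
  assumes A: "ideal n A"
  shows "\<exists>S. downset n S \<and> A = span_on S"
proof (intro exI conjI)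
  let ?S = "{b \<in> basis_index n. basis_tuple b \<in> A}"
  have lead: "leading (basis_tuple b :: 'k tuple) b" for b
    by (cases b) (auto intro!: leadingI simp: basis_tuple_def lookup_single monomial_def when_def split: if_splits)
  show "downset n ?S"
    unfolding downset_def using ideal_contains_leading[OF A _ _ lead] by blast
  show "A = span_on ?S"
  proof (intro equalityI subsetI)
    fix f assume f: "f \<in> A"
    then have fU: "f \<in> span_on (basis_index n)" using idealD(1)[OF A] by blast
    show "f \<in> span_on ?S"
    proof (cases "f = 0")
      case False
      then obtain z where z: "z \<in> basis_index n" "leading f z" using leading_exists[OF fU] by blast
      then show ?thesis
        unfolding span_on_def using ideal_contains_leading[OF A z(1) f z(2)] fU
        by (auto simp: leading_def span_on_def)
    qed (simp add: span_on_0)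
  next
    fix f :: "'k tuple" assume f: "f \<in> span_on ?S"
    then have "f \<in> span_on (basis_index n)" using span_on_mono[of ?S "basis_index n"] by auto
    then show "f \<in> A"
      using ideal_contains_supported[OF A, of ?S f] f by (auto simp: span_on_def)
  qed
qed

section \<open>Isomorphisms of quotients\<close>

lemma lie_isomorphic_trans:
  assumes "L \<cong> M" "M \<cong> N"
  shows "L \<cong> N"
proof -
  from assms(1) obtain f where f: "bij_betw f (carrier L) (carrier M)"
    "\<forall>x\<in>carrier L. \<forall>y\<in>carrier L. f (add L x y) = add M (f x) (f y)"
    "\<forall>c. \<forall>x\<in>carrier L. f (scale L c x) = scale M c (f x)"
    "\<forall>x\<in>carrier L. \<forall>y\<in>carrier L. f (bracket L x y) = bracket M (f x) (f y)"
    unfolding lie_isomorphic_def by blast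
  from assms(2) obtain g where g: "bij_betw g (carrier M) (carrier N)"
    "\<forall>x\<in>carrier M. \<forall>y\<in>carrier M. g (add M x y) = add N (g x) (g y)"
    "\<forall>c. \<forall>x\<in>carrier M. g (scale M c x) = scale N c (g x)"
    "\<forall>x\<in>carrier M. \<forall>y\<in>carrier M. g (bracket M x y) = bracket N (g x) (g y)"
    unfolding lie_isomorphic_def by blast
  have fM: "f x \<in> carrier M" if "x \<in> carrier L" for x
    using f(1) that by (rule bij_betwE[rule_format])
  show ?thesis
    unfolding lie_isomorphic_def
  proof (intro exI[of _ "g \<circ> f"] conjI)
    show "bij_betw (g \<circ> f) (carrier L) (carrier N)" using f(1) g(1) by (rule bij_betw_trans)
  qed (simp_all add: f(2-4) g(2-4) fM)
qed

lemma lie_isomorphic_refl: "L \<cong> L"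
  unfolding lie_isomorphic_def by (intro exI[of _ id]) simp

text \<open>
  Closedness of \<open>L\<close> under its operations is included; it lets the inverse map be an isomorphism too.
\<close>

definition lie_iso ::
    "('a \<Rightarrow> 'b) \<Rightarrow> ('k, 'a) lie_algebra \<Rightarrow> ('k, 'b) lie_algebra \<Rightarrow> bool" where
  "lie_iso g L M \<longleftrightarrow> bij_betw g (carrier L) (carrier M) \<and>
     (\<forall>x\<in>carrier L. \<forall>y\<in>carrier L. add L x y \<in> carrier L \<and> g (add L x y) = add M (g x) (g y)) \<and>
     (\<forall>c. \<forall>x\<in>carrier L. scale L c x \<in> carrier L \<and> g (scale L c x) = scale M c (g x)) \<and>
     (\<forall>x\<in>carrier L. \<forall>y\<in>carrier L.
       bracket L x y \<in> carrier L \<and> g (bracket L x y) = bracket M (g x) (g y))"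

lemma lie_iso_inverse:
  assumes "lie_iso g L M"
  shows "lie_iso (inv_into (carrier L) g) M L"
proof -
  let ?h = "inv_into (carrier L) g"
  have g: "bij_betw g (carrier L) (carrier M)"
    and add: "\<And>x y. x \<in> carrier L \<Longrightarrow> y \<in> carrier L \<Longrightarrow> add L x y \<in> carrier L \<and> g (add L x y) = add M (g x) (g y)"
    and scale: "\<And>c x. x \<in> carrier L \<Longrightarrow> scale L c x \<in> carrier L \<and> g (scale L c x) = scale M c (g x)"
    and bracket: "\<And>x y. x \<in> carrier L \<Longrightarrow> y \<in> carrier L \<Longrightarrow>
      bracket L x y \<in> carrier L \<and> g (bracket L x y) = bracket M (g x) (g y)"
    using assms unfolding lie_iso_def by blast+
  have gM: "g x \<in> carrier M" if "x \<in> carrier L" for x using g that by (rule bij_betwE[rule_format])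
  have hg: "?h (g x) = x" if "x \<in> carrier L" for x
    using g that by (simp add: bij_betw_inv_into_left)
  have M: "\<exists>x\<in>carrier L. y = g x" if "y \<in> carrier M" for y
    using g that by (metis bij_betw_imp_surj_on imageE)
  show ?thesis
    unfolding lie_iso_def
  proof (intro conjI ballI allI)
    show "bij_betw ?h (carrier M) (carrier L)" using g by (rule bij_betw_inv_into)
  next
    fix y z assume "y \<in> carrier M" "z \<in> carrier M"
    then obtain x w where "x \<in> carrier L" "w \<in> carrier L" "y = g x" "z = g w" using M by blast
    then show "add M y z \<in> carrier M" "?h (add M y z) = add L (?h y) (?h z)"
      "bracket M y z \<in> carrier M" "?h (bracket M y z) = bracket L (?h y) (?h z)"
      using add[of x w] bracket[of x w] gM hg by metis+
  next
    fix c y assume "y \<in> carrier M"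
    then obtain x where "x \<in> carrier L" "y = g x" using M by blast
    then show "scale M c y \<in> carrier M" "?h (scale M c y) = scale L c (?h y)"
      using scale[of x c] gM hg by metis+
  qed
qed

lemma lie_coset_image: "lie_coset L I x = add L x ` I"
  by (auto simp: lie_coset_def)

text \<open>
  Cosets and the operations on them are defined through the operations of the algebra alone, so an
  isomorphism of algebras carries them along by taking images.
\<close>

lemma lie_quotient_image:
  assumes "lie_iso g L M" "I \<subseteq> carrier L"
  shows "L //\<^sub>L I \<cong> M //\<^sub>L (g ` I)"
proof -
  have g: "bij_betw g (carrier L) (carrier M)"
    and add: "\<And>x y. x \<in> carrier L \<Longrightarrow> y \<in> carrier L \<Longrightarrow> add L x y \<in> carrier L"
    "\<And>x y. x \<in> carrier L \<Longrightarrow> y \<in> carrier L \<Longrightarrow> add M (g x) (g y) = g (add L x y)"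
    and scale: "\<And>c x. x \<in> carrier L \<Longrightarrow> scale L c x \<in> carrier L"
    "\<And>c x. x \<in> carrier L \<Longrightarrow> scale M c (g x) = g (scale L c x)"
    and bracket: "\<And>x y. x \<in> carrier L \<Longrightarrow> y \<in> carrier L \<Longrightarrow> bracket L x y \<in> carrier L"
    "\<And>x y. x \<in> carrier L \<Longrightarrow> y \<in> carrier L \<Longrightarrow> bracket M (g x) (g y) = g (bracket L x y)"
    using assms(1) unfolding lie_iso_def by (blast, blast, metis, blast, metis, blast, metis)
  have coset: "lie_coset M (g ` I) (g x) = g ` lie_coset L I x" if "x \<in> carrier L" for x
    unfolding lie_coset_image image_image using assms(2) add(2) that by (intro image_cong) auto
  have sub: "lie_coset L I x \<subseteq> carrier L" if "x \<in> carrier L" for x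
    unfolding lie_coset_image using assms(2) add(1) that by auto
  have img: "g ` carrier L = carrier M" using g by (rule bij_betw_imp_surj_on)
  have carrier: "carrier (L //\<^sub>L I) = lie_coset L I ` carrier L"
    "carrier (M //\<^sub>L (g ` I)) = lie_coset M (g ` I) ` carrier M" by (simp_all add: lie_quotient_def)
  have mem: "A \<subseteq> carrier L" if "A \<in> carrier (L //\<^sub>L I)" for A
    using that sub unfolding carrier by blast
  show ?thesis
    unfolding lie_isomorphic_def
  proof (intro exI[of _ "\<lambda>A. g ` A"] conjI ballI allI)
    have "inj_on (\<lambda>A. g ` A) (carrier (L //\<^sub>L I))"
      by (rule inj_onI) (use mem g in \<open>meson bij_betw_imp_inj_on inj_on_image_eq_iff\<close>)
    moreover have "(\<lambda>A. g ` A) ` carrier (L //\<^sub>L I) = carrier (M //\<^sub>L (g ` I))"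
      unfolding carrier image_image img[symmetric] using coset by (intro image_cong) auto
    ultimately show "bij_betw (\<lambda>A. g ` A) (carrier (L //\<^sub>L I)) (carrier (M //\<^sub>L (g ` I)))"
      by (simp add: bij_betw_def)
  next
    fix A B assume "A \<in> carrier (L //\<^sub>L I)" "B \<in> carrier (L //\<^sub>L I)"
    then have AB: "A \<subseteq> carrier L" "B \<subseteq> carrier L" using mem by blast+
    have "(\<Union>x\<in>g ` A. \<Union>y\<in>g ` B. lie_coset M (g ` I) (add M x y)) =
        (\<Union>x\<in>A. \<Union>y\<in>B. g ` lie_coset L I (add L x y))"
      unfolding UN_simps(10) using AB add coset by (intro SUP_cong refl) (auto simp: subset_iff)
    then show "g ` add (L //\<^sub>L I) A B = add (M //\<^sub>L (g ` I)) (g ` A) (g ` B)"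
      by (simp add: lie_quotient_def image_UN)
    have "(\<Union>x\<in>g ` A. \<Union>y\<in>g ` B. lie_coset M (g ` I) (bracket M x y)) =
        (\<Union>x\<in>A. \<Union>y\<in>B. g ` lie_coset L I (bracket L x y))"
      unfolding UN_simps(10) using AB bracket coset by (intro SUP_cong refl) (auto simp: subset_iff)
    then show "g ` bracket (L //\<^sub>L I) A B = bracket (M //\<^sub>L (g ` I)) (g ` A) (g ` B)"
      by (simp add: lie_quotient_def image_UN)
  next
    fix c A assume "A \<in> carrier (L //\<^sub>L I)"
    then have A: "A \<subseteq> carrier L" using mem by blast
    have "(\<Union>x\<in>g ` A. lie_coset M (g ` I) (scale M c x)) = (\<Union>x\<in>A. g ` lie_coset L I (scale L c x))"
      unfolding UN_simps(10) using A scale coset by (intro SUP_cong refl) (auto simp: subset_iff)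
    then show "g ` scale (L //\<^sub>L I) c A = scale (M //\<^sub>L (g ` I)) c (g ` A)"
      by (simp add: lie_quotient_def image_UN)
  qed
qed

lemma lie_quotient_image_iff:
  assumes g: "lie_iso g L M" and I: "I \<subseteq> carrier L" and J: "J \<subseteq> carrier L"
  shows "M //\<^sub>L (g ` I) \<cong> M //\<^sub>L (g ` J) \<longleftrightarrow> L //\<^sub>L I \<cong> L //\<^sub>L J"
proof -
  have bij: "bij_betw g (carrier L) (carrier M)" using g by (simp add: lie_iso_def)
  have preimage: "M //\<^sub>L (g ` K) \<cong> L //\<^sub>L K" if K: "K \<subseteq> carrier L" for K
  proof -
    have "inv_into (carrier L) g ` g ` K = K"
      using bij K by (simp add: bij_betw_imp_inj_on inv_into_image_cancel)
    moreover have "g ` K \<subseteq> carrier M" using bij K bij_betw_imp_surj_on by blast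
    ultimately show ?thesis using lie_quotient_image[OF lie_iso_inverse[OF g], of "g ` K"] by simp
  qed
  show ?thesis
    using lie_quotient_image[OF g I] lie_quotient_image[OF g J] preimage[OF I] preimage[OF J]
    by (meson lie_isomorphic_trans)
qed

lemma lie_iso_derivation:
  "lie_iso (derivation n) (tuples n) (\<uu> n :: ('k::comm_ring_1, 'k operator) lie_algebra)"
  unfolding lie_iso_def
  by (auto simp: bij_betw_derivation[unfolded tuples_simps] span_on_add span_on_scale
      tuple_bracket_closed derivation_add[symmetric] derivation_scale[symmetric]
      derivation_bracket[symmetric])

subsection \<open>Cosets of an ideal\<close>

lemma tuple_scale_minus_1: "tuple_scale (- 1) f = - f"
  by (intro ext poly_mapping_eqI) (simp add: lookup_tuple_scale)

lemma tuple_scale_add: "tuple_scale c (f + g) = tuple_scale c f + tuple_scale c g"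
  by (simp add: fun_eq_iff tuple_scale_def distrib_left)

lemma ideal_uminus: "ideal n A \<Longrightarrow> f \<in> A \<Longrightarrow> - f \<in> A"
  using idealD(4)[of n A f "- 1"] by (simp add: tuple_scale_minus_1)

lemma ideal_diff: "ideal n A \<Longrightarrow> f \<in> A \<Longrightarrow> g \<in> A \<Longrightarrow> f - g \<in> A"
  using idealD(3)[of n A f "- g"] ideal_uminus[of n A g] by simp

lemma ideal_bracket_right:
  "ideal n A \<Longrightarrow> f \<in> A \<Longrightarrow> g \<in> span_on (basis_index n) \<Longrightarrow> tuple_bracket f g \<in> A"
  using idealD(5)[of n A g f] ideal_uminus[of n A "tuple_bracket g f"]
  by (simp add: tuple_bracket_commute[of f g])

abbreviation coset :: "nat \<Rightarrow> 'k::comm_ring_1 tuple set \<Rightarrow> 'k tuple \<Rightarrow> 'k tuple set" where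
  "coset n I \<equiv> lie_coset (tuples n) I"

lemma coset_eq_iff:
  assumes "ideal n I"
  shows "coset n I f = coset n I g \<longleftrightarrow> f - g \<in> I"
proof
  assume *: "coset n I f = coset n I g"
  have "f \<in> coset n I f" unfolding lie_coset_def using idealD(2)[OF assms] by force
  then have "f \<in> coset n I g" using * by simp
  then show "f - g \<in> I" unfolding lie_coset_def by auto
next
  assume d: "f - g \<in> I"
  have "f + h \<in> coset n I g" "g + h \<in> coset n I f" if h: "h \<in> I" for h
  proof -
    have "f + h = g + ((f - g) + h)" "g + h = f + (h - (f - g))" by simp_all
    then show "f + h \<in> coset n I g" "g + h \<in> coset n I f"
      unfolding lie_coset_image tuples_simps
      using idealD(3)[OF assms d h] ideal_diff[OF assms h d] by blast+
  qed
  then show "coset n I f = coset n I g" by (force simp: lie_coset_def)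
qed

lemma coset_self: "ideal n I \<Longrightarrow> f \<in> coset n I f"
  unfolding lie_coset_def using idealD(2) by force

lemma in_cosetD: "g \<in> coset n I f \<Longrightarrow> \<exists>h\<in>I. g = f + h"
  by (auto simp: lie_coset_def)

lemma carrier_quotient: "carrier (tuples n //\<^sub>L I) = coset n I ` span_on (basis_index n)"
  by (simp add: lie_quotient_def)

lemma quotient_add:
  assumes "ideal n I"
  shows "add (tuples n //\<^sub>L I) (coset n I f) (coset n I g) = coset n I (f + g)"
proof -
  have "coset n I (f' + g') = coset n I (f + g)" if "f' \<in> coset n I f" "g' \<in> coset n I g" for f' g'
  proof -
    obtain h k where "h \<in> I" "k \<in> I" "f' = f + h" "g' = g + k" using \<open>f' \<in> _\<close> \<open>g' \<in> _\<close> in_cosetD by metis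
    then show ?thesis using idealD(3)[OF assms, of h k] by (simp add: coset_eq_iff[OF assms] algebra_simps)
  qed
  then have "(\<Union>x\<in>coset n I f. \<Union>y\<in>coset n I g. coset n I (x + y)) = coset n I (f + g)"
    using coset_self[OF assms, of f] coset_self[OF assms, of g] by blast
  then show ?thesis by (simp add: lie_quotient_def)
qed

lemma quotient_scale:
  assumes "ideal n I"
  shows "scale (tuples n //\<^sub>L I) c (coset n I f) = coset n I (tuple_scale c f)"
proof -
  have "coset n I (tuple_scale c f') = coset n I (tuple_scale c f)" if "f' \<in> coset n I f" for f'
    using in_cosetD[OF that] idealD(4)[OF assms] by (auto simp: coset_eq_iff[OF assms] tuple_scale_add)
  then have "(\<Union>x\<in>coset n I f. coset n I (tuple_scale c x)) = coset n I (tuple_scale c f)"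
    using coset_self[OF assms, of f] by blast
  then show ?thesis by (simp add: lie_quotient_def)
qed

lemma quotient_bracket:
  assumes "ideal n I" and f: "f \<in> span_on (basis_index n)" and g: "g \<in> span_on (basis_index n)"
  shows "bracket (tuples n //\<^sub>L I) (coset n I f) (coset n I g) = coset n I (tuple_bracket f g)"
proof -
  have "coset n I (tuple_bracket f' g') = coset n I (tuple_bracket f g)"
    if "f' \<in> coset n I f" "g' \<in> coset n I g" for f' g'
  proof -
    obtain h k where hk: "h \<in> I" "k \<in> I" "f' = f + h" "g' = g + k"
      using \<open>f' \<in> _\<close> \<open>g' \<in> _\<close> in_cosetD by metis
    then have "h \<in> span_on (basis_index n)" using idealD(1)[OF assms(1)] by blast
    then have "tuple_bracket f k + (tuple_bracket h g + tuple_bracket h k) \<in> I"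
      using hk f g by (intro idealD(3)[OF assms(1)] idealD(5)[OF assms(1)] ideal_bracket_right[OF assms(1)])
    then show ?thesis
      using hk by (simp add: coset_eq_iff[OF assms(1)] tuple_bracket_add algebra_simps)
  qed
  then have "(\<Union>x\<in>coset n I f. \<Union>y\<in>coset n I g. coset n I (tuple_bracket x y)) = coset n I (tuple_bracket f g)"
    using coset_self[OF assms(1), of f] coset_self[OF assms(1), of g] by blast
  then show ?thesis by (simp add: lie_quotient_def)
qed

subsection \<open>Correspondences\<close>

text \<open>
  An isomorphism between the quotients by \<open>I\<close> and \<open>J\<close>, seen as the relation that holds between
  representatives of matching cosets.
\<close>

definition correspondence ::
    "nat \<Rightarrow> 'k::comm_ring_1 tuple set \<Rightarrow> 'k tuple set \<Rightarrow>
      ('k tuple \<times> 'k tuple) set \<Rightarrow> bool" where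
  "correspondence n I J R \<longleftrightarrow>
     Domain R = span_on (basis_index n) \<and> Range R = span_on (basis_index n) \<and>
     (\<forall>f g f' g'. (f, g) \<in> R \<longrightarrow> (f', g') \<in> R \<longrightarrow>
       (f + f', g + g') \<in> R \<and> (tuple_bracket f f', tuple_bracket g g') \<in> R) \<and>
     (\<forall>c f g. (f, g) \<in> R \<longrightarrow> (tuple_scale c f, tuple_scale c g) \<in> R) \<and>
     (\<forall>f g. (f, g) \<in> R \<longrightarrow> (f \<in> I \<longleftrightarrow> g \<in> J))"

lemma correspondenceD:
  assumes "correspondence n I J R"
  shows "(f, g) \<in> R \<Longrightarrow> f \<in> span_on (basis_index n)"
    "(f, g) \<in> R \<Longrightarrow> g \<in> span_on (basis_index n)"
    "f \<in> span_on (basis_index n) \<Longrightarrow> \<exists>g. (f, g) \<in> R"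
    "g \<in> span_on (basis_index n) \<Longrightarrow> \<exists>f. (f, g) \<in> R"
    "(f, g) \<in> R \<Longrightarrow> (f', g') \<in> R \<Longrightarrow> (f + f', g + g') \<in> R"
    "(f, g) \<in> R \<Longrightarrow> (f', g') \<in> R \<Longrightarrow> (f - f', g - g') \<in> R"
    "(f, g) \<in> R \<Longrightarrow> (f', g') \<in> R \<Longrightarrow> (tuple_bracket f f', tuple_bracket g g') \<in> R"
    "(f, g) \<in> R \<Longrightarrow> (tuple_scale c f, tuple_scale c g) \<in> R"
    "(f, g) \<in> R \<Longrightarrow> f \<in> I \<longleftrightarrow> g \<in> J"
proof -
  have *: "(f + f', g + g') \<in> R" "(tuple_bracket f f', tuple_bracket g g') \<in> R"
    if "(f, g) \<in> R" "(f', g') \<in> R" for f g f' g'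
    using assms that unfolding correspondence_def by blast+
  have **: "(tuple_scale c f, tuple_scale c g) \<in> R" if "(f, g) \<in> R" for c f g
    using assms that unfolding correspondence_def by blast
  have "(f + tuple_scale (- 1) f', g + tuple_scale (- 1) g') \<in> R" if "(f, g) \<in> R" "(f', g') \<in> R"
    using that by (intro * **)
  then show "(f, g) \<in> R \<Longrightarrow> (f', g') \<in> R \<Longrightarrow> (f - f', g - g') \<in> R"
    by (simp add: tuple_scale_minus_1)
  show "(f, g) \<in> R \<Longrightarrow> f \<in> I \<longleftrightarrow> g \<in> J" using assms unfolding correspondence_def by blast
qed (use assms in \<open>unfold correspondence_def, blast+\<close>)

lemma correspondence_converse: "correspondence n I J R \<Longrightarrow> correspondence n J I (R\<inverse>)"
  unfolding correspondence_def by (simp add: Domain_converse Range_converse)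

lemma isomorphic_imp_correspondence:
  assumes I: "ideal n I" and J: "ideal n J" and iso: "tuples n //\<^sub>L I \<cong> tuples n //\<^sub>L J"
  shows "\<exists>R. correspondence n I J R"
proof -
  let ?U = "span_on (basis_index n)"
  from iso obtain F where F: "bij_betw F (coset n I ` ?U) (coset n J ` ?U)"
    and add: "\<And>f g. f \<in> ?U \<Longrightarrow> g \<in> ?U \<Longrightarrow>
      F (coset n I (f + g)) = add (tuples n //\<^sub>L J) (F (coset n I f)) (F (coset n I g))"
    and scale: "\<And>c f. f \<in> ?U \<Longrightarrow>
      F (coset n I (tuple_scale c f)) = scale (tuples n //\<^sub>L J) c (F (coset n I f))"
    and bracket: "\<And>f g. f \<in> ?U \<Longrightarrow> g \<in> ?U \<Longrightarrow>
      F (coset n I (tuple_bracket f g)) = bracket (tuples n //\<^sub>L J) (F (coset n I f)) (F (coset n I g))"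
    unfolding lie_isomorphic_def carrier_quotient
    by (auto simp: quotient_add[OF I] quotient_scale[OF I] quotient_bracket[OF I])
  define R where "R = {(f, g) \<in> ?U \<times> ?U. F (coset n I f) = coset n J g}"
  have total: "\<exists>g. (f, g) \<in> R" if "f \<in> ?U" for f
    using bij_betwE[OF F] that unfolding R_def by blast
  have surj: "\<exists>f. (f, g) \<in> R" if "g \<in> ?U" for g
  proof -
    have "coset n J g \<in> F ` coset n I ` ?U" using bij_betw_imp_surj_on[OF F] that by blast
    with that show ?thesis unfolding R_def by auto
  qed
  have R_add: "(f + f', g + g') \<in> R" if "(f, g) \<in> R" "(f', g') \<in> R" for f g f' g'
    using that unfolding R_def by (auto simp: add quotient_add[OF J] span_on_add)
  have U0: "(0 :: 'a tuple) \<in> ?U" by (rule span_on_0)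
  obtain z where z: "(0, z) \<in> R" using total[OF U0] by blast
  then have "(0, z + z) \<in> R" using R_add[OF z z] by simp
  with z have "coset n J (z + z) = coset n J z" by (simp add: R_def)
  then have "z \<in> J" by (simp add: coset_eq_iff[OF J])
  \<comment> \<open>The zero coset is the only one that equals its double, so \<open>F\<close> preserves it.\<close>
  then have F0: "F (coset n I 0) = coset n J 0" using z by (auto simp: R_def coset_eq_iff[OF J])
  have "f \<in> I \<longleftrightarrow> g \<in> J" if "(f, g) \<in> R" for f g
  proof -
    have "f \<in> I \<longleftrightarrow> coset n I f = coset n I 0" by (simp add: coset_eq_iff[OF I])
    also have "\<dots> \<longleftrightarrow> F (coset n I f) = F (coset n I 0)"
      using inj_on_eq_iff[OF bij_betw_imp_inj_on[OF F], of "coset n I f" "coset n I 0"] that U0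
      by (simp add: R_def)
    also have "\<dots> \<longleftrightarrow> g \<in> J" using that by (simp add: R_def F0 coset_eq_iff[OF J])
    finally show ?thesis .
  qed
  moreover have "(tuple_bracket f f', tuple_bracket g g') \<in> R" if "(f, g) \<in> R" "(f', g') \<in> R" for f g f' g'
    using that unfolding R_def by (auto simp: bracket quotient_bracket[OF J] tuple_bracket_closed)
  moreover have "(tuple_scale c f, tuple_scale c g) \<in> R" if "(f, g) \<in> R" for c f g
    using that unfolding R_def by (auto simp: scale quotient_scale[OF J] span_on_scale)
  moreover have "Domain R = ?U" "Range R = ?U"
    using total surj by (auto simp: R_def)
  ultimately have "correspondence n I J R" unfolding correspondence_def using R_add by simp
  then show ?thesis ..
qed

lemma correspondence_imp_isomorphic:
  assumes I: "ideal n I" and J: "ideal n J" and R: "correspondence n I J R"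
  shows "tuples n //\<^sub>L I \<cong> tuples n //\<^sub>L J"
proof -
  let ?U = "span_on (basis_index n)"
  note RD = correspondenceD[OF R]
  have iff: "coset n I f = coset n I f' \<longleftrightarrow> coset n J g = coset n J g'"
    if "(f, g) \<in> R" "(f', g') \<in> R" for f g f' g'
    unfolding coset_eq_iff[OF I] coset_eq_iff[OF J] using RD(9)[OF RD(6)[OF that]] .
  define F where "F A = coset n J (SOME g. \<exists>f. (f, g) \<in> R \<and> A = coset n I f)" for A
  have F: "F (coset n I f) = coset n J g" if fg: "(f, g) \<in> R" for f g
  proof -
    let ?P = "\<lambda>g. \<exists>f'. (f', g) \<in> R \<and> coset n I f = coset n I f'"
    have "?P (Eps ?P)" by (rule someI[of ?P g]) (use fg in blast)
    then obtain f' where f': "(f', Eps ?P) \<in> R" "coset n I f = coset n I f'" by blast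
    have "coset n J (Eps ?P) = coset n J g" using iff[OF f'(1) fg] f'(2) by simp
    then show ?thesis by (simp only: F_def)
  qed
  show ?thesis
    unfolding lie_isomorphic_def
  proof (intro exI[of _ F] conjI ballI allI)
    show "bij_betw F (carrier (tuples n //\<^sub>L I)) (carrier (tuples n //\<^sub>L J))"
      unfolding carrier_quotient bij_betw_def
    proof (intro conjI inj_onI)
      fix A B assume "A \<in> coset n I ` ?U" "B \<in> coset n I ` ?U" and eq: "F A = F B"
      then obtain f g f' g' where "(f, g) \<in> R" "(f', g') \<in> R" "A = coset n I f" "B = coset n I f'"
        using RD(3) by blast
      with eq show "A = B" by (simp add: F iff)
    next
      show "F ` coset n I ` ?U = coset n J ` ?U"
      proof (intro equalityI subsetI)
        fix B assume "B \<in> F ` coset n I ` ?U"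
        then obtain f where f: "f \<in> ?U" "B = F (coset n I f)" by blast
        then obtain g where g: "(f, g) \<in> R" using RD(3) by blast
        with f F RD(2) show "B \<in> coset n J ` ?U" by blast
      next
        fix B assume "B \<in> coset n J ` ?U"
        then obtain g where "g \<in> ?U" "B = coset n J g" by blast
        moreover obtain f where "(f, g) \<in> R" using RD(4) calculation(1) by blast
        ultimately show "B \<in> F ` coset n I ` ?U" using F RD(1) by blast
      qed
    qed
  next
    fix A B assume "A \<in> carrier (tuples n //\<^sub>L I)" "B \<in> carrier (tuples n //\<^sub>L I)"
    then obtain f g f' g' where fg: "(f, g) \<in> R" "(f', g') \<in> R" and AB: "A = coset n I f" "B = coset n I f'"
      using RD(3) unfolding carrier_quotient by blast
    show "F (add (tuples n //\<^sub>L I) A B) = add (tuples n //\<^sub>L J) (F A) (F B)"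
      by (simp add: AB quotient_add[OF I] quotient_add[OF J] F[OF fg(1)] F[OF fg(2)] F[OF RD(5)[OF fg]])
    show "F (bracket (tuples n //\<^sub>L I) A B) = bracket (tuples n //\<^sub>L J) (F A) (F B)"
      by (simp add: AB quotient_bracket[OF I RD(1)[OF fg(1)] RD(1)[OF fg(2)]]
          quotient_bracket[OF J RD(2)[OF fg(1)] RD(2)[OF fg(2)]]
          F[OF fg(1)] F[OF fg(2)] F[OF RD(7)[OF fg]])
  next
    fix c A assume "A \<in> carrier (tuples n //\<^sub>L I)"
    then obtain f g where fg: "(f, g) \<in> R" and A: "A = coset n I f"
      using RD(3) unfolding carrier_quotient by blast
    show "F (scale (tuples n //\<^sub>L I) c A) = scale (tuples n //\<^sub>L J) c (F A)"
      by (simp add: A quotient_scale[OF I] quotient_scale[OF J] F[OF fg] F[OF RD(8)[OF fg]])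
  qed
qed

lemma tuples_isomorphic_sym:
  assumes "ideal n I" "ideal n J" "tuples n //\<^sub>L I \<cong> tuples n //\<^sub>L J"
  shows "tuples n //\<^sub>L J \<cong> tuples n //\<^sub>L I"
proof -
  obtain R where "correspondence n I J R" using isomorphic_imp_correspondence[OF assms] ..
  then show ?thesis
    using correspondence_imp_isomorphic[OF assms(2,1)] correspondence_converse by blast
qed

section \<open>Invariants of the quotients\<close>

definition bracket_within ::
    "'k::comm_ring_1 tuple set \<Rightarrow> 'k tuple set \<Rightarrow> 'k tuple set \<Rightarrow> bool" where
  "bracket_within A B C \<longleftrightarrow> (\<forall>f\<in>A. \<forall>g\<in>B. tuple_bracket f g \<in> C)"

text \<open>
  Images under a correspondence give the isomorphism between the ideals above \<open>I\<close> and those above \<open>J\<close>.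
\<close>

lemma image_ideal:
  assumes R: "correspondence n I J R" and A: "ideal n A"
  shows "ideal n (R `` A)"
  unfolding ideal_def
proof (intro conjI ballI allI)
  note RD = correspondenceD[OF R]
  show "R `` A \<subseteq> span_on (basis_index n)" using RD(2) by blast
  obtain g where "(0, g) \<in> R" using RD(3)[OF span_on_0] by blast
  then have "(0, 0) \<in> R" using RD(6)[of 0 g 0 g] by simp
  then show "0 \<in> R `` A" using idealD(2)[OF A] by blast
  show "f + g \<in> R `` A" if "f \<in> R `` A" "g \<in> R `` A" for f g
    using that RD(5) idealD(3)[OF A] by blast
  show "tuple_scale c f \<in> R `` A" if "f \<in> R `` A" for c f
    using that RD(8) idealD(4)[OF A] by blast
  show "tuple_bracket f g \<in> R `` A" if f: "f \<in> span_on (basis_index n)" and g: "g \<in> R `` A" for f g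
  proof -
    obtain f' where f': "(f', f) \<in> R" using RD(4)[OF f] by blast
    obtain g' where g': "(g', g) \<in> R" "g' \<in> A" using g by blast
    show ?thesis using RD(7)[OF f' g'(1)] idealD(5)[OF A RD(1)[OF f'] g'(2)] by blast
  qed
qed

lemma image_contains:
  assumes R: "correspondence n I J R" and "ideal n J" "I \<subseteq> A"
  shows "J \<subseteq> R `` A"
proof
  fix g assume g: "g \<in> J"
  then obtain f where f: "(f, g) \<in> R"
    using correspondenceD(4)[OF R] idealD(1)[OF assms(2)] by blast
  then have "f \<in> A" using correspondenceD(9)[OF R f] g assms(3) by blast
  with f show "g \<in> R `` A" by blast
qed

lemma converse_image_image:
  assumes R: "correspondence n I J R" and J: "ideal n J" and A: "ideal n A" "I \<subseteq> A"
  shows "R\<inverse> `` (R `` A) = A"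
proof (intro equalityI subsetI)
  fix f assume "f \<in> R\<inverse> `` (R `` A)"
  then obtain g f' where fg: "(f, g) \<in> R" "(f', g) \<in> R" "f' \<in> A" by blast
  then have "(f - f', 0) \<in> R" using correspondenceD(6)[OF R fg(1,2)] by simp
  then have "f - f' \<in> A" using correspondenceD(9)[OF R] idealD(2)[OF J] A(2) by blast
  then show "f \<in> A" using idealD(3)[OF A(1) _ fg(3)] by force
next
  fix f assume f: "f \<in> A"
  then obtain g where "(f, g) \<in> R" using correspondenceD(3)[OF R] idealD(1)[OF A(1)] by blast
  with f show "f \<in> R\<inverse> `` (R `` A)" by blast
qed

lemma image_subsetI:
  assumes R: "correspondence n I J R" and I: "ideal n I" and B: "ideal n B" "J \<subseteq> B"
    and "A \<subseteq> R\<inverse> `` B"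
  shows "R `` A \<subseteq> B"
proof -
  have "R `` A \<subseteq> R `` R\<inverse> `` B" using assms(5) by (rule Image_mono[OF order_refl])
  also have "\<dots> = B" using converse_image_image[OF correspondence_converse[OF R] I B] by simp
  finally show ?thesis .
qed

lemma bracket_within_image:
  "correspondence n I J R \<Longrightarrow> bracket_within A B C \<Longrightarrow> bracket_within (R `` A) (R `` B) (R `` C)"
  unfolding bracket_within_def using correspondenceD(7) by blast

subsection \<open>The derived series\<close>

definition tail :: "nat \<Rightarrow> nat \<Rightarrow> index set" where
  "tail n k = {b \<in> basis_index n. k < snd b}"

lemma downset_tail: "downset n (tail n k)"
  unfolding downset_def tail_def index_less_def by auto

lemma downset_Un: "downset n S \<Longrightarrow> downset n T \<Longrightarrow> downset n (S \<union> T)"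
  unfolding downset_def by blast

lemma span_on_subset_iff:
  "(span_on S :: 'k::comm_ring_1 tuple set) \<subseteq> span_on T \<longleftrightarrow> S \<subseteq> T"
proof
  assume *: "(span_on S :: 'k tuple set) \<subseteq> span_on T"
  show "S \<subseteq> T"
  proof
    fix b assume "b \<in> S"
    then have "(basis_tuple b :: 'k tuple) \<in> span_on S" by (simp add: basis_tuple_supported)
    then have "(basis_tuple b :: 'k tuple) \<in> span_on T" using * by blast
    then show "b \<in> T" by (simp add: basis_tuple_supported)
  qed
qed (rule span_on_mono)

lemma span_on_inject:
  "(span_on S :: 'k::comm_ring_1 tuple set) = span_on T \<longleftrightarrow> S = T"
  using span_on_subset_iff[of S T, where 'k = 'k] span_on_subset_iff[of T S, where 'k = 'k] by auto

lemma tuple_bracket_basis: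
  assumes "1 \<le> k" "k < i"
  shows "tuple_bracket (basis_tuple (\<delta>, k)) (basis_tuple (\<alpha>, i)) =
    tuple_scale (of_nat (lookup \<alpha> k)) (basis_tuple (\<delta> + (\<alpha> - \<epsilon> k), i) :: 'k::comm_ring_1 tuple)"
proof
  fix j
  let ?f = "basis_tuple (\<alpha>, i) :: 'k tuple"
  have f0: "?f l = 0" if "l < i" for l using that by (simp add: basis_tuple_def)
  consider "j < i" | "j = i" | "i < j" by linarith
  then show "tuple_bracket (basis_tuple (\<delta>, k)) ?f j =
    tuple_scale (of_nat (lookup \<alpha> k)) (basis_tuple (\<delta> + (\<alpha> - \<epsilon> k), i)) j"
  proof cases
    case 1
    then show ?thesis
      using bracket_basis_tuple(2)[of i ?f k j \<delta>] f0 assms by (simp add: tuple_scale_def basis_tuple_def)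
  next
    case 2
    then show ?thesis
      using bracket_basis_tuple(1)[of i ?f k \<delta>] f0 assms
      by (simp add: tuple_scale_def basis_tuple_def monomial_def pderivative_single mult_single Const_def
          del: single_of_nat)
  next
    case 3
    then show ?thesis
      using assms unfolding tuple_bracket_def
      by (subst sum.neutral) (auto simp: tuple_scale_def basis_tuple_def)
  qed
qed

lemma ideal_scale_cancel:
  fixes f :: "'k::field tuple"
  assumes "ideal n A" "c \<noteq> 0" "tuple_scale c f \<in> A"
  shows "f \<in> A"
proof -
  have "tuple_scale (inverse c) (tuple_scale c f) = f"
    using assms(2) by (intro ext poly_mapping_eqI) (simp add: lookup_tuple_scale)
  then show ?thesis using idealD(4)[OF assms(1,3), of "inverse c"] by simp
qed

text \<open>
  A term \<open>f\<^sub>j \<partial>\<^sub>j(g\<^sub>i)\<close> of a bracket belongs to a block \<open>i\<close> beyond block \<open>j\<close>.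
\<close>

lemma bracket_within_tail:
  assumes S: "downset n S"
  shows "bracket_within (span_on (tail n k \<union> S)) (span_on (tail n k \<union> S))
    (span_on (tail n (Suc k) \<union> S) :: 'k::comm_ring_1 tuple set)"
  unfolding bracket_within_def
proof (intro ballI span_onI)
  fix f g :: "'k tuple" and \<alpha> i
  assume f: "f \<in> span_on (tail n k \<union> S)" and g: "g \<in> span_on (tail n k \<union> S)"
    and nz: "lookup (tuple_bracket f g i) \<alpha> \<noteq> 0"
  have "tail n k \<union> S \<subseteq> basis_index n" using S by (auto simp: tail_def downset_def)
  then have "f \<in> span_on (basis_index n)" "g \<in> span_on (basis_index n)"
    using f g span_on_mono by blast+
  then have W: "(\<alpha>, i) \<in> basis_index n" using span_onD[OF tuple_bracket_closed nz] by blast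
  from nz obtain j \<beta> where j: "j < i" "lookup (f j) \<beta> \<noteq> 0 \<or> lookup (g j) \<beta> \<noteq> 0"
    by (rule tuple_bracket_nonzero) blast
  then have "(\<beta>, j) \<in> tail n k \<union> S" using span_onD[OF f] span_onD[OF g] by blast
  moreover have "(\<alpha>, i) \<in> tail n (Suc k)" if "(\<beta>, j) \<in> tail n k"
    using that W j(1) by (auto simp: tail_def)
  moreover have "(\<alpha>, i) \<in> S" if "(\<beta>, j) \<in> S"
  proof -
    have "(\<alpha>, i) \<prec> (\<beta>, j)" using j(1) by (simp add: index_less_Pair)
    then show ?thesis using that W S unfolding downset_def by blast
  qed
  ultimately show "(\<alpha>, i) \<in> tail n (Suc k) \<union> S" by blast
qed

text \<open>
  Up to a nonzero factor \<open>x\<^sup>\<alpha> \<partial>\<^sub>i\<close> is the bracket of \<open>\<partial>\<^bsub>i-1\<^esub>\<close> and \<open>x\<^bsub>i-1\<^esub> x\<^sup>\<alpha> \<partial>\<^sub>i\<close>.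
\<close>

lemma tail_least:
  fixes C :: "'k::field_char_0 tuple set"
  assumes C: "ideal n C" and br: "bracket_within (span_on (tail n k \<union> S)) (span_on (tail n k \<union> S)) C"
  shows "span_on (tail n (Suc k)) \<subseteq> C"
proof
  fix f :: "'k tuple" assume f: "f \<in> span_on (tail n (Suc k))"
  show "f \<in> C"
  proof (rule ideal_contains_supported[OF C, of "tail n (Suc k)"])
    show "f \<in> span_on (basis_index n)" "support f \<subseteq> tail n (Suc k)"
      using f span_on_mono[of "tail n (Suc k)" "basis_index n"] by (auto simp: tail_def span_on_def)
    fix b assume b: "b \<in> tail n (Suc k)"
    obtain \<alpha> i where b_eq: "b = (\<alpha>, i)" by (cases b)
    have i: "Suc k < i" "i \<le> n" "keys \<alpha> \<subseteq> {1..i - 1}" using b by (auto simp: b_eq tail_def basis_index_def)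
    have "(0, i - 1) \<in> tail n k" "(\<alpha> + \<epsilon> (i - 1), i) \<in> tail n k"
      using i by (auto simp: tail_def basis_index_def keys_plus_exp)
    then have "tuple_bracket (basis_tuple (0, i - 1)) (basis_tuple (\<alpha> + \<epsilon> (i - 1), i)) \<in> C"
      using br unfolding bracket_within_def by (simp add: basis_tuple_supported)
    moreover have "1 \<le> i - 1" "i - 1 < i" using i by auto
    ultimately have "tuple_scale (of_nat (lookup (\<alpha> + \<epsilon> (i - 1)) (i - 1))) (basis_tuple b) \<in> C"
      unfolding b_eq by (simp add: tuple_bracket_basis)
    then show "basis_tuple b \<in> C"
      by (rule ideal_scale_cancel[OF C, rotated]) (simp add: lookup_add del: of_nat_add of_nat_Suc)
  qed
qed

text \<open>
  On either side the next ideal is the least one above the kernel that contains all brackets of its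
  predecessor.  The preimage of the next ideal on the right contains the brackets of the predecessor on
  the left, hence the next ideal on the left.
\<close>

lemma image_tail_step:
  fixes R :: "('k::field_char_0 tuple \<times> 'k tuple) set"
  assumes R: "correspondence n (span_on S) (span_on S') R" and S: "downset n S" and S': "downset n S'"
    and eq: "R `` span_on (tail n k \<union> S) = span_on (tail n k \<union> S')"
  shows "R `` span_on (tail n (Suc k) \<union> S) \<subseteq> span_on (tail n (Suc k) \<union> S')"
proof -
  let ?A = "\<lambda>k S. span_on (tail n k \<union> S) :: 'k tuple set"
  note R' = correspondence_converse[OF R]
  have I: "ideal n (?A l T)" "ideal n (span_on T :: 'k tuple set)" if "downset n T" for l T
    using that by (auto intro: ideal_span_on downset_Un downset_tail)
  have preimage: "R\<inverse> `` ?A k S' = ?A k S"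
    unfolding eq[symmetric] by (rule converse_image_image[OF R I(2)[OF S'] I(1)[OF S]]) (simp add: span_on_subset_iff)
  let ?C = "R\<inverse> `` ?A (Suc k) S'"
  have C: "ideal n ?C" by (rule image_ideal[OF R' I(1)[OF S']])
  have "span_on S \<subseteq> ?C"
    by (rule image_contains[OF R' I(2)[OF S]]) (simp add: span_on_subset_iff)
  moreover have "span_on (tail n (Suc k)) \<subseteq> ?C"
    using tail_least[OF C] bracket_within_image[OF R' bracket_within_tail[OF S', of k]] unfolding preimage by blast
  moreover obtain T where T: "downset n T" "?C = span_on T" using ideal_classification[OF C] by blast
  ultimately have "?A (Suc k) S \<subseteq> ?C" by (simp add: span_on_subset_iff)
  then show ?thesis
    by (intro image_subsetI[OF R I(2)[OF S] I(1)[OF S']]) (simp_all add: span_on_subset_iff)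
qed

text \<open>
  Modulo the ideal, the span of the blocks beyond \<open>k\<close> is the \<open>k\<close>-th derived algebra, and therefore
  it is carried along by every isomorphism.
\<close>

lemma image_tail:
  fixes R :: "('k::field_char_0 tuple \<times> 'k tuple) set"
  assumes R: "correspondence n (span_on S) (span_on S') R" and S: "downset n S" and S': "downset n S'"
  shows "R `` span_on (tail n k \<union> S) = span_on (tail n k \<union> S')"
proof (induction k)
  case 0
  have "tail n 0 \<union> T = basis_index n" if "downset n T" for T
    using that by (auto simp: tail_def basis_index_def downset_def)
  moreover have "R `` span_on (basis_index n) = span_on (basis_index n)"
  proof (intro equalityI subsetI)
    fix g assume "g \<in> R `` span_on (basis_index n)"
    then show "g \<in> span_on (basis_index n)" using correspondenceD(2)[OF R] by blast
  next
    fix g :: "'k tuple" assume "g \<in> span_on (basis_index n)"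
    then obtain f where "(f, g) \<in> R" using correspondenceD(4)[OF R] by blast
    then show "g \<in> R `` span_on (basis_index n)" using correspondenceD(1)[OF R] by blast
  qed
  ultimately show ?case using S S' by simp
next
  case (Suc k)
  let ?A = "\<lambda>k S. span_on (tail n k \<union> S) :: 'k tuple set"
  note R' = correspondence_converse[OF R]
  have I: "ideal n (?A l T)" "ideal n (span_on T :: 'k tuple set)" if "downset n T" for l T
    using that by (auto intro: ideal_span_on downset_Un downset_tail)
  have "R\<inverse> `` ?A k S' = ?A k S"
    unfolding Suc[symmetric] by (rule converse_image_image[OF R I(2)[OF S'] I(1)[OF S]]) (simp add: span_on_subset_iff)
  then have "R\<inverse> `` ?A (Suc k) S' \<subseteq> ?A (Suc k) S" by (rule image_tail_step[OF R' S' S])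
  then have "R `` R\<inverse> `` ?A (Suc k) S' \<subseteq> R `` ?A (Suc k) S" by blast
  moreover have "R `` R\<inverse> `` ?A (Suc k) S' = ?A (Suc k) S'"
    using converse_image_image[OF R' I(2)[OF S] I(1)[OF S']] by (simp add: span_on_subset_iff)
  ultimately show ?case using image_tail_step[OF R S S' Suc] by blast
qed

lemma tail_subset_transfer:
  fixes R :: "('k::field_char_0 tuple \<times> 'k tuple) set"
  assumes R: "correspondence n (span_on S) (span_on S') R" and S: "downset n S" and S': "downset n S'"
  shows "tail n k \<subseteq> S \<Longrightarrow> tail n k \<subseteq> S'"
proof -
  have 0: "tail n n = {}" by (auto simp: tail_def basis_index_def)
  have "R `` span_on S = span_on S'"
    using image_tail[OF R S S', of n] by (simp add: 0)
  moreover assume "tail n k \<subseteq> S"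
  ultimately have "span_on (tail n k \<union> S') = (span_on S' :: 'k tuple set)"
    using image_tail[OF R S S', of k] by (simp add: Un_absorb1)
  then show "tail n k \<subseteq> S'" by (auto simp: span_on_inject)
qed

text \<open>
  In other words, the quotient has derived length \<open>s\<close>.
\<close>

lemma tail_subset_below_iff:
  "(\<alpha>, s) \<in> basis_index n \<Longrightarrow> tail n k \<subseteq> below n (\<alpha>, s) \<longleftrightarrow> s \<le> k"
proof
  assume "tail n k \<subseteq> below n (\<alpha>, s)" "(\<alpha>, s) \<in> basis_index n"
  then show "s \<le> k"
    using subsetD[of "tail n k" "below n (\<alpha>, s)" "(\<alpha>, s)"] by (auto simp: tail_def below_def not_less[symmetric])
qed (auto simp: tail_def below_def index_less_def)

subsection \<open>Two centralizers\<close>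

text \<open>
  Let \<open>I\<close> be the ideal of all elements below \<open>x\<^sup>\<alpha> \<partial>\<^bsub>r+1\<^esub>\<close>, where \<open>\<alpha> = \<alpha>' + a \<epsilon>\<^sub>r\<close> and \<open>\<alpha>'\<close>
  involves only \<open>x\<^sub>1, \<dots>, x\<^bsub>r-1\<^esub>\<close>.  Modulo \<open>I\<close>, the \<open>r\<close>-th derived algebra is the span of the tail beyond
  block \<open>r\<close>, and the least ideal properly above it adds \<open>\<partial>\<^sub>r\<close>.  The centralizer of that ideal is
  \<open>below n (\<alpha> + \<epsilon> r, Suc r)\<close>, because \<open>\<partial>\<^sub>r\<close> lowers the exponent of \<open>x\<^sub>r\<close> by one; the centralizer of the
  previous derived algebra, which contains every \<open>x\<^sup>\<delta> \<partial>\<^sub>r\<close>, is \<open>below n ((a + 1) \<epsilon>\<^sub>r, Suc r)\<close>.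
\<close>

lemma bracket_within_centralizer1:
  assumes r: "1 \<le> r" and \<alpha>: "(\<alpha>, Suc r) \<in> basis_index n"
  shows "bracket_within (span_on (insert (0, r) (tail n r))) (span_on (below n (\<alpha> + \<epsilon> r, Suc r)))
    (span_on (below n (\<alpha>, Suc r)) :: 'k::comm_ring_1 tuple set)"
  unfolding bracket_within_def
proof (intro ballI span_onI)
  fix f g :: "'k tuple" and \<kappa> i
  assume f: "f \<in> span_on (insert (0, r) (tail n r))" and g: "g \<in> span_on (below n (\<alpha> + \<epsilon> r, Suc r))"
    and nz: "lookup (tuple_bracket f g i) \<kappa> \<noteq> 0"
  have "insert (0, r) (tail n r) \<subseteq> basis_index n" "below n (\<alpha> + \<epsilon> r, Suc r) \<subseteq> basis_index n"
    using r \<alpha> by (auto simp: tail_def below_def basis_index_def)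
  then have "f \<in> span_on (basis_index n)" "g \<in> span_on (basis_index n)"
    using f g span_on_mono by blast+
  then have W: "(\<kappa>, i) \<in> basis_index n" using span_onD[OF tuple_bracket_closed nz] by blast
  from nz obtain j \<beta> \<gamma> where j: "j < i" and \<kappa>: "\<kappa> = \<beta> + \<gamma>" and
    alt: "lookup (f j) \<beta> \<noteq> 0 \<and> lookup (g i) (\<gamma> + \<epsilon> j) \<noteq> 0 \<or>
      lookup (g j) \<beta> \<noteq> 0 \<and> lookup (f i) (\<gamma> + \<epsilon> j) \<noteq> 0"
    by (rule tuple_bracket_nonzero)
  have fD: "(j = r \<and> \<beta> = 0) \<or> r < j" if "lookup (f j) \<beta> \<noteq> 0" for j \<beta>
    using span_onD[OF f that] by (auto simp: tail_def)
  have gD: "r < j \<and> (j = Suc r \<longrightarrow> \<beta> \<lhd> \<alpha> + \<epsilon> r)" if "lookup (g j) \<beta> \<noteq> 0" for j \<beta>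
    using span_onD[OF g that] by (auto simp: below_def index_less_Pair)
  show "(\<kappa>, i) \<in> below n (\<alpha>, Suc r)"
  proof (cases "Suc r < i")
    case False
    then have "lookup (f j) \<beta> \<noteq> 0" "lookup (g i) (\<gamma> + \<epsilon> j) \<noteq> 0" "i = Suc r" "j = r" "\<beta> = 0"
      using alt fD[of j \<beta>] gD[of j \<beta>] gD[of i "\<gamma> + \<epsilon> j"] j by auto
    moreover have "\<gamma> + \<epsilon> r \<lhd> \<alpha> + \<epsilon> r" using gD[of i "\<gamma> + \<epsilon> r"] calculation by simp
    ultimately show ?thesis using W unfolding colex_add by (simp add: below_def index_less_Pair \<kappa>)
  qed (use W in \<open>simp add: below_def index_less_Pair\<close>)
qed

lemma centralizer1_greatest:
  assumes r: "1 \<le> r" and \<alpha>: "(\<alpha>, Suc r) \<in> basis_index n" and X: "downset n X"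
    and br: "bracket_within (span_on (insert (0, r) (tail n r))) (span_on X)
      (span_on (below n (\<alpha>, Suc r)) :: 'k::field_char_0 tuple set)"
  shows "X \<subseteq> below n (\<alpha> + \<epsilon> r, Suc r)"
proof (rule downset_not_mem[OF X])
  show "(\<alpha> + \<epsilon> r, Suc r) \<in> basis_index n" using r \<alpha> by (auto simp: basis_index_def keys_plus_exp)
  show "(\<alpha> + \<epsilon> r, Suc r) \<notin> X"
  proof
    assume *: "(\<alpha> + \<epsilon> r, Suc r) \<in> X"
    let ?A = "span_on (below n (\<alpha>, Suc r)) :: 'k tuple set"
    have "tuple_bracket (basis_tuple (0, r)) (basis_tuple (\<alpha> + \<epsilon> r, Suc r)) \<in> ?A"
      using br * unfolding bracket_within_def by (simp add: basis_tuple_supported)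
    then have "tuple_scale (of_nat (lookup (\<alpha> + \<epsilon> r) r)) (basis_tuple (\<alpha>, Suc r)) \<in> ?A"
      using r by (simp add: tuple_bracket_basis)
    then have "basis_tuple (\<alpha>, Suc r) \<in> ?A"
      by (rule ideal_scale_cancel[OF ideal_span_on[OF downset_below], rotated])
        (simp add: lookup_add del: of_nat_add of_nat_Suc)
    then show False by (simp add: basis_tuple_supported below_def)
  qed
qed

lemma bracket_within_centralizer2:
  assumes r: "1 \<le> r" and \<alpha>: "(\<alpha> + single r a, Suc r) \<in> basis_index n"
  shows "bracket_within (span_on (tail n (r - 1))) (span_on (below n (single r (Suc a), Suc r)))
    (span_on (below n (\<alpha> + single r a, Suc r)) :: 'k::comm_ring_1 tuple set)"
  unfolding bracket_within_def
proof (intro ballI span_onI)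
  fix f g :: "'k tuple" and \<kappa> i
  assume f: "f \<in> span_on (tail n (r - 1))"
    and g: "g \<in> span_on (below n (single r (Suc a), Suc r))"
    and nz: "lookup (tuple_bracket f g i) \<kappa> \<noteq> 0"
  have "tail n (r - 1) \<subseteq> basis_index n" "below n (single r (Suc a), Suc r) \<subseteq> basis_index n"
    by (auto simp: tail_def below_def)
  then have "f \<in> span_on (basis_index n)" "g \<in> span_on (basis_index n)"
    using f g span_on_mono by blast+
  then have W: "(\<kappa>, i) \<in> basis_index n" using span_onD[OF tuple_bracket_closed nz] by blast
  from nz obtain j \<beta> \<gamma> where j: "j < i" and \<kappa>: "\<kappa> = \<beta> + \<gamma>" and
    alt: "lookup (f j) \<beta> \<noteq> 0 \<and> lookup (g i) (\<gamma> + \<epsilon> j) \<noteq> 0 \<or>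
      lookup (g j) \<beta> \<noteq> 0 \<and> lookup (f i) (\<gamma> + \<epsilon> j) \<noteq> 0"
    by (rule tuple_bracket_nonzero)
  have fD: "r \<le> j \<and> keys \<beta> \<subseteq> {1..j - 1}" if "lookup (f j) \<beta> \<noteq> 0" for j \<beta>
    using span_onD[OF f that] by (auto simp: tail_def basis_index_def)
  have gD: "r < j \<and> (j = Suc r \<longrightarrow> \<beta> \<lhd> single r (Suc a))" if "lookup (g j) \<beta> \<noteq> 0" for j \<beta>
    using span_onD[OF g that] by (auto simp: below_def index_less_Pair)
  show "(\<kappa>, i) \<in> below n (\<alpha> + single r a, Suc r)"
  proof (cases "Suc r < i")
    case False
    then have ij: "i = Suc r" "j = r" and "lookup (f j) \<beta> \<noteq> 0" "lookup (g i) (\<gamma> + \<epsilon> j) \<noteq> 0"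
      using alt fD[of j \<beta>] gD[of j \<beta>] gD[of i "\<gamma> + \<epsilon> j"] j by auto
    then have \<beta>: "keys \<beta> \<subseteq> {1..r - 1}" and "\<gamma> + \<epsilon> r \<lhd> single r (Suc a)"
      using fD gD by blast+
    moreover have "single r (Suc a) = single r a + \<epsilon> r"
      by (simp flip: single_add)
    ultimately have "\<gamma> \<lhd> single r a" by (simp add: colex_add)
    then obtain m where m: "lookup \<gamma> m < lookup (single r a) m"
      "\<forall>k>m. lookup \<gamma> k = lookup (single r a) k" unfolding colex_def by blast
    then have "m = r" by (simp add: lookup_single when_def split: if_splits)
    have "lookup \<beta> k = 0" if "r \<le> k" for k
    proof -
      have "k \<notin> keys \<beta>" using \<beta> that r by auto
      then show ?thesis by (simp only: in_keys_iff not_not)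
    qed
    moreover have "lookup \<alpha> k = 0" if "r < k" for k
    proof -
      have "k \<notin> keys \<alpha>" using \<alpha> that by (auto simp: basis_index_def keys_plus_exp)
      then show ?thesis by (simp only: in_keys_iff not_not)
    qed
    ultimately have "\<kappa> \<lhd> \<alpha> + single r a"
      unfolding colex_def \<kappa> using m \<open>m = r\<close>
      by (intro exI[of _ r]) (simp add: lookup_add)
    then show ?thesis using W by (simp add: below_def index_less_Pair ij)
  qed (use W in \<open>simp add: below_def index_less_Pair\<close>)
qed

lemma centralizer2_greatest:
  assumes r: "1 \<le> r" and \<alpha>: "(\<alpha> + single r a, Suc r) \<in> basis_index n"
    and \<alpha>': "keys \<alpha> \<subseteq> {1..r - 1}" and X: "downset n X"
    and br: "bracket_within (span_on (tail n (r - 1))) (span_on X)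
      (span_on (below n (\<alpha> + single r a, Suc r)) :: 'k::field_char_0 tuple set)"
  shows "X \<subseteq> below n (single r (Suc a), Suc r)"
proof (rule downset_not_mem[OF X])
  show "(single r (Suc a), Suc r) \<in> basis_index n" using r \<alpha> by (auto simp: basis_index_def)
  show "(single r (Suc a), Suc r) \<notin> X"
  proof
    assume *: "(single r (Suc a), Suc r) \<in> X"
    let ?A = "span_on (below n (\<alpha> + single r a, Suc r)) :: 'k tuple set"
    have "(\<alpha>, r) \<in> tail n (r - 1)" using r \<alpha> \<alpha>' by (auto simp: tail_def basis_index_def)
    then have "tuple_bracket (basis_tuple (\<alpha>, r)) (basis_tuple (single r (Suc a), Suc r)) \<in> ?A"
      using br * unfolding bracket_within_def by (simp add: basis_tuple_supported)
    moreover have "single r (Suc a) - \<epsilon> r = single r a"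
      by (rule poly_mapping_eqI) (auto simp: lookup_minus lookup_single when_def)
    ultimately have "tuple_scale (of_nat (Suc a)) (basis_tuple (\<alpha> + single r a, Suc r)) \<in> ?A"
      using r by (simp add: tuple_bracket_basis del: of_nat_Suc)
    then have "basis_tuple (\<alpha> + single r a, Suc r) \<in> ?A"
      by (rule ideal_scale_cancel[OF ideal_span_on[OF downset_below], rotated]) (simp del: of_nat_Suc)
    then show False by (simp add: basis_tuple_supported below_def)
  qed
qed

subsection \<open>Recovering the exponents\<close>

lemma split_top_exponent:
  fixes \<kappa> :: "nat \<Rightarrow>\<^sub>0 nat"
  assumes "1 \<le> r" "keys \<kappa> \<subseteq> {1..r}"
  obtains \<delta> where "\<kappa> = \<delta> + single r (lookup \<kappa> r)" "keys \<delta> \<subseteq> {1..r - 1}"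
proof
  let ?\<delta> = "\<kappa> - single r (lookup \<kappa> r)"
  have \<delta>: "lookup ?\<delta> k = (if k = r then 0 else lookup \<kappa> k)" for k
    by (simp add: lookup_minus lookup_single when_def)
  show "\<kappa> = ?\<delta> + single r (lookup \<kappa> r)"
    by (rule poly_mapping_eqI) (simp add: lookup_add \<delta> lookup_single when_def)
  show "keys ?\<delta> \<subseteq> {1..r - 1}"
  proof
    fix k assume "k \<in> keys ?\<delta>"
    then have "k \<noteq> r" "k \<in> keys \<kappa>" by (auto simp: in_keys_iff \<delta> split: if_splits)
    moreover have "k \<in> {1..r}" using calculation(2) assms(2) by blast
    ultimately show "k \<in> {1..r - 1}" by auto
  qed
qed

lemma lookup_above_keys:
  fixes \<alpha> :: "nat \<Rightarrow>\<^sub>0 nat"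
  shows "keys \<alpha> \<subseteq> {1..r - 1} \<Longrightarrow> 1 \<le> r \<Longrightarrow> r \<le> k \<Longrightarrow> lookup \<alpha> k = 0"
proof -
  assume "keys \<alpha> \<subseteq> {1..r - 1}" "1 \<le> r" "r \<le> k"
  then have "k \<notin> keys \<alpha>" by auto
  then show ?thesis by (simp only: in_keys_iff not_not)
qed

lemma colex_asym: "\<alpha> \<lhd> \<beta> \<Longrightarrow> \<not> \<beta> \<lhd> \<alpha>"
  using colex_trans[of \<alpha> \<beta> \<alpha>] by auto

lemma colex_add_single_iff:
  assumes "1 \<le> r" "keys \<alpha> \<subseteq> {1..r - 1}" "keys \<beta> \<subseteq> {1..r - 1}"
  shows "\<alpha> + single r a \<lhd> \<beta> + single r b \<longleftrightarrow> a < b \<or> a = b \<and> \<alpha> \<lhd> \<beta>"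
proof -
  have less: "\<alpha> + single r a \<lhd> \<beta> + single r b"
    if "a < b" "keys \<alpha> \<subseteq> {1..r - 1}" "keys \<beta> \<subseteq> {1..r - 1}" for \<alpha> \<beta> a b
    unfolding colex_def using that lookup_above_keys[OF that(2) assms(1)] lookup_above_keys[OF that(3) assms(1)]
    by (intro exI[of _ r]) (simp add: lookup_add lookup_single when_def)
  consider "a < b" | "a = b" | "b < a" by linarith
  then show ?thesis
  proof cases
    case 3
    then show ?thesis using colex_asym[OF less[OF 3 assms(3,2)]] by simp
  qed (use less[OF _ assms(2,3)] colex_add in auto)
qed

lemma add_single_in_basis_index:
  "1 \<le> r \<Longrightarrow> r < n \<Longrightarrow> keys \<alpha> \<subseteq> {1..r - 1} \<Longrightarrow> (\<alpha> + single r a, Suc r) \<in> basis_index n"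
  by (cases "a = 0") (force simp: basis_index_def keys_plus_exp)+

lemma downset_insert_tail:
  assumes "1 \<le> r" "r \<le> n"
  shows "downset n (insert (0, r) (tail n r))"
proof -
  have "(\<alpha>, i) \<in> tail n r" if "(\<alpha>, i) \<in> basis_index n" "(\<alpha>, i) \<prec> (0, r)" for \<alpha> i
    using that by (auto simp: index_less_Pair tail_def colex_def)
  then show ?thesis
    using assms downset_tail[of n r] by (auto simp: downset_def basis_index_def)
qed

text \<open>
  The index \<open>(0, r)\<close> of \<open>\<partial>\<^sub>r\<close> is the least one outside the tail beyond block \<open>r\<close>.
\<close>

lemma insert_tail_least:
  assumes X: "downset n X" "tail n r \<subseteq> X" "X \<noteq> tail n r" and r: "1 \<le> r" "r \<le> n"
  shows "insert (0, r) (tail n r) \<subseteq> X"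
proof -
  obtain \<alpha> i where b: "(\<alpha>, i) \<in> X" "(\<alpha>, i) \<notin> tail n r" using X(2,3) by (metis prod.collapse subsetI subset_antisym)
  then have "i \<le> r" using X(1) by (auto simp: downset_def tail_def)
  then have "(0, r) = (\<alpha>, i) \<or> (0, r) \<prec> (\<alpha>, i)"
    using colex_pointwise[of 0 \<alpha>] by (auto simp: index_less_Pair)
  moreover have "(0, r) \<in> basis_index n" using r by (simp add: basis_index_def)
  ultimately have "(0, r) \<in> X" using b(1) X(1) unfolding downset_def by metis
  then show ?thesis using X(2) by blast
qed

text \<open>
  The tail is preserved and so are strict inclusions.  Hence the image of the least ideal properly
  above the tail again lies properly above the tail.
\<close>

lemma insert_tail_subset_image:
  fixes R :: "('k::field_char_0 tuple \<times> 'k tuple) set"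
  assumes R: "correspondence n (span_on S) (span_on S') R" and S: "downset n S" and S': "downset n S'"
    and sub: "S \<subseteq> tail n r" "S' \<subseteq> tail n r" and r: "1 \<le> r" "r \<le> n"
  shows "span_on (insert (0, r) (tail n r)) \<subseteq> R `` span_on (insert (0, r) (tail n r))"
proof -
  let ?t = "span_on (tail n r) :: 'k tuple set"
  let ?E = "span_on (insert (0, r) (tail n r)) :: 'k tuple set"
  have t: "R `` ?t = ?t" using image_tail[OF R S S', of r] sub by (simp add: Un_absorb2)
  have E: "ideal n ?E" by (rule ideal_span_on[OF downset_insert_tail[OF r]])
  obtain X where X: "downset n X" "R `` ?E = span_on X"
    using ideal_classification[OF image_ideal[OF R E]] by blast
  have "?t \<subseteq> R `` ?E" using Image_mono[of R R ?t ?E] unfolding t by (simp add: span_on_subset_iff subset_insertI)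
  then have "tail n r \<subseteq> X" by (simp add: X(2) span_on_subset_iff)
  moreover have "X \<noteq> tail n r"
  proof
    assume "X = tail n r"
    then have eq: "R `` ?E = R `` ?t" by (simp add: X(2) t)
    have "?E = R\<inverse> `` R `` ?E" using converse_image_image[OF R ideal_span_on[OF S'] E] sub(1)
      by (simp add: span_on_subset_iff subset_insertI2)
    also have "\<dots> = ?t"
      unfolding eq using converse_image_image[OF R ideal_span_on[OF S'] ideal_span_on[OF downset_tail], of r] sub(1)
      by (simp add: span_on_subset_iff)
    finally have "insert (0, r) (tail n r) = tail n r" by (simp only: span_on_inject)
    moreover have "(0, r) \<notin> tail n r" by (simp add: tail_def)
    ultimately show False by blast
  qed
  ultimately show ?thesis
    using insert_tail_least[OF X(1) _ _ r] by (simp add: X(2) span_on_subset_iff)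
qed

lemma image_insert_tail:
  fixes R :: "('k::field_char_0 tuple \<times> 'k tuple) set"
  assumes R: "correspondence n (span_on S) (span_on S') R" and S: "downset n S" and S': "downset n S'"
    and sub: "S \<subseteq> tail n r" "S' \<subseteq> tail n r" and r: "1 \<le> r" "r \<le> n"
  shows "R `` span_on (insert (0, r) (tail n r)) = span_on (insert (0, r) (tail n r))"
proof (rule equalityI)
  let ?E = "span_on (insert (0, r) (tail n r)) :: 'k tuple set"
  have "ideal n ?E" by (rule ideal_span_on[OF downset_insert_tail[OF r]])
  moreover have "span_on S' \<subseteq> ?E" using sub(2) by (simp add: span_on_subset_iff subset_insertI2)
  ultimately show "R `` ?E \<subseteq> ?E"
    by (rule image_subsetI[OF R ideal_span_on[OF S]])
      (rule insert_tail_subset_image[OF correspondence_converse[OF R] S' S sub(2,1) r])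
qed (rule insert_tail_subset_image[OF R S S' sub r])

lemma below_Suc_subset_tail: "below n (\<alpha>, Suc r) \<subseteq> tail n r"
  by (auto simp: below_def tail_def index_less_def)

lemma image_zero_ideal:
  assumes R: "correspondence n I J R" and J: "ideal n J"
  shows "R `` I = J"
  using correspondenceD(9)[OF R] correspondenceD(4)[OF R] idealD(1)[OF J] by blast

text \<open>
  The image of the centralizer centralizes the image of what it centralized, which is the same ideal on
  the other side, and there the centralizer is the greatest such ideal.
\<close>

lemma image_centralizer1_subset:
  fixes R :: "('k::field_char_0 tuple \<times> 'k tuple) set"
  assumes R: "correspondence n (span_on (below n (\<alpha>, Suc r))) (span_on (below n (\<beta>, Suc r))) R"
    and r: "1 \<le> r" and \<alpha>: "(\<alpha>, Suc r) \<in> basis_index n" and \<beta>: "(\<beta>, Suc r) \<in> basis_index n"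
  shows "R `` span_on (below n (\<alpha> + \<epsilon> r, Suc r)) \<subseteq> span_on (below n (\<beta> + \<epsilon> r, Suc r))"
proof -
  let ?C = "span_on (below n (\<alpha> + \<epsilon> r, Suc r)) :: 'k tuple set"
  obtain X where X: "downset n X" "R `` ?C = span_on X"
    using ideal_classification[OF image_ideal[OF R ideal_span_on[OF downset_below]]] by blast
  have "r \<le> n" using \<alpha> by (simp add: basis_index_def)
  then have "bracket_within (span_on (insert (0, r) (tail n r))) (span_on X)
      (span_on (below n (\<beta>, Suc r)) :: 'k tuple set)"
    using bracket_within_image[OF R bracket_within_centralizer1[OF r \<alpha>]]
      image_insert_tail[OF R downset_below downset_below below_Suc_subset_tail below_Suc_subset_tail r]
      image_zero_ideal[OF R ideal_span_on[OF downset_below]]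
    unfolding X(2) by simp
  then show ?thesis
    unfolding X(2) span_on_subset_iff by (rule centralizer1_greatest[OF r \<beta> X(1)])
qed

lemma image_centralizer2_subset:
  fixes R :: "('k::field_char_0 tuple \<times> 'k tuple) set"
  assumes R: "correspondence n (span_on (below n (\<alpha> + single r a, Suc r)))
      (span_on (below n (\<beta> + single r b, Suc r))) R"
    and r: "1 \<le> r" "r < n" and \<alpha>: "keys \<alpha> \<subseteq> {1..r - 1}" and \<beta>: "keys \<beta> \<subseteq> {1..r - 1}"
  shows "R `` span_on (below n (single r (Suc a), Suc r)) \<subseteq>
    span_on (below n (single r (Suc b), Suc r))"
proof -
  let ?C = "span_on (below n (single r (Suc a), Suc r)) :: 'k tuple set"
  obtain X where X: "downset n X" "R `` ?C = span_on X"
    using ideal_classification[OF image_ideal[OF R ideal_span_on[OF downset_below]]] by blast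
  have sub: "below n (\<gamma>, Suc r) \<subseteq> tail n (r - 1)" for \<gamma>
    by (auto simp: below_def tail_def index_less_def)
  have t: "R `` span_on (tail n (r - 1)) = span_on (tail n (r - 1))"
    using image_tail[OF R downset_below downset_below, of "r - 1"] unfolding Un_absorb2[OF sub] .
  have "bracket_within (span_on (tail n (r - 1))) (span_on X)
      (span_on (below n (\<beta> + single r b, Suc r)) :: 'k tuple set)"
    using bracket_within_image[OF R bracket_within_centralizer2[OF r(1) add_single_in_basis_index[OF r \<alpha>, of a]]]
    unfolding X(2) t image_zero_ideal[OF R ideal_span_on[OF downset_below]] .
  then show ?thesis
    unfolding X(2) span_on_subset_iff
    by (rule centralizer2_greatest[OF r(1) add_single_in_basis_index[OF r \<beta>] \<beta> X(1)])
qed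

text \<open>
  If \<open>\<gamma>\<close> were the least element that \<open>h\<close> decreases, then \<open>h \<gamma>\<close> would be a smaller one.
\<close>

lemma strictly_increasing_not_below:
  assumes mono: "\<And>\<gamma> \<gamma>'. P \<gamma> \<Longrightarrow> P \<gamma>' \<Longrightarrow> \<gamma> \<lhd> \<gamma>' \<Longrightarrow> h \<gamma> \<lhd> h \<gamma>'"
    and keys: "\<And>\<gamma>. P \<gamma> \<Longrightarrow> keys \<gamma> \<subseteq> {..<m}"
    and down: "\<And>\<gamma>. P \<gamma> \<Longrightarrow> h \<gamma> \<lhd> \<gamma> \<Longrightarrow> P (h \<gamma>)"
    and "P \<gamma>"
  shows "\<not> h \<gamma> \<lhd> \<gamma>"
proof
  assume "h \<gamma> \<lhd> \<gamma>"
  then have "{\<gamma>. P \<gamma> \<and> h \<gamma> \<lhd> \<gamma>} \<noteq> {}" using assms(4) by blast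
  then obtain \<delta> where \<delta>: "P \<delta>" "h \<delta> \<lhd> \<delta>" "\<And>\<gamma>. P \<gamma> \<Longrightarrow> h \<gamma> \<lhd> \<gamma> \<Longrightarrow> \<gamma> = \<delta> \<or> \<delta> \<lhd> \<gamma>"
    using colex_least[of "{\<gamma>. P \<gamma> \<and> h \<gamma> \<lhd> \<gamma>}" m] keys by auto
  have "P (h \<delta>)" using down \<delta>(1,2) by blast
  moreover have "h (h \<delta>) \<lhd> h \<delta>" using mono[OF calculation \<delta>(1,2)] .
  ultimately have "h \<delta> = \<delta> \<or> \<delta> \<lhd> h \<delta>" using \<delta>(3) by blast
  then show False using \<delta>(2) colex_asym by auto
qed

text \<open>
  Between the two centralizers lies an interval of ideals that is isomorphic, as an ordered set, to
  the set of exponents up to \<open>\<alpha>\<close> in the variables \<open>x\<^sub>1, \<dots>, x\<^bsub>r-1\<^esub>\<close>.  An isomorphism of quotients embeds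
  this interval into the one for \<open>\<beta>\<close>, and a strictly increasing map on a well-order never decreases
  an element.
\<close>

lemma correspondence_not_less:
  fixes R :: "('k::field_char_0 tuple \<times> 'k tuple) set"
  assumes R: "correspondence n (span_on (below n (\<alpha> + single r a, Suc r)))
      (span_on (below n (\<beta> + single r b, Suc r))) R"
    and r: "1 \<le> r" "r < n" and \<alpha>: "keys \<alpha> \<subseteq> {1..r - 1}" and \<beta>: "keys \<beta> \<subseteq> {1..r - 1}"
  shows "\<not> \<beta> \<lhd> \<alpha>"
proof -
  let ?X = "\<lambda>\<gamma> a. below n (\<gamma> + single r a, Suc r)"
  let ?I = "\<lambda>\<gamma> a. span_on (?X \<gamma> a) :: 'k tuple set"
  note R' = correspondence_converse[OF R]
  note W = add_single_in_basis_index[OF r]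
  have ideal: "ideal n (?I \<gamma> c)" for \<gamma> c by (rule ideal_span_on[OF downset_below])
  have le: "?X \<gamma> c \<subseteq> ?X \<gamma>' c' \<longleftrightarrow> c < c' \<or> c = c' \<and> (\<gamma> = \<gamma>' \<or> \<gamma> \<lhd> \<gamma>')"
    if "keys \<gamma> \<subseteq> {1..r - 1}" "keys \<gamma>' \<subseteq> {1..r - 1}" for \<gamma> \<gamma>' c c'
  proof -
    have "lookup (\<gamma> + single r c) r = c" "lookup (\<gamma>' + single r c') r = c'"
      using lookup_above_keys[OF that(1) r(1)] lookup_above_keys[OF that(2) r(1)] by (simp_all add: lookup_add)
    then have "\<gamma> + single r c = \<gamma>' + single r c' \<longleftrightarrow> c = c' \<and> \<gamma> = \<gamma>'" by auto
    then show ?thesis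
      unfolding below_subset_iff[OF W[OF that(2)]]
      using colex_add_single_iff[OF r(1) that, of c c'] by (auto simp: index_less_Pair)
  qed
  have top: "\<gamma> + single r c + \<epsilon> r = \<gamma> + single r (Suc c)" for \<gamma> c
    by (simp add: add.assoc flip: single_add)
  have C1: "R `` ?I \<alpha> (Suc a) \<subseteq> ?I \<beta> (Suc b)"
    using image_centralizer1_subset[OF R r(1) W[OF \<alpha>] W[OF \<beta>]] unfolding top .
  have C2: "R\<inverse> `` ?I 0 (Suc b) \<subseteq> ?I 0 (Suc a)"
    using image_centralizer2_subset[OF R' r \<beta> \<alpha>] by simp
  have preimage: "R\<inverse> `` R `` ?I \<gamma> (Suc a) = ?I \<gamma> (Suc a)" if "keys \<gamma> \<subseteq> {1..r - 1}" for \<gamma>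
    by (rule converse_image_image[OF R ideal ideal]) (simp add: span_on_subset_iff le[OF \<alpha> that])
  let ?P = "\<lambda>\<gamma>. keys \<gamma> \<subseteq> {1..r - 1} \<and> (\<gamma> = \<alpha> \<or> \<gamma> \<lhd> \<alpha>)"
  have "\<exists>\<delta>. keys \<delta> \<subseteq> {1..r - 1} \<and> (\<delta> = \<beta> \<or> \<delta> \<lhd> \<beta>) \<and> R `` ?I \<gamma> (Suc a) = ?I \<delta> (Suc b)"
    if \<gamma>: "?P \<gamma>" for \<gamma>
  proof -
    obtain X where X: "downset n X" "R `` ?I \<gamma> (Suc a) = span_on X"
      using ideal_classification[OF image_ideal[OF R ideal]] by blast
    have "?I \<gamma> (Suc a) \<subseteq> ?I \<alpha> (Suc a)"
      unfolding span_on_subset_iff using le[of \<gamma> \<alpha>] \<gamma> \<alpha> by simp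
    then have "R `` ?I \<gamma> (Suc a) \<subseteq> ?I \<beta> (Suc b)" using C1 by blast
    then have upper: "X \<subseteq> ?X \<beta> (Suc b)" by (simp add: X(2) span_on_subset_iff)
    have "R\<inverse> `` ?I 0 (Suc b) \<subseteq> ?I \<gamma> (Suc a)"
    proof -
      have "?I 0 (Suc a) \<subseteq> ?I \<gamma> (Suc a)"
        unfolding span_on_subset_iff using le[of 0 \<gamma>] \<gamma> colex_pointwise[of 0 \<gamma>] by simp
      then show ?thesis using C2 by blast
    qed
    then have "R `` R\<inverse> `` ?I 0 (Suc b) \<subseteq> R `` ?I \<gamma> (Suc a)" by blast
    moreover have "R `` R\<inverse> `` ?I 0 (Suc b) = ?I 0 (Suc b)"
      using converse_image_image[OF R' ideal ideal, of 0 "Suc b"] le[OF \<beta>, of 0 b "Suc b"]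
      by (simp add: span_on_subset_iff)
    ultimately have lower: "?X 0 (Suc b) \<subseteq> X" by (simp add: X(2) span_on_subset_iff)
    have "(\<beta> + single r (Suc b), Suc r) \<notin> X" using upper by (auto simp: below_def)
    with W[OF \<beta>] have "X \<noteq> basis_index n" by blast
    with downset_cases[OF X(1)] obtain c where c: "c \<in> basis_index n" "X = below n c" by metis
    have c1: "c = (\<beta> + single r (Suc b), Suc r) \<or> c \<prec> (\<beta> + single r (Suc b), Suc r)"
      using upper unfolding c(2) by (simp only: below_subset_iff[OF W[OF \<beta>]])
    have c2: "(single r (Suc b), Suc r) = c \<or> (single r (Suc b), Suc r) \<prec> c"
      using lower unfolding c(2) by (simp add: below_subset_iff[OF c(1)])
    obtain \<kappa> where \<kappa>: "c = (\<kappa>, Suc r)" using c1 c2 by (cases c) (auto simp: index_less_Pair)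
    then have "keys \<kappa> \<subseteq> {1..r}" using c(1) by (simp add: basis_index_def)
    then obtain \<delta> where \<delta>: "\<kappa> = \<delta> + single r (lookup \<kappa> r)" "keys \<delta> \<subseteq> {1..r - 1}"
      using split_top_exponent[OF r(1)] by blast
    define d where "d = lookup \<kappa> r"
    have X_eq: "X = ?X \<delta> d" unfolding c(2) \<kappa> d_def using \<delta>(1) by simp
    have "Suc b \<le> d" using lower le[of 0 \<delta> "Suc b" d] \<delta>(2) by (auto simp: X_eq)
    moreover have "d < Suc b \<or> d = Suc b \<and> (\<delta> = \<beta> \<or> \<delta> \<lhd> \<beta>)"
      using upper le[OF \<delta>(2) \<beta>] by (simp add: X_eq)
    ultimately show ?thesis using \<delta>(2) X(2) unfolding X_eq by auto
  qed
  then obtain h where h: "\<And>\<gamma>. ?P \<gamma> \<Longrightarrow> keys (h \<gamma>) \<subseteq> {1..r - 1}" "\<And>\<gamma>. ?P \<gamma> \<Longrightarrow> h \<gamma> = \<beta> \<or> h \<gamma> \<lhd> \<beta>"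
    "\<And>\<gamma>. ?P \<gamma> \<Longrightarrow> R `` ?I \<gamma> (Suc a) = ?I (h \<gamma>) (Suc b)" by metis
  have mono: "h \<gamma> \<lhd> h \<gamma>'" if P: "?P \<gamma>" "?P \<gamma>'" and less: "\<gamma> \<lhd> \<gamma>'" for \<gamma> \<gamma>'
  proof -
    have "?I \<gamma> (Suc a) \<subseteq> ?I \<gamma>' (Suc a)"
      unfolding span_on_subset_iff using le[of \<gamma> \<gamma>'] P less by simp
    then have "?I (h \<gamma>) (Suc b) \<subseteq> ?I (h \<gamma>') (Suc b)" unfolding h(3)[OF P(1), symmetric] h(3)[OF P(2), symmetric] by blast
    then have "h \<gamma> = h \<gamma>' \<or> h \<gamma> \<lhd> h \<gamma>'"
      using le[OF h(1)[OF P(1)] h(1)[OF P(2)]] by (simp add: span_on_subset_iff)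
    moreover have "h \<gamma> \<noteq> h \<gamma>'"
    proof
      assume "h \<gamma> = h \<gamma>'"
      then have "?I \<gamma> (Suc a) = ?I \<gamma>' (Suc a)"
        using preimage[of \<gamma>] preimage[of \<gamma>'] P h(3) by metis
      then have "?X \<gamma>' (Suc a) \<subseteq> ?X \<gamma> (Suc a)" by (simp add: span_on_inject)
      then show False using le[of \<gamma>' \<gamma>] P less colex_asym[OF less] by auto
    qed
    ultimately show ?thesis by blast
  qed
  have "\<not> h \<alpha> \<lhd> \<alpha>"
  proof (rule strictly_increasing_not_below[where P = ?P and m = r])
    show "keys \<gamma> \<subseteq> {..<r}" if "?P \<gamma>" for \<gamma> using that r(1) by force
    show "?P (h \<gamma>)" if "?P \<gamma>" "h \<gamma> \<lhd> \<gamma>" for \<gamma> using that h(1) colex_trans by blast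
  qed (use mono \<alpha> in auto)
  moreover have "h \<alpha> = \<beta> \<or> h \<alpha> \<lhd> \<beta>" using h(2)[of \<alpha>] \<alpha> by blast
  ultimately show ?thesis using colex_trans by auto
qed

text \<open>
  The criterion in terms of indices.  The first two alternatives are the quotients of dimension zero
  and one; in the third the exponent of the last variable \<open>x\<^sub>r\<close> of the block is arbitrary.
\<close>

definition similar :: "nat \<Rightarrow> index set \<Rightarrow> index set \<Rightarrow> bool" where
  "similar n S S' \<longleftrightarrow> S = basis_index n \<and> S' = basis_index n \<or> S = below n (0, 1) \<and> S' = below n (0, 1) \<or>
    (\<exists>r \<alpha> a b. 1 \<le> r \<and> r < n \<and> keys \<alpha> \<subseteq> {1..r - 1} \<and>
      S = below n (\<alpha> + single r a, Suc r) \<and> S' = below n (\<alpha> + single r b, Suc r))"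

text \<open>
  The derived length determines the block.  The interval between the two centralizers, applied in both
  directions, determines the exponents of the variables before the last one.
\<close>

theorem isomorphic_imp_similar:
  assumes S: "downset n S" and S': "downset n S'"
    and iso: "(tuples n :: ('k::field_char_0, 'k tuple) lie_algebra) //\<^sub>L span_on S \<cong>
      tuples n //\<^sub>L span_on S'"
  shows "similar n S S'"
proof -
  obtain R where R: "correspondence n (span_on S :: 'k tuple set) (span_on S') R"
    using isomorphic_imp_correspondence[OF ideal_span_on[OF S] ideal_span_on[OF S'] iso] ..
  note R' = correspondence_converse[OF R]
  have tails: "tail n k \<subseteq> S \<longleftrightarrow> tail n k \<subseteq> S'" for k
    using tail_subset_transfer[OF R S S'] tail_subset_transfer[OF R' S' S] by blast
  have tail_0: "tail n 0 = basis_index n" by (auto simp: tail_def basis_index_def)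
  have all: "T = basis_index n \<longleftrightarrow> tail n 0 \<subseteq> T" if "downset n T" for T
    using that unfolding tail_0 downset_def by blast
  show ?thesis
  proof (cases "S = basis_index n")
    case True
    then show ?thesis using all[OF S] all[OF S'] tails unfolding similar_def by blast
  next
    case False
    then have "S' \<noteq> basis_index n" using all[OF S] all[OF S'] tails by blast
    with False obtain c c' where c: "c \<in> basis_index n" "S = below n c" "c' \<in> basis_index n" "S' = below n c'"
      using downset_cases[OF S] downset_cases[OF S'] by metis
    obtain \<alpha> s \<beta> t where c_eq: "c = (\<alpha>, s)" "c' = (\<beta>, t)" by (cases c, cases c')
    have "s \<le> k \<longleftrightarrow> t \<le> k" for k
      using tails[of k] tail_subset_below_iff c unfolding c_eq by metis
    then have t: "t = s" by (meson le_antisym order_refl)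
    have keys: "1 \<le> s" "s \<le> n" "keys \<alpha> \<subseteq> {1..s - 1}" "keys \<beta> \<subseteq> {1..s - 1}"
      using c unfolding c_eq t by (auto simp: basis_index_def)
    show ?thesis
    proof (cases "s = 1")
      case True
      then have "\<alpha> = 0" "\<beta> = 0" using keys by auto
      then show ?thesis using c unfolding similar_def c_eq t True by blast
    next
      case False
      define r where "r = s - 1"
      have r: "s = Suc r" "1 \<le> r" "r < n" using False keys by (auto simp: r_def)
      obtain \<alpha>' where \<alpha>': "\<alpha> = \<alpha>' + single r (lookup \<alpha> r)" "keys \<alpha>' \<subseteq> {1..r - 1}"
        using split_top_exponent[OF r(2), of \<alpha>] keys(3) by (auto simp: r(1))
      obtain \<beta>' where \<beta>': "\<beta> = \<beta>' + single r (lookup \<beta> r)" "keys \<beta>' \<subseteq> {1..r - 1}"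
        using split_top_exponent[OF r(2), of \<beta>] keys(4) by (auto simp: r(1))
      have S_eq: "S = below n (\<alpha>' + single r (lookup \<alpha> r), Suc r)"
        "S' = below n (\<beta>' + single r (lookup \<beta> r), Suc r)"
        using c(2,4) unfolding c_eq t r(1) \<alpha>'(1)[symmetric] \<beta>'(1)[symmetric] by simp_all
      have "\<not> \<beta>' \<lhd> \<alpha>'" "\<not> \<alpha>' \<lhd> \<beta>'"
        using correspondence_not_less[OF R[unfolded S_eq] r(2,3) \<alpha>'(2) \<beta>'(2)]
          correspondence_not_less[OF R'[unfolded S_eq] r(2,3) \<beta>'(2) \<alpha>'(2)] .
      then have "\<alpha>' = \<beta>'" using colex_total by blast
      then show ?thesis using S_eq r(2,3) \<alpha>'(2) unfolding similar_def by blast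
    qed
  qed
qed

section \<open>A surjective endomorphism modulo an ideal\<close>

definition shift :: "nat \<Rightarrow> 'k::comm_ring_1 tuple \<Rightarrow> 'k tuple" where
  "shift r f i = (if i \<le> r then f i else if i = Suc r then \<partial> r (f i) else 0)"

lemma shift_closed:
  "r < n \<Longrightarrow> f \<in> span_on (basis_index n) \<Longrightarrow> shift r f \<in> span_on (basis_index n)"
  using span_on_component[of f n] span_on_component(1)[of f n "Suc r"] unfolding span_on_basis_index[of "shift r f"]
  by (auto simp: shift_def Polys_0 intro!: Polys_pderivative split: if_splits)

lemma shift_add: "shift r (f + g) = shift r f + shift r g"
  by (simp add: fun_eq_iff shift_def pderivative_add)

lemma shift_scale: "shift r (tuple_scale c f) = tuple_scale c (shift r f)"
  by (simp add: fun_eq_iff shift_def tuple_scale_def pderivative_Const_mult)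

text \<open>
  This endomorphism is \<open>\<partial>\<^sub>r\<close> on the coefficient of \<open>\<partial>\<^bsub>r+1\<^esub>\<close>.  It respects brackets because \<open>\<partial>\<^sub>r\<close>
  commutes with every \<open>f\<^sub>j \<partial>\<^sub>j\<close>, \<open>j \<le> r\<close>, whose coefficient \<open>f\<^sub>j\<close> does not involve \<open>x\<^sub>r\<close>.
\<close>

lemma shift_bracket:
  assumes f: "f \<in> span_on (basis_index n)" and g: "g \<in> span_on (basis_index n)"
  shows "shift r (tuple_bracket f g) = tuple_bracket (shift r f) (shift r g)"
proof
  fix i
  have 0: "\<partial> r (f j) = 0" "\<partial> r (g j) = 0" if "1 \<le> j" "j \<le> r" for j
    using that span_on_component(1)[OF f, of j] span_on_component(1)[OF g, of j]
    by (auto intro: pderivative_eq_0)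
  consider "i \<le> r" | "i = Suc r" | "Suc r < i" by linarith
  then show "shift r (tuple_bracket f g) i = tuple_bracket (shift r f) (shift r g) i"
  proof cases
    case 1
    then show ?thesis by (simp add: shift_def tuple_bracket_def)
  next
    case 2
    have "\<partial> r (f j * \<partial> j (g i) - g j * \<partial> j (f i)) = f j * \<partial> j (\<partial> r (g i)) - g j * \<partial> j (\<partial> r (f i))"
      if "j \<in> {1..<i}" for j
      using that 0[of j] 2 by (simp add: pderivative_diff pderivative_mult pderivative_commute[of r j])
    then have "\<partial> r (tuple_bracket f g i) = (\<Sum>j\<in>{1..<i}. f j * \<partial> j (\<partial> r (g i)) - g j * \<partial> j (\<partial> r (f i)))"
      unfolding tuple_bracket_def pderivative_sum by (intro sum.cong) auto
    also have "\<dots> = tuple_bracket (shift r f) (shift r g) i"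
      unfolding tuple_bracket_def using 2 by (intro sum.cong) (auto simp: shift_def)
    finally show ?thesis using 2 by (simp add: shift_def)
  next
    case 3
    then show ?thesis by (simp add: shift_def tuple_bracket_def)
  qed
qed

text \<open>
  Division by \<open>\<alpha>\<^sub>r + 1\<close> is where surjectivity needs characteristic zero.
\<close>

lemma antiderivative:
  fixes p :: "'k::field_char_0 mpoly"
  assumes p: "p \<in> Polys m" and r: "1 \<le> r" "r \<le> m"
  obtains q where "q \<in> Polys m" "\<partial> r q = p"
proof
  let ?q = "\<Sum>\<alpha>\<in>keys p. single (\<alpha> + \<epsilon> r) (lookup p \<alpha> / of_nat (Suc (lookup \<alpha> r)))"
  show "?q \<in> Polys m"
  proof (rule Polys_sum)
    fix \<alpha> assume "\<alpha> \<in> keys p"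
    then have "keys \<alpha> \<subseteq> {1..m}" using p by (simp add: Polys_def)
    then show "single (\<alpha> + \<epsilon> r) (lookup p \<alpha> / of_nat (Suc (lookup \<alpha> r))) \<in> Polys m"
      using r by (auto simp: Polys_def keys_plus_exp)
  qed
  have "\<partial> r ?q = (\<Sum>\<alpha>\<in>keys p. single \<alpha> (lookup p \<alpha>))"
    unfolding pderivative_sum
    by (intro sum.cong) (simp_all add: pderivative_single lookup_add del: of_nat_Suc)
  also have "\<dots> = p"
    by (rule poly_mapping_eqI) (simp add: lookup_sum lookup_single when_def sum.delta' in_keys_iff)
  finally show "\<partial> r ?q = p" .
qed

text \<open>
  Differentiation by \<open>x\<^sub>r\<close> lowers the exponent of \<open>x\<^sub>r\<close> by one.  The monomials that it kills do not
  involve \<open>x\<^sub>r\<close> and lie below \<open>x\<^sup>\<alpha> x\<^sub>r\<close> in any case.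
\<close>

lemma shift_mem_below_iff:
  fixes f :: "'k::field_char_0 tuple"
  assumes f: "f \<in> span_on (basis_index n)" and r: "1 \<le> r" "r < n" and \<alpha>: "(\<alpha>, Suc r) \<in> basis_index n"
  shows "shift r f \<in> span_on (below n (\<alpha>, Suc r)) \<longleftrightarrow> f \<in> span_on (below n (\<alpha> + \<epsilon> r, Suc r))"
proof
  assume L: "shift r f \<in> span_on (below n (\<alpha>, Suc r))"
  show "f \<in> span_on (below n (\<alpha> + \<epsilon> r, Suc r))"
  proof (rule span_onI)
    fix \<kappa> i assume nz: "lookup (f i) \<kappa> \<noteq> 0"
    have W: "(\<kappa>, i) \<in> basis_index n" using span_onD[OF f nz] .
    consider "i \<le> r" | "i = Suc r" | "Suc r < i" by linarith
    then show "(\<kappa>, i) \<in> below n (\<alpha> + \<epsilon> r, Suc r)"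
    proof cases
      case 1
      then have "lookup (shift r f i) \<kappa> \<noteq> 0" using nz by (simp add: shift_def)
      then show ?thesis using span_onD[OF L] 1 by (fastforce simp: below_def index_less_Pair)
    next
      case 2
      have "\<kappa> \<lhd> \<alpha> + \<epsilon> r"
      proof (cases "lookup \<kappa> r = 0")
        case True
        have "lookup \<kappa> k = 0" "lookup \<alpha> k = 0" if "r < k" for k
          using lookup_above_keys[of _ "Suc r" k] W \<alpha> that by (auto simp: basis_index_def 2)
        then show ?thesis
          unfolding colex_def using True
          by (intro exI[of _ r]) (simp add: lookup_add lookup_single when_def)
      next
        case False
        then have \<kappa>: "\<kappa> - \<epsilon> r + \<epsilon> r = \<kappa>" by (rule minus_unit_exp_add)
        then have "lookup (shift r f i) (\<kappa> - \<epsilon> r) \<noteq> 0"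
          using nz by (simp add: shift_def 2 lookup_pderivative del: of_nat_Suc)
        then have "\<kappa> - \<epsilon> r \<lhd> \<alpha>" using span_onD[OF L] by (fastforce simp: below_def index_less_Pair 2)
        then have "\<kappa> - \<epsilon> r + \<epsilon> r \<lhd> \<alpha> + \<epsilon> r" by (simp only: colex_add)
        then show ?thesis by (simp only: \<kappa>)
      qed
      then show ?thesis using W by (simp add: below_def index_less_Pair 2)
    next
      case 3
      then show ?thesis using W by (simp add: below_def index_less_Pair)
    qed
  qed
next
  assume L: "f \<in> span_on (below n (\<alpha> + \<epsilon> r, Suc r))"
  show "shift r f \<in> span_on (below n (\<alpha>, Suc r))"
  proof (rule span_onI)
    fix \<kappa> i assume nz: "lookup (shift r f i) \<kappa> \<noteq> 0"
    have W: "(\<kappa>, i) \<in> basis_index n" using span_onD[OF shift_closed[OF r(2) f] nz] .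
    consider "i \<le> r" | "i = Suc r" | "Suc r < i" by linarith
    then show "(\<kappa>, i) \<in> below n (\<alpha>, Suc r)"
    proof cases
      case 1
      then have "lookup (f i) \<kappa> \<noteq> 0" using nz by (simp add: shift_def)
      then show ?thesis using span_onD[OF L] 1 by (fastforce simp: below_def index_less_Pair)
    next
      case 2
      then have "lookup (f (Suc r)) (\<kappa> + \<epsilon> r) \<noteq> 0"
        using nz lookup_pderivative_nonzero[of r "f (Suc r)" \<kappa>] by (simp add: shift_def)
      then have "(\<kappa> + \<epsilon> r, Suc r) \<in> below n (\<alpha> + \<epsilon> r, Suc r)" by (rule span_onD[OF L])
      then have "\<kappa> + \<epsilon> r \<lhd> \<alpha> + \<epsilon> r" by (simp add: below_def index_less_Pair)
      then have "\<kappa> \<lhd> \<alpha>" by (simp only: colex_add)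
      then show ?thesis using W by (simp add: below_def index_less_Pair 2)
    next
      case 3
      then show ?thesis using W by (simp add: below_def index_less_Pair)
    qed
  qed
qed

text \<open>
  The correspondence is the graph of \<open>shift r\<close> modulo the target ideal.  That ideal contains all blocks
  after \<open>r + 1\<close>, so surjectivity concerns the coefficient of \<open>\<partial>\<^bsub>r+1\<^esub>\<close> only, and an antiderivative
  provides a preimage.
\<close>

lemma isomorphic_step:
  assumes r: "1 \<le> r" "r < n" and \<alpha>: "(\<alpha>, Suc r) \<in> basis_index n"
  shows "(tuples n :: ('k::field_char_0, 'k tuple) lie_algebra) //\<^sub>L span_on (below n (\<alpha> + \<epsilon> r, Suc r)) \<cong>
    tuples n //\<^sub>L span_on (below n (\<alpha>, Suc r))"
proof -
  let ?U = "span_on (basis_index n) :: 'k tuple set"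
  let ?I = "span_on (below n (\<alpha> + \<epsilon> r, Suc r)) :: 'k tuple set"
  let ?J = "span_on (below n (\<alpha>, Suc r)) :: 'k tuple set"
  have I: "ideal n ?I" and J: "ideal n ?J" by (rule ideal_span_on[OF downset_below])+
  define R where "R = {(f, g). f \<in> ?U \<and> g \<in> ?U \<and> g - shift r f \<in> ?J}"
  have Domain: "\<exists>g. (f, g) \<in> R" if "f \<in> ?U" for f
    using that shift_closed[OF r(2) that] idealD(2)[OF J] unfolding R_def
    by (intro exI[of _ "shift r f"]) simp
  have Range: "\<exists>f. (f, g) \<in> R" if g: "g \<in> ?U" for g
  proof -
    have "g (Suc r) \<in> Polys r" using span_on_component(1)[OF g, of "Suc r"] by simp
    then obtain q where q: "q \<in> Polys r" "\<partial> r q = g (Suc r)" using antiderivative[of _ r r] r(1) by blast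
    define f where "f i = (if i \<le> r then g i else if i = Suc r then q else 0)" for i
    have f: "f \<in> ?U"
      using span_on_component[OF g] q(1) r unfolding span_on_basis_index
      by (auto simp: f_def Polys_0 split: if_splits)
    have "g - shift r f \<in> ?J"
    proof (rule span_onI)
      fix \<kappa> i assume nz: "lookup ((g - shift r f) i) \<kappa> \<noteq> 0"
      then have "\<not> i \<le> Suc r" using q(2) by (auto simp: shift_def f_def fun_diff_def le_Suc_eq)
      then have i: "Suc r < i" "lookup (g i) \<kappa> \<noteq> 0" using nz by (auto simp: shift_def)
      then show "(\<kappa>, i) \<in> below n (\<alpha>, Suc r)"
        using span_onD[OF g i(2)] by (simp add: below_def index_less_Pair)
    qed
    then have "(f, g) \<in> R" using f g by (simp add: R_def)
    then show ?thesis by blast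
  qed
  have "correspondence n ?I ?J R"
    unfolding correspondence_def
  proof (intro conjI allI impI)
    show "Domain R = ?U" "Range R = ?U" using Domain Range by (auto simp: R_def)
  next
    fix f g f' g' assume "(f, g) \<in> R" "(f', g') \<in> R"
    then have f: "f \<in> ?U" "f' \<in> ?U" and g: "g \<in> ?U" "g' \<in> ?U"
      and d: "g - shift r f \<in> ?J" "g' - shift r f' \<in> ?J" by (simp_all add: R_def)
    have add: "g + g' - shift r (f + f') = (g - shift r f) + (g' - shift r f')"
      by (simp add: shift_add)
    show "(f + f', g + g') \<in> R"
      using f g idealD(3)[OF J d] unfolding R_def mem_Collect_eq split add
      by (simp add: span_on_add)
    have bracket: "tuple_bracket g g' - shift r (tuple_bracket f f') =
        tuple_bracket (g - shift r f) g' + tuple_bracket (shift r f) (g' - shift r f')"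
    proof -
      have "tuple_bracket g g' = tuple_bracket ((g - shift r f) + shift r f) g'" by simp
      also have "\<dots> = tuple_bracket (g - shift r f) g' + tuple_bracket (shift r f) ((g' - shift r f') + shift r f')"
        unfolding tuple_bracket_add(1) by simp
      also have "\<dots> = tuple_bracket (g - shift r f) g' + tuple_bracket (shift r f) (g' - shift r f') +
          shift r (tuple_bracket f f')"
        unfolding tuple_bracket_add(2) shift_bracket[OF f] by (simp add: add.assoc)
      finally show ?thesis by simp
    qed
    have "tuple_bracket (g - shift r f) g' + tuple_bracket (shift r f) (g' - shift r f') \<in> ?J"
      by (intro idealD(3)[OF J] ideal_bracket_right[OF J d(1) g(2)]
          idealD(5)[OF J shift_closed[OF r(2) f(1)] d(2)])
    then show "(tuple_bracket f f', tuple_bracket g g') \<in> R"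
      using f g by (simp add: R_def tuple_bracket_closed bracket)
  next
    fix c f g assume "(f, g) \<in> R"
    then have f: "f \<in> ?U" and g: "g \<in> ?U" and d: "g - shift r f \<in> ?J" by (simp_all add: R_def)
    have "tuple_scale c g - shift r (tuple_scale c f) = tuple_scale c (g - shift r f)"
      by (simp add: shift_scale fun_eq_iff tuple_scale_def right_diff_distrib)
    then show "(tuple_scale c f, tuple_scale c g) \<in> R"
      using f g idealD(4)[OF J d] by (simp add: R_def span_on_scale)
  next
    fix f g assume "(f, g) \<in> R"
    then have f: "f \<in> ?U" and d: "g - shift r f \<in> ?J" by (simp_all add: R_def)
    have "g \<in> ?J \<longleftrightarrow> shift r f \<in> ?J"
    proof
      assume "g \<in> ?J"
      from ideal_diff[OF J this d] show "shift r f \<in> ?J" by simp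
    next
      assume "shift r f \<in> ?J"
      from idealD(3)[OF J d this] show "g \<in> ?J" by simp
    qed
    then show "f \<in> ?I \<longleftrightarrow> g \<in> ?J" using shift_mem_below_iff[OF f r \<alpha>] by blast
  qed
  then show ?thesis by (rule correspondence_imp_isomorphic[OF I J])
qed

theorem isomorphic_if_equal_lower_exponents:
  assumes r: "1 \<le> r" "r < n" and \<alpha>: "keys \<alpha> \<subseteq> {1..r - 1}"
  shows "(tuples n :: ('k::field_char_0, 'k tuple) lie_algebra)
      //\<^sub>L span_on (below n (\<alpha> + single r a, Suc r)) \<cong>
    tuples n //\<^sub>L span_on (below n (\<alpha> + single r b, Suc r))"
proof -
  let ?Q = "\<lambda>a. (tuples n :: ('k, 'k tuple) lie_algebra)
    //\<^sub>L span_on (below n (\<alpha> + single r a, Suc r))"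
  have base: "?Q a \<cong> ?Q 0" for a
  proof (induction a)
    case (Suc a)
    have "\<alpha> + single r a + \<epsilon> r = \<alpha> + single r (Suc a)"
      by (simp add: add.assoc flip: single_add)
    then have "?Q (Suc a) \<cong> ?Q a"
      using isomorphic_step[OF r add_single_in_basis_index[OF r \<alpha>, of a]] by simp
    then show ?case using Suc by (rule lie_isomorphic_trans)
  qed (rule lie_isomorphic_refl)
  have "?Q 0 \<cong> ?Q b"
    using base by (rule tuples_isomorphic_sym[rotated 2]) (rule ideal_span_on[OF downset_below])+
  with base show ?thesis by (rule lie_isomorphic_trans)
qed

section \<open>Order types of well-ordered sets\<close>

text \<open>
  Well-orders are given here by a strict predicate and a set, so that subsets and increasing maps can be
  treated without restricting relations.
\<close>

definition order_rel :: "('a \<Rightarrow> 'a \<Rightarrow> bool) \<Rightarrow> 'a set \<Rightarrow> 'a rel" where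
  "order_rel lt A = {(x, y). x \<in> A \<and> y \<in> A \<and> (x = y \<or> lt x y)}"

definition ord :: "('a \<Rightarrow> 'a \<Rightarrow> bool) \<Rightarrow> 'a set \<Rightarrow> ordinal" where
  "ord lt A = order_type (order_rel lt A)"

definition well_ordered :: "('a \<Rightarrow> 'a \<Rightarrow> bool) \<Rightarrow> 'a set \<Rightarrow> bool" where
  "well_ordered lt A \<longleftrightarrow> countable A \<and> (\<forall>x\<in>A. \<not> lt x x) \<and>
     (\<forall>x\<in>A. \<forall>y\<in>A. \<forall>z\<in>A. lt x y \<longrightarrow> lt y z \<longrightarrow> lt x z) \<and>
     (\<forall>B\<subseteq>A. B \<noteq> {} \<longrightarrow> (\<exists>b\<in>B. \<forall>c\<in>B. c = b \<or> lt b c))"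

lemma well_orderedD:
  assumes "well_ordered lt A"
  shows "countable A" "x \<in> A \<Longrightarrow> \<not> lt x x"
    "x \<in> A \<Longrightarrow> y \<in> A \<Longrightarrow> z \<in> A \<Longrightarrow> lt x y \<Longrightarrow> lt y z \<Longrightarrow> lt x z"
    "B \<subseteq> A \<Longrightarrow> B \<noteq> {} \<Longrightarrow> \<exists>b\<in>B. \<forall>c\<in>B. c = b \<or> lt b c"
    "x \<in> A \<Longrightarrow> y \<in> A \<Longrightarrow> x = y \<or> lt x y \<or> lt y x"
proof -
  show min: "B \<subseteq> A \<Longrightarrow> B \<noteq> {} \<Longrightarrow> \<exists>b\<in>B. \<forall>c\<in>B. c = b \<or> lt b c" for B
    using assms unfolding well_ordered_def by simp
  show "x \<in> A \<Longrightarrow> y \<in> A \<Longrightarrow> x = y \<or> lt x y \<or> lt y x" using min[of "{x, y}"] by auto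
qed (use assms in \<open>unfold well_ordered_def, blast+\<close>)

lemma well_ordered_subset:
  assumes A: "well_ordered lt A" and sub: "B \<subseteq> A"
  shows "well_ordered lt B"
proof -
  note D = well_orderedD[OF A]
  have mem: "x \<in> A" if "x \<in> B" for x using that sub by blast
  have "countable B" using sub D(1) by (rule countable_subset)
  moreover have "\<forall>x\<in>B. \<not> lt x x" using D(2) mem by simp
  moreover have "\<forall>x\<in>B. \<forall>y\<in>B. \<forall>z\<in>B. lt x y \<longrightarrow> lt y z \<longrightarrow> lt x z"
    by (blast intro: D(3)[OF mem mem mem])
  moreover have "\<forall>C\<subseteq>B. C \<noteq> {} \<longrightarrow> (\<exists>b\<in>C. \<forall>c\<in>C. c = b \<or> lt b c)"
    using D(4) order_trans[OF _ sub] by simp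
  ultimately show ?thesis unfolding well_ordered_def by (intro conjI)
qed

lemma in_order_rel: "(x, y) \<in> order_rel lt A \<longleftrightarrow> x \<in> A \<and> y \<in> A \<and> (x = y \<or> lt x y)"
  by (simp add: order_rel_def)

lemma Field_order_rel [simp]: "Field (order_rel lt A) = A"
  by (auto simp: order_rel_def Field_def)

lemma Well_order_order_rel:
  assumes "well_ordered lt A"
  shows "Well_order (order_rel lt A)"
proof -
  note D = well_orderedD[OF assms]
  have "Refl (order_rel lt A)" by (auto simp: refl_on_def) (auto simp: in_order_rel)
  moreover have "trans (order_rel lt A)"     unfolding trans_def in_order_rel by (blast intro: D(3))
  moreover have "antisym (order_rel lt A)"
  proof (rule antisymI)
    fix x y assume xy: "(x, y) \<in> order_rel lt A" "(y, x) \<in> order_rel lt A"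
    then have "x \<in> A" "y \<in> A" by (simp_all add: in_order_rel)
    then show "x = y" using xy D(2)[of x] D(3)[of x y x] by (auto simp: in_order_rel)
  qed
  moreover have "Total (order_rel lt A)"
  proof (simp add: total_on_def, intro ballI impI)
    fix x y assume "x \<in> A" "y \<in> A" "x \<noteq> y"
    then show "(x, y) \<in> order_rel lt A \<or> (y, x) \<in> order_rel lt A"
      using D(5)[of x y] by (simp add: in_order_rel)
  qed
  moreover have "wf (order_rel lt A - Id)"
  proof (rule wfI_min)
    fix x Q assume "x \<in> (Q :: 'a set)"
    show "\<exists>z\<in>Q. \<forall>y. (y, z) \<in> order_rel lt A - Id \<longrightarrow> y \<notin> Q"
    proof (cases "Q \<inter> A = {}")
      case True
      then show ?thesis using \<open>x \<in> Q\<close> by (intro bexI[of _ x]) (auto simp: in_order_rel)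
    next
      case False
      then obtain b where b: "b \<in> Q \<inter> A" "\<forall>c\<in>Q \<inter> A. c = b \<or> lt b c" using D(4)[of "Q \<inter> A"] by blast
      have "y \<notin> Q" if y: "(y, b) \<in> order_rel lt A - Id" for y
      proof
        assume "y \<in> Q"
        then have "y \<in> A" "lt y b" "lt b y" using y b by (auto simp: in_order_rel)
        then show False using D(2)[of b] D(3)[of b y b] b(1) by blast
      qed
      then show ?thesis using b(1) by blast
    qed
  qed
  moreover have "order_rel lt A \<subseteq> A \<times> A" by (auto simp: in_order_rel)
  ultimately show ?thesis by (simp add: order_on_defs)
qed

lemmas well_order_on_order_rel = Well_order_order_rel[unfolded Field_order_rel]

lemma rep_ord: "well_ordered lt A \<Longrightarrow> rep_ordinal (ord lt A) =o order_rel lt A"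
  unfolding ord_def by (rule rep_order_type) (simp_all add: well_order_on_order_rel well_orderedD(1))

lemma ord_eqI:
  assumes "well_ordered lt A" "rep_ordinal x =o order_rel lt A"
  shows "x = ord lt A"
  unfolding ordinal_eq_iff by (rule ordIso_transitive[OF assms(2) ordIso_symmetric[OF rep_ord[OF assms(1)]]])

lemma order_type_cong:
  assumes "r =o s"
  shows "order_type r = order_type s"
proof -
  have "q =o r \<longleftrightarrow> q =o s" for q :: "nat rel"
    using ordIso_transitive[OF _ assms] ordIso_transitive[OF _ ordIso_symmetric[OF assms]] by blast
  then show ?thesis by (simp add: order_type_def)
qed

lemma ord_cong:
  assumes "well_ordered lt A" "well_ordered lt' B" "bij_betw h A B"
    and "\<And>x y. x \<in> A \<Longrightarrow> y \<in> A \<Longrightarrow> lt x y \<longleftrightarrow> lt' (h x) (h y)"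
  shows "ord lt A = ord lt' B"
  unfolding ord_def
proof (rule order_type_cong, rule ordIsoI[where f = h])
  fix x y assume "x \<in> Field (order_rel lt A)" "y \<in> Field (order_rel lt A)"
  then have xy: "x \<in> A" "y \<in> A" by simp_all
  then have "h x \<in> B" "h y \<in> B" "h x = h y \<longleftrightarrow> x = y"
    using assms(3) by (auto simp: bij_betw_def inj_on_def)
  then show "(x, y) \<in> order_rel lt A \<longleftrightarrow> (h x, h y) \<in> order_rel lt' B"
    using xy assms(4)[OF xy] by (simp add: in_order_rel)
qed (simp_all add: assms well_order_on_order_rel)

lemma ord_Un:
  assumes W: "well_ordered lt (A \<union> B)" and less: "\<And>a b. a \<in> A \<Longrightarrow> b \<in> B \<Longrightarrow> lt a b"
  shows "ord lt (A \<union> B) = ord lt A + ord lt B"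
proof -
  have WA: "well_ordered lt A" and WB: "well_ordered lt B"
    by (rule well_ordered_subset[OF W]; blast)+
  have not_less: "\<not> lt b a \<and> a \<noteq> b" if "a \<in> A" "b \<in> B" for a b
    using less[OF that] well_orderedD(2)[OF W, of a] well_orderedD(3)[OF W, of a b a] that by blast
  have disjoint: "a \<notin> B" if "a \<in> A" for a using not_less[OF that] by blast
  have "order_sum (order_rel lt A) (order_rel lt B) =o order_rel lt (A \<union> B)"
  proof (rule ordIsoI[where f = "case_sum id id"])
    show "bij_betw (case_sum id id) (Field (order_sum (order_rel lt A) (order_rel lt B)))
        (Field (order_rel lt (A \<union> B)))"
      unfolding Field_order_sum bij_betw_def using disjoint by (auto simp: inj_on_def image_Un image_image)
    fix x y assume "x \<in> Field (order_sum (order_rel lt A) (order_rel lt B))"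
      "y \<in> Field (order_sum (order_rel lt A) (order_rel lt B))"
    then show "(x, y) \<in> order_sum (order_rel lt A) (order_rel lt B) \<longleftrightarrow>
        (case_sum id id x, case_sum id id y) \<in> order_rel lt (A \<union> B)"
      using less not_less disjoint unfolding Field_order_sum by (auto simp: in_order_rel)
  qed (rule Well_order_order_sum[OF Well_order_order_rel[OF WA] Well_order_order_rel[OF WB]],
      rule Well_order_order_rel[OF W])
  moreover have "rep_ordinal (ord lt A + ord lt B) =o order_sum (order_rel lt A) (order_rel lt B)"
    by (rule ordIso_transitive[OF rep_plus_ordinal order_sum_cong[OF rep_ord[OF WA] rep_ord[OF WB]]])
  ultimately have "rep_ordinal (ord lt A + ord lt B) =o order_rel lt (A \<union> B)"
    by (metis ordIso_transitive)
  then show ?thesis using ord_eqI[OF W] by simp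
qed

definition lex_less :: "('a \<Rightarrow> 'a \<Rightarrow> bool) \<Rightarrow> ('b \<Rightarrow> 'b \<Rightarrow> bool) \<Rightarrow> 'a \<times> 'b \<Rightarrow> 'a \<times> 'b \<Rightarrow> bool" where
  "lex_less lt lt' p q \<longleftrightarrow> lt' (snd p) (snd q) \<or> (snd p = snd q \<and> lt (fst p) (fst q))"

lemma well_ordered_lex:
  assumes A: "well_ordered lt A" and B: "well_ordered lt' B"
  shows "well_ordered (lex_less lt lt') (A \<times> B)"
  unfolding well_ordered_def
proof (intro conjI allI impI ballI)
  show "countable (A \<times> B)" using well_orderedD(1)[OF A] well_orderedD(1)[OF B] by simp
  show "\<not> lex_less lt lt' p p" if "p \<in> A \<times> B" for p
    using that well_orderedD(2)[OF A] well_orderedD(2)[OF B] by (auto simp: lex_less_def)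
  show "lex_less lt lt' p s"
    if "p \<in> A \<times> B" "q \<in> A \<times> B" "s \<in> A \<times> B" "lex_less lt lt' p q" "lex_less lt lt' q s" for p q s
    using that well_orderedD(3)[OF A, of "fst p" "fst q" "fst s"] well_orderedD(3)[OF B, of "snd p" "snd q" "snd s"]
    by (auto simp: lex_less_def)
  fix C assume C: "C \<subseteq> A \<times> B" "C \<noteq> {}"
  then have "snd ` C \<subseteq> B" "snd ` C \<noteq> {}" by auto
  then obtain b where b: "b \<in> snd ` C" "\<forall>c\<in>snd ` C. c = b \<or> lt' b c" using well_orderedD(4)[OF B] by blast
  have "{a. (a, b) \<in> C} \<subseteq> A" "{a. (a, b) \<in> C} \<noteq> {}" using C b(1) by auto
  then obtain a where a: "(a, b) \<in> C" "\<forall>c\<in>{a. (a, b) \<in> C}. c = a \<or> lt a c" using well_orderedD(4)[OF A] by blast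
  have "q = (a, b) \<or> lex_less lt lt' (a, b) q" if "q \<in> C" for q
  proof -
    obtain c d where q: "q = (c, d)" by (cases q)
    then have "d = b \<or> lt' b d" using b(2) that by force
    then show ?thesis using a(2) that by (auto simp: q lex_less_def)
  qed
  with a(1) show "\<exists>p\<in>C. \<forall>q\<in>C. q = p \<or> lex_less lt lt' p q" by blast
qed

text \<open>
  Multiplication of ordinals is defined through representatives on the natural numbers.  Isomorphisms
  onto these representatives combine to an isomorphism of the product relations.
\<close>

lemma ord_times:
  assumes A: "well_ordered lt A" and B: "well_ordered lt' B"
  shows "ord (lex_less lt lt') (A \<times> B) = ord lt A * ord lt' B"
proof -
  let ?r = "rep_ordinal (ord lt A)" and ?s = "rep_ordinal (ord lt' B)"
  obtain f where f: "iso (order_rel lt A) ?r f"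
    using ordIso_symmetric[OF rep_ord[OF A]] unfolding ordIso_def by blast
  obtain g where g: "iso (order_rel lt' B) ?s g"
    using ordIso_symmetric[OF rep_ord[OF B]] unfolding ordIso_def by blast
  have f_bij: "bij_betw f A (Field ?r)" and f_iff: "\<And>x y. x \<in> A \<Longrightarrow> y \<in> A \<Longrightarrow> (f x, f y) \<in> ?r \<longleftrightarrow> x = y \<or> lt x y"
    using f unfolding iso_iff2 Field_order_rel by (simp_all add: in_order_rel)
  have g_bij: "bij_betw g B (Field ?s)" and g_iff: "\<And>x y. x \<in> B \<Longrightarrow> y \<in> B \<Longrightarrow> (g x, g y) \<in> ?s \<longleftrightarrow> x = y \<or> lt' x y"
    using g unfolding iso_iff2 Field_order_rel by (simp_all add: in_order_rel)
  have g_eq: "g x = g y \<longleftrightarrow> x = y" if "x \<in> B" "y \<in> B" for x y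
    using g_bij that by (auto simp: bij_betw_def inj_on_def)
  let ?q = "order_rel (lex_less lt lt') (A \<times> B)"
  have inj: "inj_on (map_prod f g) (Field ?q)"
    using f_bij g_bij by (auto simp: bij_betw_def intro: map_prod_inj_on)
  have key: "((f x, g y), (f x', g y')) \<in> order_prod ?r ?s \<longleftrightarrow> ((x, y), (x', y')) \<in> ?q"
    if "x \<in> A" "x' \<in> A" "y \<in> B" "y' \<in> B" for x y x' y'
    using that f_bij g_bij well_orderedD(2)[OF B, of y]
    by (auto simp: order_prod_def in_order_rel lex_less_def f_iff g_iff g_eq bij_betw_def)
  have "order_prod ?r ?s = dir_image ?q (map_prod f g)"
  proof (intro equalityI subrelI)
    fix p q assume pq: "(p, q) \<in> order_prod ?r ?s"
    obtain u v u' v' where eq: "p = (u, v)" "q = (u', v')" by (cases p, cases q)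
    with pq have "u \<in> f ` A" "u' \<in> f ` A" "v \<in> g ` B" "v' \<in> g ` B"
      using f_bij g_bij by (auto simp: order_prod_def bij_betw_def)
    then obtain x x' y y' where "x \<in> A" "x' \<in> A" "y \<in> B" "y' \<in> B" "p = (f x, g y)" "q = (f x', g y')"
      unfolding eq by blast
    then show "(p, q) \<in> dir_image ?q (map_prod f g)"
      using pq key[of x x' y y'] unfolding dir_image_def by force
  next
    fix p q assume "(p, q) \<in> dir_image ?q (map_prod f g)"
    then obtain x y x' y' where "((x, y), (x', y')) \<in> ?q" "p = (f x, g y)" "q = (f x', g y')"
      unfolding dir_image_def by auto
    then show "(p, q) \<in> order_prod ?r ?s" using key[of x x' y y'] by (auto simp: in_order_rel)
  qed
  then have "?q =o order_prod ?r ?s"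
    using dir_image_ordIso[OF Well_order_order_rel[OF well_ordered_lex[OF A B]] inj] by simp
  then show ?thesis unfolding ord_def times_ordinal_def by (rule order_type_cong)
qed

lemma Restr_order_rel: "Restr (order_rel lt A) B = order_rel lt (A \<inter> B)"
  by (auto simp: in_order_rel)

lemma underS_order_rel:
  assumes "well_ordered lt A" "a \<in> A"
  shows "underS (order_rel lt A) a = {x \<in> A. lt x a}"
  using well_orderedD(2)[OF assms] assms(2) by (auto simp: underS_def in_order_rel)

lemma ord_segment_less:
  assumes "well_ordered lt A" "a \<in> A"
  shows "ord lt {x \<in> A. lt x a} < ord lt A"
proof -
  have W: "well_ordered lt {x \<in> A. lt x a}" by (rule well_ordered_subset[OF assms(1)]) auto
  have "Restr (order_rel lt A) (underS (order_rel lt A) a) <o order_rel lt A"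
    using underS_Restr_ordLess[OF Well_order_order_rel[OF assms(1)]] assms(2) by auto
  then have "order_rel lt {x \<in> A. lt x a} <o order_rel lt A"
    unfolding underS_order_rel[OF assms] Restr_order_rel by (simp add: Collect_conj_eq Int_absorb1 Int_assoc[symmetric])
  then show ?thesis
    unfolding less_ordinal_def
    by (rule ordIso_ordLess_trans[OF rep_ord[OF W] ordLess_ordIso_trans[OF _ ordIso_symmetric[OF rep_ord[OF assms(1)]]]])
qed

lemma less_ord_imp_segment:
  assumes W: "well_ordered lt A" and less: "x < ord lt A"
  shows "\<exists>a\<in>A. x = ord lt {b \<in> A. lt b a}"
proof -
  have "rep_ordinal x <o order_rel lt A"
    by (rule ordLess_ordIso_trans[OF less[unfolded less_ordinal_def] rep_ord[OF W]])
  then obtain a where a: "a \<in> A" "rep_ordinal x =o Restr (order_rel lt A) (underS (order_rel lt A) a)"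
    using ordLess_iff_ordIso_Restr[OF Well_order_order_rel[OF W] Well_order_rep_ordinal, of x] by auto
  have "A \<inter> {b \<in> A. lt b a} = {b \<in> A. lt b a}" by blast
  then have "rep_ordinal x =o order_rel lt {b \<in> A. lt b a}"
    using a(2) unfolding underS_order_rel[OF W a(1)] Restr_order_rel by simp
  then have "x = ord lt {b \<in> A. lt b a}"
    by (intro ord_eqI well_ordered_subset[OF W]) auto
  with a(1) show ?thesis by blast
qed

lemma well_ordered_empty: "well_ordered lt {}"
  by (simp add: well_ordered_def)

lemma ord_empty [simp]: "ord lt {} = 0"
proof -
  have "order_rel lt {} = {}" by (auto simp: order_rel_def)
  then have "order_rel lt {} =o ({} :: nat rel)"
    by (intro ordIsoI[where f = "\<lambda>_. 0"]) (simp_all add: bij_betw_def)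
  then show ?thesis unfolding ord_def zero_ordinal_def by (rule order_type_cong)
qed

lemma well_ordered_singleton: "\<not> lt a a \<Longrightarrow> well_ordered lt {a}"
  by (auto simp: well_ordered_def subset_singleton_iff)

lemma ord_singleton:
  assumes "\<not> lt a a"
  shows "ord lt {a} = 1"
proof -
  have W: "well_ordered (\<lambda>_ _. False) {()}" by (rule well_ordered_singleton) simp
  have "ord lt {a} = ord (\<lambda>_ _. False) {()}"
    using assms by (intro ord_cong[OF well_ordered_singleton[of lt a, OF assms] W, of "\<lambda>_. ()"]) (auto simp: bij_betw_def)
  also have "order_rel (\<lambda>_ _. False) {()} = {((), ())}" by (auto simp: in_order_rel)
  then have "ord (\<lambda>_ _. False) {()} = 1" by (simp only: ord_def one_ordinal_def)
  finally show ?thesis .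
qed

lemma ordinal_not_less_0: "\<not> (x :: ordinal) < 0"
  using less_ord_imp_segment[OF well_ordered_empty, of x "(<) :: nat \<Rightarrow> nat \<Rightarrow> bool"] by auto

lemma ordinal_0_or_ge_1: "x = 0 \<or> (1 :: ordinal) \<le> x"
proof (cases "x < 1")
  case True
  have W: "well_ordered (\<lambda>_ _. False) {()}" by (rule well_ordered_singleton) simp
  have "x < ord (\<lambda>_ _. False) {()}" using True by (simp add: ord_singleton)
  from less_ord_imp_segment[OF W this] show ?thesis by auto
qed auto

lemma well_ordered_nat: "well_ordered (<) (UNIV :: nat set)"
  unfolding well_ordered_def
proof (intro conjI allI impI ballI)
  fix B :: "nat set" assume "B \<noteq> {}"
  then show "\<exists>b\<in>B. \<forall>c\<in>B. c = b \<or> b < c"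
    by (intro bexI[of _ "LEAST b. b \<in> B"]) (auto intro: LeastI simp: le_less dest: Least_le)
qed auto

lemma ord_nat: "ord (<) (UNIV :: nat set) = \<omega>"
proof -
  have "order_rel (<) (UNIV :: nat set) = {(i, j). i \<le> j}" by (auto simp: in_order_rel)
  then show ?thesis by (simp add: ord_def omega_def)
qed

subsection \<open>Exponent vectors\<close>

text \<open>
  Exponent vectors in the \<open>m\<close> variables from \<open>x\<^sub>l\<close> on.  The first variable is a parameter because
  \<open>\<omega> ^ Suc m\<close> unfolds to \<open>\<omega> * \<omega> ^ m\<close>, in which the first factor is the least significant one; an
  induction on \<open>m\<close> therefore splits off \<open>x\<^sub>l\<close>.
\<close>

definition exps :: "nat \<Rightarrow> nat \<Rightarrow> (nat \<Rightarrow>\<^sub>0 nat) set" where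
  "exps l m = {\<alpha>. keys \<alpha> \<subseteq> {l..<l + m}}"

lemma countable_exps: "countable {\<alpha> :: nat \<Rightarrow>\<^sub>0 nat. keys \<alpha> \<subseteq> {..<m}}"
proof (rule countable_image_inj_on)
  let ?f = "\<lambda>\<alpha> :: nat \<Rightarrow>\<^sub>0 nat. map (lookup \<alpha>) [0..<m]"
  show "countable (?f ` {\<alpha>. keys \<alpha> \<subseteq> {..<m}})" by simp
  show "inj_on ?f {\<alpha>. keys \<alpha> \<subseteq> {..<m}}"
  proof (rule inj_onI, rule poly_mapping_eqI)
    fix \<alpha> \<beta> :: "nat \<Rightarrow>\<^sub>0 nat" and k
    assume *: "\<alpha> \<in> {\<alpha>. keys \<alpha> \<subseteq> {..<m}}" "\<beta> \<in> {\<alpha>. keys \<alpha> \<subseteq> {..<m}}" "?f \<alpha> = ?f \<beta>"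
    show "lookup \<alpha> k = lookup \<beta> k"
    proof (cases "k < m")
      case True
      then show ?thesis using *(3) by (simp add: map_eq_conv)
    next
      case False
      then have "k \<notin> keys \<alpha>" "k \<notin> keys \<beta>" using * by auto
      then show ?thesis by (simp only: in_keys_iff not_not)
    qed
  qed
qed

lemma well_ordered_colex: "well_ordered (\<lhd>) {\<alpha>. keys \<alpha> \<subseteq> {..<m}}"
  unfolding well_ordered_def
proof (intro conjI ballI allI impI)
  show "\<exists>b\<in>B. \<forall>c\<in>B. c = b \<or> b \<lhd> c" if "B \<subseteq> {\<alpha>. keys \<alpha> \<subseteq> {..<m}}" "B \<noteq> {}" for B
    using colex_least[of B m] that by auto
qed (auto intro: countable_exps colex_trans)

lemma well_ordered_exps: "well_ordered (\<lhd>) (exps l m)"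
  by (rule well_ordered_subset[OF well_ordered_colex[of "l + m"]]) (auto simp: exps_def)

lemma colex_add_low_single_iff:
  assumes "\<beta> \<in> exps (Suc l) m" "\<beta>' \<in> exps (Suc l) m"
  shows "\<beta> + single l i \<lhd> \<beta>' + single l i' \<longleftrightarrow> \<beta> \<lhd> \<beta>' \<or> \<beta> = \<beta>' \<and> i < i'"
proof -
  have 0: "lookup \<beta> k = 0" if "\<beta> \<in> exps (Suc l) m" "k \<le> l" for \<beta> k
  proof -
    have "k \<notin> keys \<beta>" using that by (auto simp: exps_def)
    then show ?thesis by (simp only: in_keys_iff not_not)
  qed
  have less: "\<beta> + single l i \<lhd> \<beta>' + single l i'"
    if "\<beta> \<in> exps (Suc l) m" and \<beta>': "\<beta>' \<in> exps (Suc l) m" and lt: "\<beta> \<lhd> \<beta>'" for \<beta> \<beta>' i i'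
  proof -
    obtain k where k: "lookup \<beta> k < lookup \<beta>' k" "\<forall>j>k. lookup \<beta> j = lookup \<beta>' j"
      using lt unfolding colex_def by blast
    then have "l < k" using 0[OF \<beta>', of k] by (cases "k \<le> l") auto
    then show ?thesis
      using k unfolding colex_def by (intro exI[of _ k]) (simp add: lookup_add lookup_single when_def)
  qed
  have eq: "\<beta> + single l i \<lhd> \<beta> + single l i' \<longleftrightarrow> i < i'" for \<beta> i i'
  proof
    assume "\<beta> + single l i \<lhd> \<beta> + single l i'"
    then show "i < i'" by (auto simp: colex_def lookup_add lookup_single when_def split: if_splits)
  next
    assume "i < i'"
    then show "\<beta> + single l i \<lhd> \<beta> + single l i'"
      unfolding colex_def by (intro exI[of _ l]) (simp add: lookup_add lookup_single when_def)
  qed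
  consider "\<beta> \<lhd> \<beta>'" | "\<beta> = \<beta>'" | "\<beta>' \<lhd> \<beta>" using colex_total by blast
  then show ?thesis
  proof cases
    case 1
    then show ?thesis using less[OF assms] by simp
  next
    case 2
    then show ?thesis using eq by simp
  next
    case 3
    then show ?thesis using colex_asym[OF less[OF assms(2,1) 3]] colex_asym[OF 3] by auto
  qed
qed

lemma ord_exps: "ord (\<lhd>) (exps l m) = \<omega> ^ m"
proof (induction m arbitrary: l)
  case 0
  have "exps l 0 = {0}" by (auto simp: exps_def)
  then show ?case by (simp add: ord_singleton)
next
  case (Suc m)
  let ?h = "\<lambda>(i, \<beta>). \<beta> + single l i :: nat \<Rightarrow>\<^sub>0 nat"
  have 0: "lookup \<beta> l = 0" if "\<beta> \<in> exps (Suc l) m" for \<beta>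
  proof -
    have "l \<notin> keys \<beta>" using that by (auto simp: exps_def)
    then show ?thesis by (simp only: in_keys_iff not_not)
  qed
  have "bij_betw ?h (UNIV \<times> exps (Suc l) m) (exps l (Suc m))"
    unfolding bij_betw_def
  proof (intro conjI equalityI subsetI inj_onI)
    fix p q assume p: "p \<in> UNIV \<times> exps (Suc l) m" and q: "q \<in> UNIV \<times> exps (Suc l) m" and eq: "?h p = ?h q"
    obtain i \<beta> j \<gamma> where pq: "p = (i, \<beta>)" "q = (j, \<gamma>)" by (cases p, cases q)
    have "lookup (?h p) l = lookup (?h q) l" using eq by simp
    then have "i = j" using 0 p q by (simp add: pq lookup_add)
    then show "p = q" using eq by (simp add: pq)
  next
    fix \<kappa> assume "\<kappa> \<in> ?h ` (UNIV \<times> exps (Suc l) m)"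
    then show "\<kappa> \<in> exps l (Suc m)" by (force simp: exps_def keys_plus_exp split: if_splits)
  next
    fix \<kappa> assume \<kappa>: "\<kappa> \<in> exps l (Suc m)"
    let ?\<beta> = "\<kappa> - single l (lookup \<kappa> l)"
    have \<beta>: "lookup ?\<beta> k = (if k = l then 0 else lookup \<kappa> k)" for k
      by (simp add: lookup_minus lookup_single when_def)
    have "?\<beta> \<in> exps (Suc l) m"
      unfolding exps_def
    proof safe
      fix k assume "k \<in> keys ?\<beta>"
      then have "k \<noteq> l" "k \<in> keys \<kappa>" by (auto simp: in_keys_iff \<beta> split: if_splits)
      moreover have "k \<in> {l..<l + Suc m}" using calculation(2) \<kappa> by (auto simp: exps_def)
      ultimately show "k \<in> {Suc l..<Suc l + m}" by auto
    qed
    moreover have "?h (lookup \<kappa> l, ?\<beta>) = \<kappa>"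
      by (rule poly_mapping_eqI) (simp add: lookup_add \<beta> lookup_single when_def)
    ultimately show "\<kappa> \<in> ?h ` (UNIV \<times> exps (Suc l) m)" by (metis UNIV_I image_eqI mem_Sigma_iff)
  qed
  then have "ord (lex_less (<) (\<lhd>)) ((UNIV :: nat set) \<times> exps (Suc l) m) = ord (\<lhd>) (exps l (Suc m))"
    using colex_add_low_single_iff[of _ l m]
    by (intro ord_cong[where h = ?h] well_ordered_lex well_ordered_nat well_ordered_exps)
      (auto simp: lex_less_def)
  then have "ord (\<lhd>) (exps l (Suc m)) = ord (<) (UNIV :: nat set) * ord (\<lhd>) (exps (Suc l) m)"
    using ord_times[OF well_ordered_nat well_ordered_exps] by simp
  then show ?case by (simp add: ord_nat Suc)
qed

section \<open>Order types of the ideals\<close>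

lemma well_ordered_index: "well_ordered (\<prec>) (basis_index n)"
  unfolding well_ordered_def
proof (intro conjI ballI allI impI)
  have "basis_index n \<subseteq> {\<alpha>. keys \<alpha> \<subseteq> {..<n}} \<times> UNIV"
    by (fastforce simp: basis_index_def)
  then show "countable (basis_index n)"
    by (rule countable_subset) (intro countable_SIGMA countable_exps, simp)
  show "\<exists>b\<in>B. \<forall>c\<in>B. c = b \<or> b \<prec> c" if "B \<subseteq> basis_index n" "B \<noteq> {}" for B
    using basis_index_least[OF that] .
  show "x \<prec> z" if "x \<prec> y" "y \<prec> z" for x y z using that by (rule index_less_trans)
qed simp

lemma well_ordered_index_subset: "S \<subseteq> basis_index n \<Longrightarrow> well_ordered (\<prec>) S"
  by (rule well_ordered_subset[OF well_ordered_index])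

lemma downset_subset: "downset n S \<Longrightarrow> S \<subseteq> basis_index n"
  by (simp add: downset_def)

text \<open>
  A proper downset of \<open>T\<close> is the initial segment of \<open>T\<close> below one of its elements.
\<close>

lemma ord_downset_less:
  assumes S: "downset n S" and T: "downset n T" and "S \<subset> T"
  shows "ord (\<prec>) S < ord (\<prec>) T"
proof -
  obtain t where t: "t \<in> T" "t \<notin> S" using assms(3) by blast
  then have "t \<in> basis_index n" using T by (auto simp: downset_def)
  with t have "S \<noteq> basis_index n" by blast
  with downset_cases[OF S] obtain b where b: "b \<in> basis_index n" "S = below n b" by metis
  have "\<not> t \<prec> b" using t(2) \<open>t \<in> basis_index n\<close> by (simp add: b(2) below_def)
  then have "b = t \<or> b \<prec> t" using index_less_total by blast
  then have bT: "b \<in> T" using T t(1) b(1) unfolding downset_def by blast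
  have "S = {c \<in> T. c \<prec> b}" using assms(3) T by (auto simp: b(2) below_def downset_def)
  then show ?thesis using ord_segment_less[OF well_ordered_index_subset[OF downset_subset[OF T]] bT] by simp
qed

lemma ord_downset_inject:
  assumes "downset n S" "downset n T" "ord (\<prec>) S = ord (\<prec>) T"
  shows "S = T"
proof (rule ccontr)
  assume "S \<noteq> T"
  then have "S \<subset> T \<or> T \<subset> S" using downset_linear[OF assms(1,2)] by blast
  then show False using ord_downset_less[OF assms(1,2)] ord_downset_less[OF assms(2,1)] assms(3) by auto
qed

lemma ord_downset_mono: "downset n S \<Longrightarrow> downset n T \<Longrightarrow> S \<subseteq> T \<Longrightarrow> ord (\<prec>) S \<le> ord (\<prec>) T"
  using ord_downset_less[of n S T] by (cases "S = T") (simp_all add: psubset_eq less_imp_le)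

lemma index_greater_iff:
  assumes "a \<in> basis_index n" "b \<in> basis_index n"
  shows "index_greater a b \<longleftrightarrow> b \<prec> a"
proof -
  obtain \<alpha> i \<beta> j where eq: "a = (\<alpha>, i)" "b = (\<beta>, j)" by (cases a, cases b)
  have keys: "keys \<alpha> \<subseteq> {1..i - 1}" "keys \<beta> \<subseteq> {1..j - 1}" using assms by (auto simp: eq basis_index_def)
  have "(\<exists>m\<in>{1..i - 1}. lookup \<beta> m < lookup \<alpha> m \<and> (\<forall>k\<in>{m<..i - 1}. lookup \<alpha> k = lookup \<beta> k)) \<longleftrightarrow> \<beta> \<lhd> \<alpha>"
    if "i = j"
  proof
    assume "\<exists>m\<in>{1..i - 1}. lookup \<beta> m < lookup \<alpha> m \<and> (\<forall>k\<in>{m<..i - 1}. lookup \<alpha> k = lookup \<beta> k)"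
    then obtain m where m: "lookup \<beta> m < lookup \<alpha> m" "\<forall>k\<in>{m<..i - 1}. lookup \<alpha> k = lookup \<beta> k" by blast
    have "lookup \<beta> k = lookup \<alpha> k" if "k > m" for k
    proof (cases "k \<le> i - 1")
      case False
      then have "k \<notin> keys \<alpha>" "k \<notin> keys \<beta>" using keys \<open>i = j\<close> by auto
      then show ?thesis by (simp only: in_keys_iff not_not)
    qed (use m(2) that in auto)
    with m(1) show "\<beta> \<lhd> \<alpha>" unfolding colex_def by blast
  next
    assume "\<beta> \<lhd> \<alpha>"
    then obtain m where m: "lookup \<beta> m < lookup \<alpha> m" "\<forall>k>m. lookup \<beta> k = lookup \<alpha> k"
      unfolding colex_def by blast
    then have "m \<in> keys \<alpha>" by (auto simp: in_keys_iff)
    then have "m \<in> {1..i - 1}" using keys by blast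
    with m show "\<exists>m\<in>{1..i - 1}. lookup \<beta> m < lookup \<alpha> m \<and> (\<forall>k\<in>{m<..i - 1}. lookup \<alpha> k = lookup \<beta> k)" by auto
  qed
  then show ?thesis unfolding eq index_greater_def index_less_Pair by auto
qed

text \<open>
  On the basis the order of operators is the order of their indices, since distinct indices give distinct
  operators.
\<close>

lemma basis_ord_eq:
  assumes b: "b \<in> basis_index n"
  shows "basis_ord n (basis_elem n b :: 'k::comm_ring_1 operator) = ord (\<prec>) (insert b (below n b))"
proof -
  let ?e = "basis_elem n :: index \<Rightarrow> 'k operator"
  let ?S = "insert b (below n b)"
  have S: "?S \<subseteq> basis_index n" using b by (auto simp: below_def)
  have le: "(?e c, ?e d) \<in> basis_order n \<longleftrightarrow> c = d \<or> c \<prec> d"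
    if "c \<in> basis_index n" "d \<in> basis_index n" for c d
  proof -
    have "(?e c, ?e d) \<in> basis_order n \<longleftrightarrow>
      (\<exists>a b. ?e c = ?e b \<and> ?e d = ?e a \<and> a \<in> basis_index n \<and> b \<in> basis_index n \<and> (b = a \<or> index_greater a b))"
      by (simp add: basis_order_def)
    also have "\<dots> \<longleftrightarrow> c = d \<or> index_greater d c"
      using that inj_on_eq_iff[OF inj_on_basis_elem[where 'k = 'k]] by blast
    finally show ?thesis using index_greater_iff[OF that(2,1)] by simp
  qed
  have field: "\<exists>c\<in>basis_index n. Y = ?e c" if "(Y, Z) \<in> basis_order n \<or> (Z, Y) \<in> basis_order n" for Y Z
    using that unfolding basis_order_def by blast
  have "Restr (basis_order n) {Y. (Y, ?e b) \<in> basis_order n} = dir_image (order_rel (\<prec>) ?S) ?e"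
  proof (intro equalityI subrelI)
    fix Y Z assume YZ: "(Y, Z) \<in> Restr (basis_order n) {Y. (Y, ?e b) \<in> basis_order n}"
    then obtain c d where cd: "c \<in> basis_index n" "d \<in> basis_index n" "Y = ?e c" "Z = ?e d"
      using field[of Y Z] field[of Z Y] by auto
    then have "(c, d) \<in> order_rel (\<prec>) ?S"
      using YZ le b by (auto simp: in_order_rel below_def)
    then show "(Y, Z) \<in> dir_image (order_rel (\<prec>) ?S) ?e" unfolding dir_image_def cd(3,4) by blast
  next
    fix Y Z assume "(Y, Z) \<in> dir_image (order_rel (\<prec>) ?S) ?e"
    then obtain c d where cd: "(c, d) \<in> order_rel (\<prec>) ?S" "Y = ?e c" "Z = ?e d"
      unfolding dir_image_def by blast
    then have "c \<in> basis_index n" "d \<in> basis_index n" using S by (auto simp: in_order_rel)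
    then show "(Y, Z) \<in> Restr (basis_order n) {Y. (Y, ?e b) \<in> basis_order n}"
      using cd le b by (auto simp: in_order_rel below_def)
  qed
  moreover have "order_rel (\<prec>) ?S =o dir_image (order_rel (\<prec>) ?S) ?e"
    by (rule dir_image_ordIso[OF Well_order_order_rel[OF well_ordered_index_subset[OF S]]])
      (unfold Field_order_rel, rule inj_on_subset[OF inj_on_basis_elem S])
  ultimately show ?thesis
    unfolding basis_ord_def ord_def using order_type_cong ordIso_symmetric by metis
qed

text \<open>
  Order types increase strictly along downsets, so \<open>basis_ord\<close> of a basis element is at most the order
  type of \<open>S\<close> exactly for the indices in \<open>S\<close>.
\<close>

lemma ideal_upto_ord:
  assumes S: "downset n S"
  shows "(ideal_upto n (ord (\<prec>) S) :: 'k::comm_ring_1 operator set) = derivation n ` span_on S"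
proof -
  have "basis_ord n (basis_elem n b :: 'k operator) \<le> ord (\<prec>) S \<longleftrightarrow> b \<in> S" if b: "b \<in> basis_index n" for b
  proof -
    have D: "downset n (insert b (below n b))"
      using b index_less_trans unfolding downset_def below_def by blast
    show ?thesis
    proof
      assume "b \<in> S"
      then have "insert b (below n b) \<subseteq> S" using S by (auto simp: downset_def below_def)
      then show "basis_ord n (basis_elem n b :: 'k operator) \<le> ord (\<prec>) S"
        unfolding basis_ord_eq[OF b] by (rule ord_downset_mono[OF D S])
    next
      assume le: "basis_ord n (basis_elem n b :: 'k operator) \<le> ord (\<prec>) S"
      show "b \<in> S"
      proof (rule ccontr)
        assume "b \<notin> S"
        then have "S \<subset> insert b (below n b)" using downset_not_mem[OF S b] by blast
        from ord_downset_less[OF S D this] le show False unfolding basis_ord_eq[OF b] by simp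
      qed
    qed
  qed
  then have "{b \<in> basis_index n. basis_ord n (basis_elem n b :: 'k operator) \<le> ord (\<prec>) S} = S"
    using downset_subset[OF S] by blast
  then show ?thesis unfolding ideal_upto_eq by simp
qed

lemma nfold_0 [simp]: "0 \<cdot> x = 0"
  by (simp add: nfold_def)

lemma nfold_Suc: "Suc i \<cdot> x = i \<cdot> x + x"
  by (simp add: nfold_def flip: replicate_append_same)

lemma omega_sum_self [simp]: "omega_sum n n = 0"
  by (simp add: omega_sum_def)

lemma omega_sum_Suc: "k < n \<Longrightarrow> omega_sum n k = omega_sum n (Suc k) + \<omega> ^ k"
  by (simp add: omega_sum_def upt_conv_Cons)

lemma ord_slice:
  assumes "(\<lambda>\<delta>. (\<delta> + \<gamma>, i)) ` D \<subseteq> basis_index n" "D \<subseteq> exps l m"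
  shows "ord (\<prec>) ((\<lambda>\<delta>. (\<delta> + \<gamma>, i)) ` D) = ord (\<lhd>) D"
  by (rule sym, rule ord_cong[where h = "\<lambda>\<delta>. (\<delta> + \<gamma>, i)"])
    (use assms in \<open>auto intro: well_ordered_subset[OF well_ordered_exps] well_ordered_index_subset
      simp: bij_betw_def inj_on_def index_less_Pair colex_add\<close>)

text \<open>
  The block of \<open>\<partial>\<^bsub>k+1\<^esub>\<close> has order type \<open>\<omega> ^ k\<close> and comes after all later blocks.
\<close>

lemma ord_tail: "k \<le> n \<Longrightarrow> ord (\<prec>) (tail n k) = omega_sum n k"
proof (induction rule: inc_induct)
  case base
  have "tail n n = {}" by (auto simp: tail_def basis_index_def)
  then show ?case by simp
next
  case (step k)
  let ?B = "(\<lambda>\<delta>. (\<delta> + 0, Suc k)) ` exps 1 k"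
  have B: "?B \<subseteq> basis_index n" using step.hyps by (auto simp: basis_index_def exps_def)
  have eq: "tail n k = tail n (Suc k) \<union> ?B"
  proof (intro equalityI subsetI)
    fix b assume b: "b \<in> tail n k"
    obtain \<alpha> i where b_eq: "b = (\<alpha>, i)" by (cases b)
    show "b \<in> tail n (Suc k) \<union> ?B"
    proof (cases "i = Suc k")
      case True
      then have "\<alpha> \<in> exps 1 k" using b by (auto simp: b_eq tail_def basis_index_def exps_def)
      then show ?thesis by (auto simp: b_eq True)
    qed (use b in \<open>auto simp: b_eq tail_def\<close>)
  next
    fix b assume "b \<in> tail n (Suc k) \<union> ?B"
    then show "b \<in> tail n k" using B by (auto simp: tail_def)
  qed
  have "ord (\<prec>) (tail n k) = ord (\<prec>) (tail n (Suc k)) + ord (\<prec>) ?B"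
    unfolding eq
  proof (rule ord_Un)
    show "well_ordered (\<prec>) (tail n (Suc k) \<union> ?B)"
      using B by (intro well_ordered_index_subset) (auto simp: tail_def)
  qed (auto simp: tail_def index_less_def)
  also have "ord (\<prec>) ?B = \<omega> ^ k" using ord_slice[OF B order_refl] by (simp add: ord_exps)
  finally show ?case using step by (simp add: omega_sum_Suc)
qed

lemma exps_1_eq: "1 \<le> r \<Longrightarrow> exps 1 (r - 1) = {\<alpha>. keys \<alpha> \<subseteq> {1..r - 1}}"
proof -
  assume "1 \<le> r"
  then have "{1..<1 + (r - 1)} = {1..r - 1}" by auto
  then show ?thesis by (simp only: exps_def)
qed

text \<open>
  The elements below \<open>x\<^sup>\<alpha> x\<^sub>r\<^sup>a \<partial>\<^bsub>r+1\<^esub>\<close> are the higher blocks, then \<open>a\<close> full slices with constant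
  exponent of \<open>x\<^sub>r\<close>, then the initial segment below \<open>\<alpha>\<close> of the next slice.
\<close>

lemma ord_below:
  assumes r: "1 \<le> r" "r < n" and \<alpha>: "keys \<alpha> \<subseteq> {1..r - 1}"
  shows "ord (\<prec>) (below n (\<alpha> + single r a, Suc r)) =
    omega_sum n (Suc r) + a \<cdot> \<omega> ^ (r - 1) + ord (\<lhd>) {\<delta> \<in> exps 1 (r - 1). \<delta> \<lhd> \<alpha>}"
proof -
  let ?slice = "\<lambda>a D. (\<lambda>\<delta>. (\<delta> + single r a, Suc r)) ` D"
  let ?E = "exps 1 (r - 1)"
  have W: "?slice a D \<subseteq> basis_index n" if "D \<subseteq> ?E" for a D
    using that add_single_in_basis_index[OF r] unfolding exps_1_eq[OF r(1)] by blast
  have lt: "x \<prec> y" if "x \<in> ?slice a D" "y \<in> ?slice b D'" "a < b" "D \<subseteq> ?E" "D' \<subseteq> ?E" for x y a b D D'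
    using that colex_add_single_iff[OF r(1)] unfolding exps_1_eq[OF r(1)] by (auto simp: index_less_Pair subset_iff)
  have low: "ord (\<prec>) (\<Union>b<a. ?slice b ?E) = a \<cdot> \<omega> ^ (r - 1)" for a
  proof (induction a)
    case (Suc a)
    have "(\<Union>b<Suc a. ?slice b ?E) = (\<Union>b<a. ?slice b ?E) \<union> ?slice a ?E"
      by (simp add: lessThan_Suc Un_commute)
    moreover have "ord (\<prec>) ((\<Union>b<a. ?slice b ?E) \<union> ?slice a ?E) = ord (\<prec>) (\<Union>b<a. ?slice b ?E) + ord (\<prec>) (?slice a ?E)"
    proof (rule ord_Un)
      show "well_ordered (\<prec>) ((\<Union>b<a. ?slice b ?E) \<union> ?slice a ?E)"
        using W[OF order_refl] by (intro well_ordered_index_subset) blast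
      show "x \<prec> y" if "x \<in> (\<Union>b<a. ?slice b ?E)" "y \<in> ?slice a ?E" for x y
        using that lt[OF _ _ _ order_refl order_refl] by blast
    qed
    moreover have "ord (\<prec>) (?slice a ?E) = \<omega> ^ (r - 1)"
      using ord_slice[OF W[OF order_refl] order_refl] by (simp only: ord_exps)
    ultimately show ?case by (simp only: Suc.IH nfold_Suc)
  qed simp
  let ?D = "{\<delta> \<in> ?E. \<delta> \<lhd> \<alpha>}"
  let ?L = "\<Union>b<a. ?slice b ?E"
  have eq: "below n (\<alpha> + single r a, Suc r) = (tail n (Suc r) \<union> ?L) \<union> ?slice a ?D"
  proof (intro equalityI subsetI)
    fix x assume x: "x \<in> below n (\<alpha> + single r a, Suc r)"
    obtain \<kappa> i where x_eq: "x = (\<kappa>, i)" by (cases x)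
    show "x \<in> (tail n (Suc r) \<union> ?L) \<union> ?slice a ?D"
    proof (cases "Suc r < i")
      case False
      then have i: "i = Suc r" "\<kappa> \<lhd> \<alpha> + single r a" "keys \<kappa> \<subseteq> {1..r}"
        using x by (auto simp: x_eq below_def index_less_Pair basis_index_def)
      then obtain \<delta> where \<delta>: "\<kappa> = \<delta> + single r (lookup \<kappa> r)" "keys \<delta> \<subseteq> {1..r - 1}"
        using split_top_exponent[OF r(1)] by blast
      define b where "b = lookup \<kappa> r"
      have \<kappa>: "\<kappa> = \<delta> + single r b" using \<delta>(1) by (simp add: b_def)
      have "b < a \<or> b = a \<and> \<delta> \<lhd> \<alpha>" using i(2) colex_add_single_iff[OF r(1) \<delta>(2) \<alpha>] by (simp add: \<kappa>)
      moreover have "\<delta> \<in> ?E" using \<delta>(2) unfolding exps_1_eq[OF r(1)] by simp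
      ultimately show ?thesis unfolding x_eq i(1) \<kappa> by blast
    qed (use x in \<open>auto simp: x_eq below_def tail_def\<close>)
  next
    fix x assume "x \<in> (tail n (Suc r) \<union> ?L) \<union> ?slice a ?D"
    then consider "x \<in> tail n (Suc r)" | b \<delta> where "b < a" "\<delta> \<in> ?E" "x = (\<delta> + single r b, Suc r)"
      | \<delta> where "\<delta> \<in> ?E" "\<delta> \<lhd> \<alpha>" "x = (\<delta> + single r a, Suc r)" by blast
    then show "x \<in> below n (\<alpha> + single r a, Suc r)"
    proof cases
      case 1
      then show ?thesis by (auto simp: tail_def below_def index_less_def)
    next
      case 2
      then have "keys \<delta> \<subseteq> {1..r - 1}" unfolding exps_1_eq[OF r(1)] by simp
      then show ?thesis
        using 2 add_single_in_basis_index[OF r] colex_add_single_iff[OF r(1) _ \<alpha>]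
        by (simp add: below_def index_less_Pair)
    next
      case 3
      then have "keys \<delta> \<subseteq> {1..r - 1}" unfolding exps_1_eq[OF r(1)] by simp
      then show ?thesis
        using 3 add_single_in_basis_index[OF r] colex_add_single_iff[OF r(1) _ \<alpha>]
        by (simp add: below_def index_less_Pair)
    qed
  qed
  have sub: "(tail n (Suc r) \<union> ?L) \<union> ?slice a ?D \<subseteq> basis_index n"
    unfolding eq[symmetric] by (auto simp: below_def)
  have tail_lt: "x \<prec> y" if "x \<in> tail n (Suc r)" "snd y = Suc r" for x y
    using that by (auto simp: tail_def index_less_def)
  have "ord (\<prec>) ((tail n (Suc r) \<union> ?L) \<union> ?slice a ?D) = ord (\<prec>) (tail n (Suc r) \<union> ?L) + ord (\<prec>) (?slice a ?D)"
  proof (rule ord_Un[OF well_ordered_index_subset[OF sub]])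
    fix x y assume x: "x \<in> tail n (Suc r) \<union> ?L" and y: "y \<in> ?slice a ?D"
    from x show "x \<prec> y"
    proof
      assume "x \<in> tail n (Suc r)"
      then show ?thesis using y by (intro tail_lt) auto
    next
      assume "x \<in> ?L"
      then obtain b where "b < a" "x \<in> ?slice b ?E" by blast
      then show ?thesis using lt[OF _ y] by blast
    qed
  qed
  also have "ord (\<prec>) (tail n (Suc r) \<union> ?L) = ord (\<prec>) (tail n (Suc r)) + ord (\<prec>) ?L"
  proof (rule ord_Un)
    show "well_ordered (\<prec>) (tail n (Suc r) \<union> ?L)" using sub by (intro well_ordered_index_subset) blast
    show "x \<prec> y" if "x \<in> tail n (Suc r)" "y \<in> ?L" for x y using that by (intro tail_lt) auto
  qed
  also have "ord (\<prec>) (tail n (Suc r)) = omega_sum n (Suc r)" using r by (intro ord_tail) simp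
  also have "ord (\<prec>) ?L = a \<cdot> \<omega> ^ (r - 1)" by (rule low)
  also have "ord (\<prec>) (?slice a ?D) = ord (\<lhd>) ?D" 
  proof -
    have "?D \<subseteq> ?E" by blast
    then show ?thesis by (intro ord_slice[OF W])
  qed
  finally show ?thesis unfolding eq .
qed

section \<open>The isomorphism criterion\<close>

theorem isomorphic_iff_similar:
  assumes S: "downset n S" and S': "downset n S'"
  shows "(tuples n :: ('k::field_char_0, 'k tuple) lie_algebra) //\<^sub>L span_on S \<cong>
      tuples n //\<^sub>L span_on S' \<longleftrightarrow> similar n S S'"
proof
  assume "(tuples n :: ('k, 'k tuple) lie_algebra) //\<^sub>L span_on S \<cong> tuples n //\<^sub>L span_on S'"
  then show "similar n S S'" by (rule isomorphic_imp_similar[OF S S'])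
next
  assume "similar n S S'"
  then show "(tuples n :: ('k, 'k tuple) lie_algebra) //\<^sub>L span_on S \<cong> tuples n //\<^sub>L span_on S'"
    unfolding similar_def using lie_isomorphic_refl isomorphic_if_equal_lower_exponents by blast
qed

lemma triangular_isomorphic_iff:
  assumes S: "downset n S" and S': "downset n S'"
  shows "(\<uu> n :: ('k::field_char_0, 'k operator) lie_algebra) //\<^sub>L ideal_upto n (ord (\<prec>) S) \<cong>
      \<uu> n //\<^sub>L ideal_upto n (ord (\<prec>) S') \<longleftrightarrow> similar n S S'"
proof -
  have "span_on S \<subseteq> (span_on (basis_index n) :: 'k tuple set)"
    "span_on S' \<subseteq> (span_on (basis_index n) :: 'k tuple set)"
    using S S' by (simp_all add: span_on_mono downset_subset)
  then show ?thesis
    unfolding ideal_upto_ord[OF S] ideal_upto_ord[OF S'] isomorphic_iff_similar[OF S S', where 'k = 'k, symmetric]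
    by (intro lie_quotient_image_iff[OF lie_iso_derivation]) simp_all
qed

lemma lie_iso_imp_isomorphic: "lie_iso g L M \<Longrightarrow> L \<cong> M"
  unfolding lie_iso_def lie_isomorphic_def by blast

text \<open>
  This reduces the first part of the theorem to the second.
\<close>

lemma quotient_by_zero:
  "(\<uu> n :: ('k::field_char_0, 'k operator) lie_algebra) \<cong> \<uu> n //\<^sub>L ideal_upto n 0"
  "(\<uu> n :: ('k, 'k operator) lie_algebra) //\<^sub>L ideal_upto n 0 \<cong> \<uu> n"
proof -
  let ?T = "tuples n :: ('k, 'k tuple) lie_algebra"
  let ?Z = "span_on {} :: 'k tuple set"
  have D: "downset n {}" by (simp add: downset_def)
  have Z: "ideal n ?Z" by (rule ideal_span_on[OF D])
  have "f = 0" if "f \<in> ?Z" for f :: "'k tuple"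
  proof (intro ext poly_mapping_eqI)
    fix i \<alpha>
    show "lookup (f i) \<alpha> = lookup (0 i) \<alpha>" using span_onD[OF that, of i \<alpha>] by auto
  qed
  then have "inj_on (coset n ?Z) (span_on (basis_index n))"
    unfolding inj_on_def coset_eq_iff[OF Z] by (metis eq_iff_diff_eq_0)
  then have 1: "lie_iso (coset n ?Z) ?T (?T //\<^sub>L ?Z)"
    unfolding lie_iso_def carrier_quotient
    by (simp add: bij_betw_def span_on_add span_on_scale tuple_bracket_closed
        quotient_add[OF Z] quotient_scale[OF Z] quotient_bracket[OF Z])
  have "?Z \<subseteq> span_on (basis_index n)" by (rule span_on_mono) simp
  then have sub: "?Z \<subseteq> carrier ?T" by simp
  have 2: "lie_iso (derivation n) ?T (\<uu> n)" by (rule lie_iso_derivation)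
  have 3: "ideal_upto n 0 = derivation n ` ?Z" using ideal_upto_ord[OF D, where 'k = 'k] by simp
  have 4: "\<uu> n \<cong> ?T" "?T \<cong> \<uu> n"
    by (rule lie_iso_imp_isomorphic[OF lie_iso_inverse[OF 2]]) (rule lie_iso_imp_isomorphic[OF 2])
  have 5: "?T \<cong> ?T //\<^sub>L ?Z" "?T //\<^sub>L ?Z \<cong> ?T"
    by (rule lie_iso_imp_isomorphic[OF 1]) (rule lie_iso_imp_isomorphic[OF lie_iso_inverse[OF 1]])
  have bij: "bij_betw (derivation n) (carrier ?T) (carrier (\<uu> n))" by (rule bij_betw_derivation)
  have 6: "?T //\<^sub>L ?Z \<cong> \<uu> n //\<^sub>L ideal_upto n 0" "\<uu> n //\<^sub>L ideal_upto n 0 \<cong> ?T //\<^sub>L ?Z"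
    using lie_quotient_image[OF 2 sub] lie_quotient_image[OF lie_iso_inverse[OF 2], of "derivation n ` ?Z"]
      bij sub
    unfolding 3 bij_betw_def by (auto simp: inv_into_image_cancel)
  show "(\<uu> n :: ('k, 'k operator) lie_algebra) \<cong> \<uu> n //\<^sub>L ideal_upto n 0"
    "(\<uu> n :: ('k, 'k operator) lie_algebra) //\<^sub>L ideal_upto n 0 \<cong> \<uu> n"
    by (rule lie_isomorphic_trans[OF 4(1) lie_isomorphic_trans[OF 5(1) 6(1)]])
      (rule lie_isomorphic_trans[OF 6(2) lie_isomorphic_trans[OF 5(2) 4(2)]])
qed

lemma triangular_isomorphic_quotient_iff:
  fixes I :: "'k::field_char_0 operator set"
  shows "\<uu> n \<cong> \<uu> n //\<^sub>L I \<longleftrightarrow> \<uu> n //\<^sub>L ideal_upto n 0 \<cong> \<uu> n //\<^sub>L I"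
  using lie_isomorphic_trans[OF quotient_by_zero(1)] lie_isomorphic_trans[OF quotient_by_zero(2)] by blast

subsection \<open>Ordinals and downsets\<close>

lemma omega_sum_0: "n \<ge> 1 \<Longrightarrow> omega_sum n 0 = omega_sum n 1 + 1"
  using omega_sum_Suc[of 0 n] by simp

lemma ord_basis_index: "ord (\<prec>) (basis_index n) = omega_sum n 0"
proof -
  have "tail n 0 = basis_index n" by (auto simp: tail_def basis_index_def)
  then show ?thesis using ord_tail[of 0 n] by simp
qed

lemma below_block_1: "below n (0, 1) = tail n 1"
  by (auto simp: below_def tail_def index_less_def colex_def)

text \<open>
  An ordinal below the order type of the basis is the order type of an initial segment.
\<close>

lemma ordinal_is_ord_downset:
  assumes "lam \<in> {1..omega_sum n 0} \<union> {0}"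
  obtains S where "downset n S" "lam = ord (\<prec>) S"
proof -
  have "lam \<le> omega_sum n 0" using assms ordinal_not_less_0[of "omega_sum n 0"] by (auto simp: not_less)
  then consider "lam = omega_sum n 0" | "lam < ord (\<prec>) (basis_index n)"
    by (auto simp: ord_basis_index le_less)
  then show ?thesis
  proof cases
    case 1
    then show ?thesis using that[OF downset_basis_index] by (simp add: ord_basis_index)
  next
    case 2
    then obtain b where "b \<in> basis_index n" "lam = ord (\<prec>) {c \<in> basis_index n. c \<prec> b}"
      using less_ord_imp_segment[OF well_ordered_index] by blast
    then show ?thesis using that[OF downset_below] by (simp add: below_def)
  qed
qed

text \<open>
  The remainders \<open>\<nu> < \<omega> ^ (r - 1)\<close> are the order types of initial segments of the exponents in the
  first \<open>r - 1\<close> variables.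
\<close>

lemma less_omega_power_iff:
  assumes "1 \<le> r"
  shows "nu \<in> {1..<\<omega> ^ (r - 1)} \<union> {0} \<longleftrightarrow>
    (\<exists>\<alpha>. keys \<alpha> \<subseteq> {1..r - 1} \<and> nu = ord (\<lhd>) {\<delta> \<in> exps 1 (r - 1). \<delta> \<lhd> \<alpha>})"
proof
  assume "nu \<in> {1..<\<omega> ^ (r - 1)} \<union> {0}"
  moreover have "0 < \<omega> ^ (r - 1)"
    using ord_segment_less[OF well_ordered_exps, of 0 1 "r - 1"] ordinal_not_less_0
    unfolding ord_exps by (metis exps_def empty_subsetI keys_zero linorder_neqE mem_Collect_eq)
  ultimately have "nu < ord (\<lhd>) (exps 1 (r - 1))" by (auto simp: ord_exps)
  then obtain \<alpha> where "\<alpha> \<in> exps 1 (r - 1)" "nu = ord (\<lhd>) {\<delta> \<in> exps 1 (r - 1). \<delta> \<lhd> \<alpha>}"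
    using less_ord_imp_segment[OF well_ordered_exps] by blast
  moreover have "keys \<alpha> \<subseteq> {1..r - 1}" using calculation(1) unfolding exps_1_eq[OF assms] by simp
  ultimately show "\<exists>\<alpha>. keys \<alpha> \<subseteq> {1..r - 1} \<and> nu = ord (\<lhd>) {\<delta> \<in> exps 1 (r - 1). \<delta> \<lhd> \<alpha>}" by blast
next
  assume "\<exists>\<alpha>. keys \<alpha> \<subseteq> {1..r - 1} \<and> nu = ord (\<lhd>) {\<delta> \<in> exps 1 (r - 1). \<delta> \<lhd> \<alpha>}"
  then obtain \<alpha> where "keys \<alpha> \<subseteq> {1..r - 1}" and nu: "nu = ord (\<lhd>) {\<delta> \<in> exps 1 (r - 1). \<delta> \<lhd> \<alpha>}"
    by blast
  then have "\<alpha> \<in> exps 1 (r - 1)" unfolding exps_1_eq[OF assms] by simp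
  then have "nu < \<omega> ^ (r - 1)" unfolding nu ord_exps[of 1, symmetric] by (rule ord_segment_less[OF well_ordered_exps])
  then show "nu \<in> {1..<\<omega> ^ (r - 1)} \<union> {0}" using ordinal_0_or_ge_1[of nu] by auto
qed

lemma ord_below_cases:
  assumes S: "downset n S" and S': "downset n S'" and r: "1 \<le> r" "r < n"
  shows "(\<exists>i j. \<exists>nu \<in> {1..<\<omega> ^ (r - 1)} \<union> {0}.
      ord (\<prec>) S = omega_sum n (Suc r) + i \<cdot> \<omega> ^ (r - 1) + nu \<and>
      ord (\<prec>) S' = omega_sum n (Suc r) + j \<cdot> \<omega> ^ (r - 1) + nu) \<longleftrightarrow>
    (\<exists>\<alpha> a b. keys \<alpha> \<subseteq> {1..r - 1} \<and>
      S = below n (\<alpha> + single r a, Suc r) \<and> S' = below n (\<alpha> + single r b, Suc r))"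
    (is "?L \<longleftrightarrow> ?R")
proof
  assume ?L
  then obtain i j nu where nu: "nu \<in> {1..<\<omega> ^ (r - 1)} \<union> {0}"
    and ord: "ord (\<prec>) S = omega_sum n (Suc r) + i \<cdot> \<omega> ^ (r - 1) + nu"
      "ord (\<prec>) S' = omega_sum n (Suc r) + j \<cdot> \<omega> ^ (r - 1) + nu" by blast
  from nu obtain \<alpha> where \<alpha>: "keys \<alpha> \<subseteq> {1..r - 1}" "nu = ord (\<lhd>) {\<delta> \<in> exps 1 (r - 1). \<delta> \<lhd> \<alpha>}"
    unfolding less_omega_power_iff[OF r(1)] by blast
  have "S = below n (\<alpha> + single r i, Suc r)" "S' = below n (\<alpha> + single r j, Suc r)"
    using ord unfolding \<alpha>(2) ord_below[OF r \<alpha>(1), symmetric]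
    by (simp_all only: ord_downset_inject[OF S downset_below] ord_downset_inject[OF S' downset_below])
  with \<alpha>(1) show ?R by blast
next
  assume ?R
  then obtain \<alpha> a b where \<alpha>: "keys \<alpha> \<subseteq> {1..r - 1}" and
    eq: "S = below n (\<alpha> + single r a, Suc r)" "S' = below n (\<alpha> + single r b, Suc r)"
    by blast
  have "ord (\<lhd>) {\<delta> \<in> exps 1 (r - 1). \<delta> \<lhd> \<alpha>} \<in> {1..<\<omega> ^ (r - 1)} \<union> {0}"
    unfolding less_omega_power_iff[OF r(1)] using \<alpha> by blast
  then show ?L unfolding eq ord_below[OF r \<alpha>] by blast
qed

text \<open>
  The alternative (a) is the case \<open>s = n\<close> of (b), in which the leading sum of powers is empty.
\<close>

lemma similar_iff_ordinals:
  assumes n: "n \<ge> 2" and S: "downset n S" and S': "downset n S'"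
  shows "similar n S S' \<longleftrightarrow>
      (\<exists>i j. \<exists>nu \<in> {1..<\<omega> ^ (n - 2)} \<union> {0}.
          ord (\<prec>) S = i \<cdot> \<omega> ^ (n - 2) + nu \<and> ord (\<prec>) S' = j \<cdot> \<omega> ^ (n - 2) + nu) \<or>
      (\<exists>s. 2 \<le> s \<and> s \<le> n - 1 \<and>
        (\<exists>i j. \<exists>nu \<in> {1..<\<omega> ^ (s - 2)} \<union> {0}.
          ord (\<prec>) S = omega_sum n s + i \<cdot> \<omega> ^ (s - 2) + nu \<and>
          ord (\<prec>) S' = omega_sum n s + j \<cdot> \<omega> ^ (s - 2) + nu)) \<or>
      (\<exists>e \<in> {0, 1}. ord (\<prec>) S = omega_sum n 1 + e \<and> ord (\<prec>) S' = omega_sum n 1 + e)"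
    (is "_ \<longleftrightarrow> ?A \<or> ?B \<or> ?C")
proof -
  let ?P = "\<lambda>s. \<exists>i j. \<exists>nu \<in> {1..<\<omega> ^ (s - 2)} \<union> {0}.
      ord (\<prec>) S = omega_sum n s + i \<cdot> \<omega> ^ (s - 2) + nu \<and>
      ord (\<prec>) S' = omega_sum n s + j \<cdot> \<omega> ^ (s - 2) + nu"
  let ?Q = "\<lambda>r. \<exists>\<alpha> a b. keys \<alpha> \<subseteq> {1..r - 1} \<and>
      S = below n (\<alpha> + single r a, Suc r) \<and> S' = below n (\<alpha> + single r b, Suc r)"
  have PQ: "?P (Suc r) \<longleftrightarrow> ?Q r" if "1 \<le> r" "r < n" for r
  proof -
    have "Suc r - 2 = r - 1" by simp
    then show ?thesis using ord_below_cases[OF S S' that] by (simp only:)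
  qed
  have A: "?A \<longleftrightarrow> ?P n" by simp
  have AB: "?A \<or> ?B \<longleftrightarrow> (\<exists>r. 1 \<le> r \<and> r < n \<and> ?Q r)"
  proof -
    have "?A \<or> ?B \<longleftrightarrow> (\<exists>s. 2 \<le> s \<and> s \<le> n \<and> ?P s)"
    proof
      assume "?A \<or> ?B"
      then show "\<exists>s. 2 \<le> s \<and> s \<le> n \<and> ?P s"
      proof
        assume ?A
        then show ?thesis using n unfolding A by blast
      next
        assume ?B
        then obtain s where "2 \<le> s" "s \<le> n - 1" "?P s" by blast
        moreover have "s \<le> n" using \<open>s \<le> n - 1\<close> by simp
        ultimately show ?thesis by blast
      qed
    next
      assume "\<exists>s. 2 \<le> s \<and> s \<le> n \<and> ?P s"
      then obtain s where s: "2 \<le> s" "s \<le> n" "?P s" by blast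
      show "?A \<or> ?B"
      proof (cases "s = n")
        case True
        then have ?A using s(3) unfolding A by blast
        then show ?thesis ..
      next
        case False
        then have "s \<le> n - 1" using s(2) by simp
        then have ?B using s(1,3) by blast
        then show ?thesis ..
      qed
    qed
    also have "\<dots> \<longleftrightarrow> (\<exists>r. 1 \<le> r \<and> r < n \<and> ?Q r)"
    proof
      assume "\<exists>s. 2 \<le> s \<and> s \<le> n \<and> ?P s"
      then obtain s where s: "2 \<le> s" "s \<le> n" "?P s" by blast
      then obtain r where r: "s = Suc r" by (cases s) auto
      have "1 \<le> r" "r < n" using s r by auto
      then show "\<exists>r. 1 \<le> r \<and> r < n \<and> ?Q r" using PQ[of r] s(3) unfolding r by blast
    next
      assume "\<exists>r. 1 \<le> r \<and> r < n \<and> ?Q r"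
      then obtain r where r: "1 \<le> r" "r < n" "?Q r" by blast
      then have "?P (Suc r)" using PQ by blast
      moreover have "2 \<le> Suc r" "Suc r \<le> n" using r by auto
      ultimately show "\<exists>s. 2 \<le> s \<and> s \<le> n \<and> ?P s" by blast
    qed
    finally show ?thesis .
  qed
  have "ord (\<prec>) T = omega_sum n 1 + 0 \<longleftrightarrow> T = below n (0, 1)" if T: "downset n T" for T
    using ord_downset_inject[OF T downset_tail, of 1] ord_tail[of 1 n] n unfolding below_block_1 by auto
  moreover have "ord (\<prec>) T = omega_sum n 1 + 1 \<longleftrightarrow> T = basis_index n" if T: "downset n T" for T
    using ord_downset_inject[OF T downset_basis_index] ord_basis_index[of n] omega_sum_0[of n] n by auto
  ultimately have C: "?C \<longleftrightarrow> S = basis_index n \<and> S' = basis_index n \<or> S = below n (0, 1) \<and> S' = below n (0, 1)"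
    using S S' by (simp only: bex_simps) blast
  have "(?A \<or> ?B \<or> ?C) \<longleftrightarrow> (?A \<or> ?B) \<or> ?C" by blast
  also have "\<dots> \<longleftrightarrow> similar n S S'" unfolding AB C similar_def by blast
  finally show ?thesis by blast
qed

text \<open>
  The zero ideal is the one below the least basis element \<open>\<partial>\<^sub>n\<close>, so all exponents before the last
  variable have to vanish.
\<close>

lemma similar_empty_iff:
  assumes n: "n \<ge> 2" and S: "downset n S"
  shows "similar n {} S \<longleftrightarrow> (\<exists>i. ord (\<prec>) S = i \<cdot> \<omega> ^ (n - 2))"
proof -
  define r where "r = n - 1"
  have r: "1 \<le> r" "r < n" "n = Suc r" "n - 2 = r - 1" using n by (auto simp: r_def)
  have top: "(0, n) \<in> basis_index n" using n by (simp add: basis_index_def)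
  have empty: "below n (0, n) = {}" by (auto simp: below_def index_less_def colex_def basis_index_def)
  have ord: "ord (\<prec>) (below n (single r i, n)) = i \<cdot> \<omega> ^ (n - 2)" for i
  proof -
    have "{\<delta> \<in> exps 1 (r - 1). \<delta> \<lhd> 0} = {}" by (auto simp: colex_def)
    then have zero: "ord (\<lhd>) {\<delta> \<in> exps 1 (r - 1). \<delta> \<lhd> 0} = 0" by (simp only: ord_empty)
    show ?thesis using ord_below[OF r(1,2), of 0 i] unfolding zero r(3)[symmetric] r(4) by simp
  qed
  have "similar n {} S \<longleftrightarrow> (\<exists>i. S = below n (single r i, n))"
  proof
    assume "similar n {} S"
    moreover have "{} \<noteq> basis_index n" using top by blast
    moreover have "{} \<noteq> below n (0, 1)" 
    proof -
      have "(0, n) \<in> below n (0, 1)" using top n by (simp add: below_def index_less_Pair)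
      then show ?thesis by blast
    qed
    ultimately obtain q \<alpha> a b where q: "1 \<le> q" "q < n" "keys \<alpha> \<subseteq> {1..q - 1}"
      "{} = below n (\<alpha> + single q a, Suc q)" "S = below n (\<alpha> + single q b, Suc q)"
      unfolding similar_def by blast
    have "(\<alpha> + single q a, Suc q) = (0, n)"
      by (rule below_inj[OF add_single_in_basis_index[OF q(1-3)] top]) (use q(4) empty in simp)
    then have "Suc q = n" "keys (\<alpha> + single q a) = {}" by simp_all
    then have "q = r" "\<alpha> = 0" by (auto simp: r_def keys_plus_exp)
    then show "\<exists>i. S = below n (single r i, n)" using q(5) r(3) by auto
  next
    assume "\<exists>i. S = below n (single r i, n)"
    then obtain i where "S = below n (0 + single r i, Suc r)" using r(3) by auto
    moreover have "{} = below n (0 + single r 0, Suc r)" using empty r(3) by simp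
    ultimately show "similar n {} S" unfolding similar_def using r(1,2) by (metis empty_subsetI keys_zero)
  qed
  also have "\<dots> \<longleftrightarrow> (\<exists>i. ord (\<prec>) S = i \<cdot> \<omega> ^ (n - 2))"
    unfolding ord[symmetric] using ord_downset_inject[OF S downset_below] by blast
  finally show ?thesis .
qed

theorem theorem5p1:
  fixes n :: nat
  assumes "n \<ge> 2"
  shows "(\<forall>lam \<in> {1..omega_sum n 0} \<union> {0}.
      (\<uu> n :: ('k::field_char_0, 'k operator) lie_algebra) \<cong> \<uu> n //\<^sub>L ideal_upto n lam \<longleftrightarrow>
      (\<exists>i::nat. lam = i \<cdot> \<omega> ^ (n - 2)))
    \<and>
    (\<forall>lam \<in> {1..omega_sum n 0} \<union> {0}. \<forall>mu \<in> {1..omega_sum n 0} \<union> {0}.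
      (\<uu> n :: ('k, 'k operator) lie_algebra) //\<^sub>L ideal_upto n lam \<cong>
        \<uu> n //\<^sub>L ideal_upto n mu \<longleftrightarrow>
      (\<exists>i j::nat. \<exists>nu \<in> {1..<\<omega> ^ (n - 2)} \<union> {0}.
          lam = i \<cdot> \<omega> ^ (n - 2) + nu \<and> mu = j \<cdot> \<omega> ^ (n - 2) + nu) \<or>
      (\<exists>s::nat. 2 \<le> s \<and> s \<le> n - 1 \<and>
        (\<exists>i j::nat. \<exists>nu \<in> {1..<\<omega> ^ (s - 2)} \<union> {0}.
          lam = omega_sum n s + i \<cdot> \<omega> ^ (s - 2) + nu \<and>
          mu = omega_sum n s + j \<cdot> \<omega> ^ (s - 2) + nu)) \<or>
      (\<exists>e \<in> {0, 1}. lam = omega_sum n 1 + e \<and> mu = omega_sum n 1 + e))"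
proof (intro conjI ballI)
  fix lam assume "lam \<in> {1..omega_sum n 0} \<union> {0}"
  then obtain S where S: "downset n S" "lam = ord (\<prec>) S" by (rule ordinal_is_ord_downset)
  have "downset n {}" by (simp add: downset_def)
  from triangular_isomorphic_iff[OF this S(1), where 'k = 'k]
  show "(\<uu> n :: ('k, 'k operator) lie_algebra) \<cong> \<uu> n //\<^sub>L ideal_upto n lam \<longleftrightarrow>
      (\<exists>i::nat. lam = i \<cdot> \<omega> ^ (n - 2))"
    unfolding triangular_isomorphic_quotient_iff S(2) similar_empty_iff[OF assms S(1)] by simp
next
  fix lam mu assume "lam \<in> {1..omega_sum n 0} \<union> {0}" "mu \<in> {1..omega_sum n 0} \<union> {0}"
  then obtain S S' where S: "downset n S" "lam = ord (\<prec>) S" and S': "downset n S'" "mu = ord (\<prec>) S'"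
    using ordinal_is_ord_downset by metis
  show "(\<uu> n :: ('k, 'k operator) lie_algebra) //\<^sub>L ideal_upto n lam \<cong>
        \<uu> n //\<^sub>L ideal_upto n mu \<longleftrightarrow>
      (\<exists>i j::nat. \<exists>nu \<in> {1..<\<omega> ^ (n - 2)} \<union> {0}.
          lam = i \<cdot> \<omega> ^ (n - 2) + nu \<and> mu = j \<cdot> \<omega> ^ (n - 2) + nu) \<or>
      (\<exists>s::nat. 2 \<le> s \<and> s \<le> n - 1 \<and>
        (\<exists>i j::nat. \<exists>nu \<in> {1..<\<omega> ^ (s - 2)} \<union> {0}.
          lam = omega_sum n s + i \<cdot> \<omega> ^ (s - 2) + nu \<and>
          mu = omega_sum n s + j \<cdot> \<omega> ^ (s - 2) + nu)) \<or>
      (\<exists>e \<in> {0, 1}. lam = omega_sum n 1 + e \<and> mu = omega_sum n 1 + e)"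
    unfolding S(2) S'(2) triangular_isomorphic_iff[OF S(1) S'(1)]
    by (rule similar_iff_ordinals[OF assms S(1) S'(1)])
qed

end
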